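(* Let $k$ be a number field with Loxton pair $(B,E)$ (for the fixed Loxton function $L$), let $h \in k^{\mathrm{cyc}}(x)$ be a nonconstant rational function, and let $A \ge 1$ be a real number. Then $h$ is $P_A$-avoiding over $k^{\mathrm{cyc}}$, i.e. the set $\{\alpha \in k^{\mathrm{cyc}} : h(\alpha) \in P_A\}$ is finite, unless there exists an $A$-short witness for $h$.
   Context: $\mathbb U\subseteq\mathbb C$ denotes the set of roots of unity, and $k^{\mathrm{cyc}} = k(\mathbb U)$ is the cyclotomic closure of the number field $k$. The house $\lceil\alpha\rceil$ of an algebraic number $\alpha$ is the maximum of $|\beta|$ over all $\mathbb Q$-Galois conjugates $\beta$ of $\alpha$. For real $A\ge 1$, $P_A$ is the set of algebraic integers with house at most $A$. A rational function $h\in F(x)$ is $P$-avoiding over $F$ if $\{\alpha\in F: h(\alpha)\in P\}$ is finite. Loxton function and pairs: there is a fixed function $L:\mathbb R_+\to\mathbb R_+$ such that for every number field $k$ one can fix a real number $B>0$ and a subset $E\subseteq k$ with $\#E\le[k:\mathbb Q]$ with the property that every algebraic integer $\alpha\in k^{\mathrm{cyc}}$ can be written as $\sum_{i=1}^d e_i\xi_i$ with $e_i\in E$, $\xi_i\in\mathbb U$ and $d\le L(B\cdot\lceil\alpha\rceil)$. Such a fixed $(B,E)$ is the Loxton pair of $k$, and $L$ is fixed throughout. Witness: for $h\in k^{\mathrm{cyc}}(x)$, if there exist a nonconstant $S\in k^{\mathrm{cyc}}(x)$, integers $n_i$, roots of unity $\beta_i\in\mathbb U$ and $e_i\in E$ ($i=1,\dots,d$)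 with $\sum_{i=1}^d \beta_i e_i x^{n_i} = h(S(x))$, then $\sum_{i=1}^d\beta_ie_ix^{n_i}$ is called a witness for $h$; it is $A$-short if $d\le L(AB)$.
   Formalization: The Loxton function L is additionally assumed nondecreasing on [0,∞); without this, L could be changed to 0 at a point AB that is not of the form B'·house, and the claim would fail for h = x. *)

theory Defs
  imports
    "HOL-Computational_Algebra.Computational_Algebra"
    "HOL-Computational_Algebra.Field_as_Ring"
begin

section \<open>Number fields and cyclotomic closures inside the complex numbers\<close>

global_interpretation rat_vs: vector_space "\<lambda>(q :: rat) (z :: complex). of_rat q * z"
  by unfold_locales (simp_all add: algebra_simps of_rat_add of_rat_mult)

definition complex_subfield :: "complex set \<Rightarrow> bool" where
  "complex_subfield F \<longleftrightarrow> 0 \<in> F \<and> 1 \<in> F \<and>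
     (\<forall>x\<in>F. \<forall>y\<in>F. x + y \<in> F \<and> x * y \<in> F) \<and>
     (\<forall>x\<in>F. - x \<in> F \<and> inverse x \<in> F)"

definition number_field :: "complex set \<Rightarrow> bool" where
  "number_field K \<longleftrightarrow> complex_subfield K \<and> (\<exists>X. finite X \<and> K \<subseteq> rat_vs.span X)"

definition roots_of_unity :: "complex set" where
  "roots_of_unity = {z. \<exists>n::nat. n > 0 \<and> z ^ n = 1}"

definition field_adjoin :: "complex set \<Rightarrow> complex set \<Rightarrow> complex set" where
  "field_adjoin K X = \<Inter>{F. complex_subfield F \<and> K \<subseteq> F \<and> X \<subseteq> F}"

definition cyc_closure :: "complex set \<Rightarrow> complex set" where
  "cyc_closure K = field_adjoin K roots_of_unity"


section \<open>House\<close>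

definition rat_conjugates :: "complex \<Rightarrow> complex set" where
  "rat_conjugates a = {b. \<exists>p :: rat poly. irreducible p \<and>
     poly (map_poly of_rat p) a = 0 \<and> poly (map_poly of_rat p) b = 0}"

text \<open>Only meaningful for algebraic \<open>a\<close>; then the set of conjugates is finite and nonempty.\<close>

definition house :: "complex \<Rightarrow> real" where
  "house a = Max (cmod ` rat_conjugates a)"

definition bounded_house_ints :: "real \<Rightarrow> complex set" where
  "bounded_house_ints A = {a. algebraic_int a \<and> house a \<le> A}"


section \<open>Rational functions\<close>

text \<open>The field \<open>F(x)\<close>, for a subfield \<open>F\<close> of the complex numbers, is viewed inside the
  field of complex rational functions.\<close>

definition ratfuns_over :: "complex set \<Rightarrow> complex poly fract set" where
  "ratfuns_over F = {Fract p q | p q. q \<noteq> 0 \<and> (\<forall>i. coeff p i \<in> F) \<and> (\<forall>i. coeff q i \<in> F)}"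

definition ratfun_const :: "complex \<Rightarrow> complex poly fract" where
  "ratfun_const c = to_fract [:c:]"

definition ratfun_X :: "complex poly fract" where
  "ratfun_X = to_fract [:0, 1:]"

definition nonconstant :: "complex poly fract \<Rightarrow> bool" where
  "nonconstant h \<longleftrightarrow> h \<notin> range ratfun_const"

text \<open>\<open>quot_of_fract\<close> yields coprime numerator and denominator, so the poles are exactly the
  zeros of the denominator.\<close>

definition regular_at :: "complex poly fract \<Rightarrow> complex \<Rightarrow> bool" where
  "regular_at h a \<longleftrightarrow> poly (snd (quot_of_fract h)) a \<noteq> 0"

definition ratfun_eval :: "complex poly fract \<Rightarrow> complex \<Rightarrow> complex" where
  "ratfun_eval h a = poly (fst (quot_of_fract h)) a / poly (snd (quot_of_fract h)) a"

text \<open>Composition \<open>h(S(x))\<close>. For nonconstant \<open>S\<close> the denominator below is nonzero.\<close>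

definition ratfun_compose :: "complex poly fract \<Rightarrow> complex poly fract \<Rightarrow> complex poly fract" where
  "ratfun_compose h S =
     poly (map_poly ratfun_const (fst (quot_of_fract h))) S /
     poly (map_poly ratfun_const (snd (quot_of_fract h))) S"

text \<open>A pole of \<open>h\<close> has \<open>h\<close>-value \<open>\<infinity>\<close>, which never lies in \<open>P\<close>.\<close>

definition avoiding :: "complex set \<Rightarrow> complex set \<Rightarrow> complex poly fract \<Rightarrow> bool" where
  "avoiding P F h \<longleftrightarrow> finite {a \<in> F. regular_at h a \<and> ratfun_eval h a \<in> P}"


section \<open>Loxton pairs and witnesses\<close>

definition loxton_pair :: "(real \<Rightarrow> real) \<Rightarrow> complex set \<Rightarrow> real \<Rightarrow> complex set \<Rightarrow> bool" where
  "loxton_pair L K B E \<longleftrightarrow> B > 0 \<and> E \<subseteq> K \<and> finite E \<and> card E \<le> rat_vs.dim K \<and>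
     (\<forall>a \<in> cyc_closure K. algebraic_int a \<longrightarrow>
        (\<exists>(d :: nat) e \<xi>. real d \<le> L (B * house a) \<and>
           (\<forall>i\<in>{1..d}. e i \<in> E \<and> \<xi> i \<in> roots_of_unity) \<and>
           a = (\<Sum>i=1..d. e i * \<xi> i)))"

text \<open>Monotonicity of \<open>L\<close>, needed to pass from \<open>house a \<le> A\<close> to \<open>L (B * house a) \<le> L (A * B)\<close>,
  is not part of this definition; it is a separate assumption wherever it is used.\<close>

definition loxton_function :: "(real \<Rightarrow> real) \<Rightarrow> bool" where
  "loxton_function L \<longleftrightarrow> (\<forall>x\<ge>0. L x \<ge> 0) \<and>
     (\<forall>K. number_field K \<longrightarrow> (\<exists>B E. loxton_pair L K B E))"

text \<open>\<open>witness_of_length K E h d w\<close>: \<open>w\<close> is a witness for \<open>h\<close>, written with \<open>d\<close> summands.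
  The exponents \<open>n i\<close> may be negative and need not be distinct.\<close>

definition witness_of_length ::
    "complex set \<Rightarrow> complex set \<Rightarrow> complex poly fract \<Rightarrow> nat \<Rightarrow> complex poly fract \<Rightarrow> bool" where
  "witness_of_length K E h d w \<longleftrightarrow>
     (\<exists>S (n :: nat \<Rightarrow> int) \<beta> e.
        S \<in> ratfuns_over (cyc_closure K) \<and> nonconstant S \<and>
        (\<forall>i\<in>{1..d}. \<beta> i \<in> roots_of_unity \<and> e i \<in> E) \<and>
        w = (\<Sum>i=1..d. ratfun_const (\<beta> i * e i) * ratfun_X powi n i) \<and>
        w = ratfun_compose h S)"

definition short_witness ::
    "(real \<Rightarrow> real) \<Rightarrow> complex set \<Rightarrow> real \<Rightarrow> complex set \<Rightarrow> real \<Rightarrow>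
     complex poly fract \<Rightarrow> complex poly fract \<Rightarrow> bool" where
  "short_witness L K B E A h w \<longleftrightarrow>
     (\<exists>d. witness_of_length K E h d w \<and> real d \<le> L (A * B))"

end

theory Submission
  imports Defs "Jordan_Normal_Form.Char_Poly" "HOL-Number_Theory.Totient"
begin

text \<open>Write \<open>h = p / q\<close> in lowest terms. If \<open>\<alpha>\<close> lies in \<open>F = cyc_closure k\<close> and \<open>y = h \<alpha>\<close> is
  an algebraic integer of house at most \<open>A\<close>, then \<open>1 / q \<alpha>\<close> and \<open>\<alpha> / q \<alpha>\<close> are integral over
  \<open>F[y]\<close>, so both have uniformly bounded denominator and house. By the Loxton property
  of \<open>k\<close> itself, \<open>y\<close> and suitable multiples of these two quotients are sums of boundedly many terms
  \<open>e * \<xi>\<close> with \<open>e \<in> E\<close> and \<open>\<xi>\<close> a root of unity. If there are infinitely many such \<open>\<alpha>\<close>, then for one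
  of them the roots of unity \<open>\<xi>\<close> in a shortest such representation have a large common order \<open>M\<close>.
  By the pigeonhole principle they can be written as \<open>b * \<zeta> powi w\<close>, where \<open>b ^ g = 1\<close> and \<open>\<bar>w\<bar> * g\<close>
  is much smaller than \<open>totient M\<close>. As \<open>\<zeta>\<close> has degree at least of order \<open>totient M / g\<close> over a number
  field containing all \<open>b\<close>, the relations between the three sums persist when \<open>\<zeta>\<close> is
  replaced by an indeterminate. The quotient of the two auxiliary sums then becomes the
  required \<open>S\<close>, and the first sum becomes the witness.\<close>

section \<open>Integrality over subrings\<close>

text \<open>The point \<alpha> itself cannot be bounded. For \<open>h = 1 / x\<close> the points
  \<alpha> = 1 / (1 - \<zeta>), with \<zeta> a root of unity of prime order, have unbounded
  denominators and house, although 1 - \<zeta> is an algebraic integer of house at most 2. What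
  stays bounded is the pair \<open>1 / q \<alpha>\<close>, \<open>\<alpha> / q \<alpha>\<close> up
  to a fixed denominator, so \<open>S\<close> arises as a quotient. Only the sum for
  \<open>h \<alpha>\<close> decides about shortness; for the other two any bound independent of
  \<alpha> will do.

  The pigeonhole principle needs \<open>K ^ N < M\<close>, where \<open>N\<close> bounds the total
  number of terms and \<open>K\<close> is a constant times an upper bound for
  \<open>M / totient M\<close>. This ratio is at most 1 plus the number of prime factors of
  \<open>M\<close>, so \<open>K\<close> is of order log \<open>M\<close> and a large
  \<open>M\<close> suffices.

  Degrees of fields enter only through upper bounds: a number field is a subring spanned over the
  rationals by a finite set \<open>X\<close>, and \<open>card X\<close> takes the place of its
  degree.\<close>

locale subring_set =
  fixes A :: "'a :: comm_ring_1 set"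
  assumes one_mem: "1 \<in> A"
    and add_mem: "x \<in> A \<Longrightarrow> y \<in> A \<Longrightarrow> x + y \<in> A"
    and uminus_mem: "x \<in> A \<Longrightarrow> - x \<in> A"
    and mult_mem: "x \<in> A \<Longrightarrow> y \<in> A \<Longrightarrow> x * y \<in> A"
begin

lemma zero_mem: "0 \<in> A"
  using add_mem[OF one_mem uminus_mem[OF one_mem]] by simp

lemma diff_mem: "x \<in> A \<Longrightarrow> y \<in> A \<Longrightarrow> x - y \<in> A"
  using add_mem[of x "- y"] uminus_mem by simp

lemma sum_mem: "(\<And>i. i \<in> I \<Longrightarrow> f i \<in> A) \<Longrightarrow> sum f I \<in> A"
  by (induction I rule: infinite_finite_induct) (auto intro: zero_mem add_mem)

lemma prod_mem: "(\<And>i. i \<in> I \<Longrightarrow> f i \<in> A) \<Longrightarrow> prod f I \<in> A"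
  by (induction I rule: infinite_finite_induct) (auto intro: one_mem mult_mem)

lemma power_mem: "x \<in> A \<Longrightarrow> x ^ n \<in> A"
  by (induction n) (auto intro: one_mem mult_mem)

lemma sum_list_mem: "(\<And>x. x \<in> set xs \<Longrightarrow> f x \<in> A) \<Longrightarrow> sum_list (map f xs) \<in> A"
  by (induction xs) (auto intro: zero_mem add_mem)

lemma of_nat_mem: "of_nat n \<in> A"
  by (induction n) (auto intro: zero_mem one_mem add_mem)

end

lemma subring_set_Ints: "subring_set (\<int> :: 'a :: comm_ring_1 set)"
  by unfold_locales auto

lemma subring_set_Rats: "subring_set (\<rat> :: 'a :: field_char_0 set)"
  by unfold_locales auto

section \<open>Polynomials with coefficients in a subring\<close>

definition polys_over :: "'a :: zero set \<Rightarrow> 'a poly set" where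
  "polys_over A = {p. \<forall>i. coeff p i \<in> A}"

lemma coeff_mem: "p \<in> polys_over A \<Longrightarrow> coeff p i \<in> A"
  by (simp add: polys_over_def)

lemma polys_over_mono: "A \<subseteq> B \<Longrightarrow> polys_over A \<subseteq> polys_over B"
  by (auto simp: polys_over_def)

lemma pCons_mem_polys_over [simp]: "pCons a p \<in> polys_over A \<longleftrightarrow> a \<in> A \<and> p \<in> polys_over A"
proof
  assume "pCons a p \<in> polys_over A"
  hence "coeff (pCons a p) i \<in> A" for i by (auto simp: polys_over_def)
  from this[of 0] this[of "Suc _"] show "a \<in> A \<and> p \<in> polys_over A"
    by (auto simp: polys_over_def)
qed (auto simp: polys_over_def coeff_pCons split: nat.splits)

context subring_set
begin

lemma zero_mem_polys_over [simp]: "0 \<in> polys_over A"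
  by (simp add: polys_over_def zero_mem)

lemma subring_set_polys_over: "subring_set (polys_over A)"
proof
  fix p q :: "'a poly"
  assume "p \<in> polys_over A" "q \<in> polys_over A"
  thus "p + q \<in> polys_over A" "p * q \<in> polys_over A"
    by (auto simp: polys_over_def coeff_mult intro!: add_mem sum_mem mult_mem)
qed (auto simp: polys_over_def one_mem zero_mem coeff_1 intro: uminus_mem)

interpretation polys: subring_set "polys_over A"
  by (rule subring_set_polys_over)

lemma monom_mem_polys_over: "c \<in> A \<Longrightarrow> monom c n \<in> polys_over A"
  by (auto simp: polys_over_def zero_mem)

lemma smult_mem_polys_over: "c \<in> A \<Longrightarrow> p \<in> polys_over A \<Longrightarrow> Polynomial.smult c p \<in> polys_over A"
  by (auto simp: polys_over_def mult_mem)

lemma poly_mem: "p \<in> polys_over A \<Longrightarrow> x \<in> A \<Longrightarrow> poly p x \<in> A"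
  by (auto simp: poly_altdef polys_over_def intro!: sum_mem mult_mem power_mem)

lemma pcompose_mem_polys_over: "p \<in> polys_over A \<Longrightarrow> q \<in> polys_over A \<Longrightarrow> pcompose p q \<in> polys_over A"
  by (induction p) (auto simp: pcompose_pCons zero_mem intro!: polys.add_mem polys.mult_mem)

lemma division_monic:
  assumes "m \<in> polys_over A" "lead_coeff m = 1" "f \<in> polys_over A"
  shows "\<exists>s\<in>polys_over A. \<exists>r\<in>polys_over A. f = s * m + r \<and> (r = 0 \<or> degree r < degree m)"
  using assms(3)
proof (induction "degree f" arbitrary: f rule: less_induct)
  case less
  show ?case
  proof (cases "f = 0 \<or> degree f < degree m")
    case True
    thus ?thesis using less.prems by (intro bexI[of _ 0] bexI[of _ f]) auto
  next
    case False
    define t where "t = monom (lead_coeff f) (degree f - degree m)"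
    define f' where "f' = f - t * m"
    have t: "t \<in> polys_over A"
      unfolding t_def using less.prems by (intro monom_mem_polys_over coeff_mem)
    have f': "f' \<in> polys_over A"
      unfolding f'_def by (intro polys.diff_mem polys.mult_mem less.prems t assms(1))
    have "f' = 0 \<or> degree f' < degree f"
    proof (rule disjCI)
      assume "\<not> degree f' < degree f"
      have "degree (t * m) \<le> degree f"
        using degree_mult_le[of t m] degree_monom_le[of "lead_coeff f" "degree f - degree m"] False
        unfolding t_def by linarith
      hence "degree f' \<le> degree f"
        unfolding f'_def by (intro degree_diff_le) auto
      moreover have "coeff f' (degree f) = 0"
        using False assms(2) by (simp add: f'_def t_def coeff_monom_mult)
      ultimately show "f' = 0"
        using \<open>\<not> degree f' < degree f\<close> by (metis leading_coeff_0_iff le_antisym not_less)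
    qed
    \<comment> \<open>The case \<open>f' = 0\<close> is treated apart: if \<open>f\<close> is a
      constant, the degree does not drop.\<close>
    hence "\<exists>s\<in>polys_over A. \<exists>r\<in>polys_over A. f' = s * m + r \<and> (r = 0 \<or> degree r < degree m)"
    proof
      assume "f' = 0"
      thus ?thesis by (intro bexI[of _ 0] conjI disjI1) auto
    qed (rule less.hyps[OF _ f'])
    then obtain s r where sr: "s \<in> polys_over A" "r \<in> polys_over A" "f' = s * m + r"
        "r = 0 \<or> degree r < degree m"
      by blast
    have "f = (s + t) * m + r"
      using sr(3) by (simp add: f'_def algebra_simps)
    thus ?thesis
      using sr t by (intro bexI[of _ "s + t"] bexI[of _ r] polys.add_mem conjI)
  qed
qed

lemma char_poly_mem_polys_over:
  assumes "M \<in> carrier_mat n n" "\<And>i j. i < n \<Longrightarrow> j < n \<Longrightarrow> M $$ (i,j) \<in> A"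
  shows "char_poly M \<in> polys_over A"
proof -
  have "char_poly_matrix M $$ (i,j) \<in> polys_over A" if "i < n" "j < n" for i j
    using that assms polys.one_mem
    by (auto simp: char_poly_matrix_def one_mem zero_mem intro!: uminus_mem add_mem)
  moreover have "signof \<pi> \<in> polys_over A" for \<pi> :: "nat \<Rightarrow> nat"
    using polys.one_mem polys.uminus_mem[OF polys.one_mem] by (auto simp: sign_def)
  ultimately show ?thesis
    unfolding char_poly_def det_def'[OF char_poly_matrix_closed[OF assms(1)]]
    by (auto intro!: polys.sum_mem polys.mult_mem polys.prod_mem simp: permutes_in_image)
qed

end

text \<open>The nonzero vector \<open>v\<close> is an eigenvector, so \<open>t\<close> is a root of
  the characteristic polynomial, which is monic with coefficients in \<open>A\<close>. The degree is
  recorded because it later bounds degrees over the rationals.\<close>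

lemma subring_set_eigenvalue:
  fixes A :: "'a :: field set" and v :: "nat \<Rightarrow> 'a"
  assumes "subring_set A" "\<And>i j. i < n \<Longrightarrow> j < n \<Longrightarrow> M i j \<in> A"
    and "\<And>i. i < n \<Longrightarrow> t * v i = (\<Sum>j<n. M i j * v j)" and "k < n" "v k \<noteq> 0"
  shows "\<exists>p\<in>polys_over A. degree p = n \<and> lead_coeff p = 1 \<and> poly p t = 0"
proof -
  interpret subring_set A by fact
  define N where "N = mat n n (\<lambda>(i,j). M i j)"
  define w where "w = vec n v"
  have N: "N \<in> carrier_mat n n" by (simp add: N_def)
  have "N *\<^sub>v w = t \<cdot>\<^sub>v w"
    by (rule eq_vecI)
      (auto simp: N_def w_def assms(3) scalar_prod_def atLeast0LessThan intro!: sum.cong)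
  moreover have "w \<noteq> 0\<^sub>v n"
    using assms(4,5) by (metis index_vec index_zero_vec(1) w_def)
  ultimately have "eigenvalue N t"
    using N unfolding eigenvalue_def eigenvector_def by (auto simp: w_def intro!: exI[of _ w])
  hence "poly (char_poly N) t = 0"
    using eigenvalue_root_char_poly[OF N] by simp
  moreover have "char_poly N \<in> polys_over A"
    using assms(2) by (intro char_poly_mem_polys_over[OF N]) (auto simp: N_def)
  ultimately show ?thesis
    using degree_monic_char_poly[OF N] by auto
qed

section \<open>Finitely generated modules and integral closure\<close>

definition span_over :: "'a :: comm_ring_1 set \<Rightarrow> 'a set \<Rightarrow> 'a set" where
  "span_over A X = {\<Sum>x\<in>X. c x * x | c. \<forall>x\<in>X. c x \<in> A}"

lemma (in subring_set) span_over_base: "finite X \<Longrightarrow> x \<in> X \<Longrightarrow> x \<in> span_over A X"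
  unfolding span_over_def
  by (rule CollectI, rule exI[of _ "\<lambda>y. if y = x then 1 else 0"])
     (auto simp: one_mem zero_mem if_distrib[of "\<lambda>c. c * _"] cong: if_cong)

lemma (in subring_set) span_over_zero: "0 \<in> span_over A X"
  unfolding span_over_def by (rule CollectI, rule exI[of _ "\<lambda>_. 0"]) (auto simp: zero_mem)

lemma (in subring_set) span_over_add:
  assumes "u \<in> span_over A X" "v \<in> span_over A X"
  shows "u + v \<in> span_over A X"
proof -
  obtain c d where "u = (\<Sum>x\<in>X. c x * x)" "v = (\<Sum>x\<in>X. d x * x)" "\<forall>x\<in>X. c x \<in> A" "\<forall>x\<in>X. d x \<in> A"
    using assms unfolding span_over_def by auto
  thus ?thesis unfolding span_over_def
    by (intro CollectI exI[of _ "\<lambda>x. c x + d x"])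
       (auto simp: sum.distrib algebra_simps intro: add_mem)
qed

lemma (in subring_set) span_over_scale:
  assumes "u \<in> span_over A X" "a \<in> A"
  shows "a * u \<in> span_over A X"
proof -
  obtain c where "u = (\<Sum>x\<in>X. c x * x)" "\<forall>x\<in>X. c x \<in> A"
    using assms unfolding span_over_def by auto
  thus ?thesis unfolding span_over_def
    using assms(2) by (intro CollectI exI[of _ "\<lambda>x. a * c x"])
       (auto simp: sum_distrib_left algebra_simps intro: mult_mem)
qed

lemma (in subring_set) span_over_sum:
  "(\<And>i. i \<in> I \<Longrightarrow> f i \<in> span_over A X) \<Longrightarrow> sum f I \<in> span_over A X"
  by (induction I rule: infinite_finite_induct) (auto intro: span_over_zero span_over_add)

lemma (in subring_set) span_over_linear_image:
  assumes "u \<in> span_over A X" "\<And>x. x \<in> X \<Longrightarrow> t * x \<in> span_over A Y"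
  shows "t * u \<in> span_over A Y"
proof -
  obtain c where c: "u = (\<Sum>x\<in>X. c x * x)" "\<forall>x\<in>X. c x \<in> A"
    using assms unfolding span_over_def by auto
  have "t * u = (\<Sum>x\<in>X. c x * (t * x))"
    unfolding c(1) by (simp add: sum_distrib_left mult_ac)
  also have "\<dots> \<in> span_over A Y"
    using c(2) assms(2) by (intro span_over_sum) (auto intro: span_over_scale)
  finally show ?thesis .
qed

lemma (in subring_set) subring_set_span_over:
  assumes "1 \<in> span_over A X" "\<And>x y. x \<in> X \<Longrightarrow> y \<in> X \<Longrightarrow> x * y \<in> span_over A X"
  shows "subring_set (span_over A X)"
proof
  fix x y assume xy: "x \<in> span_over A X" "y \<in> span_over A X"
  have "x * z \<in> span_over A X" if "z \<in> X" for z
    using span_over_linear_image[OF xy(1), of z X] assms(2) that by (simp add: mult.commute)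
  thus "x * y \<in> span_over A X"
    using span_over_linear_image[OF xy(2), of x X] by blast
  show "- x \<in> span_over A X"
    using span_over_scale[OF xy(1) uminus_mem[OF one_mem]] by simp
qed (auto intro: assms span_over_add)

text \<open>The generators form an eigenvector for the matrix of multiplication by \<open>t\<close>;
  since \<open>1\<close> lies in their span, they are not all zero.\<close>

lemma span_over_multiplication_integral:
  fixes A :: "'a :: field set"
  assumes "subring_set A" "finite X" "1 \<in> span_over A X" "\<And>x. x \<in> X \<Longrightarrow> t * x \<in> span_over A X"
  shows "\<exists>p\<in>polys_over A. degree p = card X \<and> lead_coeff p = 1 \<and> poly p t = 0"
proof -
  define n where "n = card X"
  obtain v where v: "bij_betw v {..<n} X"
    using ex_bij_betw_nat_finite[OF assms(2)] by (auto simp: n_def atLeast0LessThan)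
  have "\<forall>x\<in>X. \<exists>c. t * x = (\<Sum>y\<in>X. c y * y) \<and> (\<forall>y\<in>X. c y \<in> A)"
    using assms(4) by (auto simp: span_over_def)
  from bchoice[OF this] obtain c where
    "\<forall>x\<in>X. t * x = (\<Sum>y\<in>X. c x y * y) \<and> (\<forall>y\<in>X. c x y \<in> A)" ..
  hence c: "\<And>x. x \<in> X \<Longrightarrow> t * x = (\<Sum>y\<in>X. c x y * y)" "\<And>x y. x \<in> X \<Longrightarrow> y \<in> X \<Longrightarrow> c x y \<in> A"
    by auto
  have vX: "v i \<in> X" if "i < n" for i
    using v that by (auto simp: bij_betw_def)
  have "\<exists>x\<in>X. x \<noteq> 0"
  proof (rule ccontr)
    assume "\<not> (\<exists>x\<in>X. x \<noteq> 0)"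
    hence "z = 0" if "z \<in> span_over A X" for z
      using that by (auto simp: span_over_def intro!: sum.neutral)
    thus False using assms(3) by force
  qed
  then obtain k where "k < n" "v k \<noteq> 0"
    using v by (metis bij_betw_iff_bijections lessThan_iff)
  moreover have "t * v i = (\<Sum>j<n. c (v i) (v j) * v j)" if "i < n" for i
    using c(1)[OF vX[OF that]] sum.reindex_bij_betw[OF v, of "\<lambda>y. c (v i) y * y"] by simp
  ultimately show ?thesis
    using subring_set_eigenvalue[OF assms(1), of n "\<lambda>i j. c (v i) (v j)" t v k] c(2) vX
    by (simp add: n_def)
qed

text \<open>The generators are the \<open>t ^ i * x\<close> with \<open>i < degree f\<close>, and
  the monic relation reduces \<open>t ^ degree f\<close>. The estimate of \<open>card Y\<close> is
  the tower law as an inequality: generators may be dependent, so \<open>f\<close> may be any monic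
  relation.\<close>

lemma span_over_adjoin:
  fixes A :: "'a :: field set"
  assumes "subring_set A" "finite X" "subring_set (span_over A X)"
    and "f \<in> polys_over (span_over A X)" "lead_coeff f = 1" "poly f t = 0"
  shows "\<exists>Y. finite Y \<and> card Y \<le> degree f * card X \<and> subring_set (span_over A Y)
    \<and> span_over A X \<subseteq> span_over A Y \<and> t \<in> span_over A Y"
proof -
  interpret A: subring_set A by fact
  interpret R: subring_set "span_over A X" by fact
  define n where "n = degree f"
  define Y where "Y = (\<lambda>(i,x). t ^ i * x) ` ({..<n} \<times> X)"
  have finY: "finite Y" using assms(2) by (simp add: Y_def)
  have cardY: "card Y \<le> n * card X"
    unfolding Y_def using card_image_le[of "{..<n} \<times> X" "\<lambda>(i,x). t ^ i * x"] assms(2)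
    by (simp add: card_cartesian_product)
  have n: "n > 0"
  proof (rule ccontr)
    assume "\<not> n > 0"
    then obtain c where "f = [:c:]" by (metis degree_eq_zeroE n_def neq0_conv)
    with assms(5,6) show False by simp
  qed
  have base: "t ^ i * u \<in> span_over A Y" if "i < n" "u \<in> span_over A X" for i u
    using that by (intro A.span_over_linear_image[OF that(2)] A.span_over_base[OF finY])
      (auto simp: Y_def)
  have top: "t ^ n * u \<in> span_over A Y" if "u \<in> span_over A X" for u
  proof -
    have "0 = (\<Sum>i\<le>n. coeff f i * t ^ i)"
      using assms(6) by (simp add: poly_altdef n_def)
    also have "\<dots> = (\<Sum>i<n. coeff f i * t ^ i) + t ^ n"
      using assms(5) by (simp add: n_def lessThan_Suc_atMost [symmetric])
    finally have eq: "t ^ n = (\<Sum>i<n. - coeff f i * t ^ i)"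
      by (simp add: sum_negf eq_neg_iff_add_eq_0 add.commute)
    have "t ^ n * u = (\<Sum>i<n. t ^ i * (- coeff f i * u))"
      unfolding eq sum_distrib_right by (intro sum.cong) (simp_all add: mult_ac)
    also have "\<dots> \<in> span_over A Y"
      using assms(4) that
      by (intro A.span_over_sum base R.mult_mem R.uminus_mem) (auto simp: coeff_mem)
    finally show ?thesis .
  qed
  have t_mult: "t * y \<in> span_over A Y" if "y \<in> span_over A Y" for y
  proof (rule A.span_over_linear_image[OF that])
    fix z assume "z \<in> Y"
    then obtain i x where z: "i < n" "x \<in> X" "z = t ^ i * x" by (auto simp: Y_def)
    have x: "x \<in> span_over A X" by (rule A.span_over_base[OF assms(2) z(2)])
    show "t * z \<in> span_over A Y"
    proof (cases "Suc i = n")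
      case True
      have "t * z = t ^ n * x" by (simp add: z flip: True)
      thus ?thesis using top[OF x] by simp
    next
      case False
      thus ?thesis using base[of "Suc i", OF _ x] z by (simp add: mult_ac)
    qed
  qed
  have t_pow: "t ^ i * y \<in> span_over A Y" if "y \<in> span_over A Y" for y i
    using that by (induction i) (auto simp: mult.assoc intro: t_mult)
  have sub: "span_over A X \<subseteq> span_over A Y"
    using base[of 0] n by auto
  have u_mult: "u * y \<in> span_over A Y" if "u \<in> span_over A X" "y \<in> span_over A Y" for u y
  proof (rule A.span_over_linear_image[OF that(2)])
    fix z assume "z \<in> Y"
    then obtain i x where z: "i < n" "x \<in> X" "z = t ^ i * x" by (auto simp: Y_def)
    have "u * z = t ^ i * (u * x)" by (simp add: z)
    also have "\<dots> \<in> span_over A Y"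
      by (intro base z R.mult_mem that A.span_over_base[OF assms(2)])
    finally show "u * z \<in> span_over A Y" .
  qed
  have "subring_set (span_over A Y)"
  proof (rule A.subring_set_span_over)
    show one: "1 \<in> span_over A Y" using R.one_mem sub by blast
    fix y z assume "y \<in> Y" "z \<in> Y"
    then obtain i x where y: "i < n" "x \<in> X" "y = t ^ i * x" by (auto simp: Y_def)
    have "t ^ i * (x * z) \<in> span_over A Y"
      using \<open>z \<in> Y\<close> y(2) by (intro t_pow u_mult A.span_over_base finY assms(2))
    thus "y * z \<in> span_over A Y" by (simp add: y mult.assoc)
  qed
  moreover have "t \<in> span_over A Y"
    using t_mult[of 1] sub R.one_mem by auto
  ultimately show ?thesis
    using finY cardY sub unfolding n_def by blast
qed

text \<open>One notion serves twice: over the integers it yields the algebraic integers, over a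
  subfield the algebraic elements.\<close>

definition integral_closure :: "'a :: field set \<Rightarrow> 'a set" where
  "integral_closure A = {t. \<exists>p\<in>polys_over A. lead_coeff p = 1 \<and> poly p t = 0}"

lemma span_over_singleton_1: "span_over A {1} = A"
  by (auto simp: span_over_def)

lemma integral_closure_finite_span:
  assumes "subring_set A" "finite T" "T \<subseteq> integral_closure A"
  shows "\<exists>X. finite X \<and> subring_set (span_over A X) \<and> A \<subseteq> span_over A X \<and> T \<subseteq> span_over A X"
  using assms(2,3)
proof (induction T)
  case empty
  show ?case
    using assms(1) by (intro exI[of _ "{1}"]) (auto simp: span_over_singleton_1)
next
  case (insert t T)
  then obtain X where X: "finite X" "subring_set (span_over A X)" "A \<subseteq> span_over A X" "T \<subseteq> span_over A X"
    by auto
  obtain p where p: "p \<in> polys_over A" "lead_coeff p = 1" "poly p t = 0"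
    using insert.prems by (auto simp: integral_closure_def)
  show ?case
    using span_over_adjoin[OF assms(1) X(1,2) subsetD[OF polys_over_mono[OF X(3)] p(1)] p(2,3)] X(3,4)
    by auto
qed

lemma span_over_subset_integral_closure:
  assumes "subring_set A" "finite X" "subring_set (span_over A X)"
  shows "span_over A X \<subseteq> integral_closure A"
proof
  fix t assume t: "t \<in> span_over A X"
  interpret A: subring_set A by fact
  interpret R: subring_set "span_over A X" by fact
  have "t * x \<in> span_over A X" if "x \<in> X" for x
    by (rule R.mult_mem[OF t A.span_over_base[OF assms(2) that]])
  thus "t \<in> integral_closure A"
    using span_over_multiplication_integral[OF assms(1,2) R.one_mem, of t]
    by (auto simp: integral_closure_def)
qed

lemma subset_integral_closure:
  assumes "subring_set A"
  shows "A \<subseteq> integral_closure A"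
proof
  fix a assume "a \<in> A"
  interpret subring_set A by fact
  show "a \<in> integral_closure A"
    unfolding integral_closure_def using \<open>a \<in> A\<close>
    by (intro CollectI bexI[of _ "[:- a, 1:]"]) (auto simp: one_mem uminus_mem)
qed

lemma subring_set_integral_closure:
  assumes "subring_set A"
  shows "subring_set (integral_closure A)"
proof
  interpret subring_set A by fact
  fix x y assume "x \<in> integral_closure A" "y \<in> integral_closure A"
  hence "finite {x, y}" "{x, y} \<subseteq> integral_closure A" by auto
  from integral_closure_finite_span[OF assms this] obtain X where
    X: "finite X" "subring_set (span_over A X)" and "{x, y} \<subseteq> span_over A X"
    by (elim exE conjE)
  hence xy: "x \<in> span_over A X" "y \<in> span_over A X" by simp_all
  interpret R: subring_set "span_over A X" by fact
  show "x + y \<in> integral_closure A" "x * y \<in> integral_closure A" "- x \<in> integral_closure A"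
    using span_over_subset_integral_closure[OF assms X]
      R.add_mem[OF xy] R.mult_mem[OF xy] R.uminus_mem[OF xy(1)] by (simp_all add: subset_iff)
qed (use subset_integral_closure[OF assms] subring_set.one_mem[OF assms] in auto)

text \<open>Only finitely many coefficients occur in the relation for \<open>t\<close>; they lie in
  one ring that is finite over \<open>A\<close>, and adjoining \<open>t\<close> to it keeps it
  finite.\<close>

lemma integral_closure_idem:
  assumes "subring_set A"
  shows "integral_closure (integral_closure A) \<subseteq> integral_closure A"
proof
  fix t assume "t \<in> integral_closure (integral_closure A)"
  then obtain p where p: "p \<in> polys_over (integral_closure A)" "lead_coeff p = 1" "poly p t = 0"
    by (auto simp: integral_closure_def)
  interpret subring_set A by fact
  have "finite (coeff p ` {..degree p})" "coeff p ` {..degree p} \<subseteq> integral_closure A"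
    using p(1) by (auto simp: coeff_mem)
  from integral_closure_finite_span[OF assms this] obtain X where
    X: "finite X" "subring_set (span_over A X)" "coeff p ` {..degree p} \<subseteq> span_over A X"
    by (elim exE conjE)
  have "coeff p i \<in> span_over A X" for i
    using X(3) span_over_zero by (cases "i \<le> degree p") (auto simp: coeff_eq_0)
  hence "p \<in> polys_over (span_over A X)" by (simp add: polys_over_def)
  from span_over_adjoin[OF assms X(1,2) this p(2,3)] show "t \<in> integral_closure A"
    using span_over_subset_integral_closure[OF assms] by blast
qed

text \<open>A relation with nonzero constant term expresses \<open>inverse t\<close> as a polynomial
  in \<open>t\<close>; the induction strips off factors of the variable until the constant term is
  nonzero.\<close>

lemma inverse_mem_of_algebraic:
  fixes A :: "'a :: field set"
  assumes "subring_set A" "\<And>a. a \<in> A \<Longrightarrow> inverse a \<in> A"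
    and "subring_set R" "A \<subseteq> R" "t \<in> R" "p \<in> polys_over A" "p \<noteq> 0" "poly p t = 0"
  shows "inverse t \<in> R"
  using assms(6-8)
proof (induction p)
  case (pCons a p)
  interpret A: subring_set A by fact
  interpret R: subring_set R by fact
  show ?case
  proof (cases "a = 0 \<or> t = 0")
    case True
    thus ?thesis using pCons R.zero_mem by auto
  next
    case False
    have "t * poly p t = - a" using pCons.prems by (simp add: eq_neg_iff_add_eq_0 add.commute)
    hence "inverse t = - (poly p t * inverse a)"
      using False by (simp add: field_simps)
    also have "\<dots> \<in> R"
      using pCons.prems assms(2,4,5) polys_over_mono[OF assms(4)]
      by (intro R.uminus_mem R.mult_mem R.poly_mem) auto
    finally show ?thesis .
  qed
qed auto

section \<open>Algebraic numbers, algebraic integers and number fields\<close>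

lemma algebraic_int_iff_integral_closure: "algebraic_int x \<longleftrightarrow> x \<in> integral_closure \<int>"
  by (auto simp: integral_closure_def polys_over_def algebraic_int.simps)

lemma algebraic_iff_integral_closure: "algebraic x \<longleftrightarrow> x \<in> integral_closure \<rat>"
proof
  assume "algebraic x"
  then obtain p where p: "\<And>i. coeff p i \<in> \<rat>" "p \<noteq> 0" "poly p x = 0"
    by (auto simp: algebraic_altdef)
  show "x \<in> integral_closure \<rat>"
    unfolding integral_closure_def using p
    by (intro CollectI bexI[of _ "Polynomial.smult (inverse (lead_coeff p)) p"])
       (auto simp: polys_over_def)
qed (force simp: integral_closure_def polys_over_def algebraic_altdef)

interpretation alg_ints: subring_set "{x :: 'a :: field_char_0. algebraic_int x}"
  using subring_set_integral_closure[OF subring_set_Ints]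
  by (simp add: algebraic_int_iff_integral_closure)

interpretation algs: subring_set "{x :: 'a :: field_char_0. algebraic x}"
  using subring_set_integral_closure[OF subring_set_Rats]
  by (simp add: algebraic_iff_integral_closure)

lemma complex_subfield_algebraic: "complex_subfield {x. algebraic x}"
  unfolding complex_subfield_def
  using algs.zero_mem algs.one_mem algs.add_mem algs.mult_mem by auto

lemma algebraic_multiple_algebraic_int:
  fixes x :: "'a :: field_char_0"
  assumes "algebraic x"
  shows "\<exists>n::nat. n > 0 \<and> algebraic_int (of_nat n * x)"
proof -
  obtain p where p: "\<And>i. coeff p i \<in> \<int>" "p \<noteq> 0" "poly p x = 0"
    using assms by (auto simp: algebraic_def)
  define l d where "l = lead_coeff p" and "d = degree p"
  have l: "l \<in> \<int>" "l \<noteq> 0" using p by (auto simp: l_def)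
  have d: "d > 0"
  proof (rule ccontr)
    assume "\<not> d > 0"
    then obtain c where "p = [:c:]" by (metis degree_eq_zeroE d_def neq0_conv)
    thus False using p by simp
  qed
  \<comment> \<open>This is \<open>l ^ (d - 1) * p (X / l)\<close>, monic with integral coefficients
    and with root \<open>l * x\<close>.\<close>
  define q where "q = monom 1 d + (\<Sum>i<d. monom (coeff p i * l ^ (d - 1 - i)) i)"
  have coeff_q: "coeff q i = (if i = d then 1 else if i < d then coeff p i * l ^ (d - 1 - i) else 0)" for i
    by (auto simp: q_def coeff_sum if_distrib[of "\<lambda>c. c * _"] sum.delta' cong: if_cong)
  have deg: "degree q = d"
    by (rule antisym[OF degree_le le_degree]) (auto simp: coeff_q)
  have "poly q (l * x) = l ^ d * x ^ d + (\<Sum>i<d. coeff p i * l ^ (d - 1 - i) * (l * x) ^ i)"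
    by (simp add: q_def poly_monom poly_sum power_mult_distrib)
  also have "l ^ d = l ^ (d - 1) * l"
    using d by (simp flip: power_Suc2)
  also have "(\<Sum>i<d. coeff p i * l ^ (d - 1 - i) * (l * x) ^ i) = l ^ (d - 1) * (\<Sum>i<d. coeff p i * x ^ i)"
    unfolding sum_distrib_left
  proof (rule sum.cong)
    fix i assume "i \<in> {..<d}"
    hence "l ^ (d - 1) = l ^ (d - 1 - i) * l ^ i" by (simp flip: power_add)
    thus "coeff p i * l ^ (d - 1 - i) * (l * x) ^ i = l ^ (d - 1) * (coeff p i * x ^ i)"
      by (simp add: power_mult_distrib)
  qed auto
  also have "l ^ (d - 1) * l * x ^ d + \<dots> = l ^ (d - 1) * poly p x"
    by (simp add: poly_altdef d_def [symmetric] l_def lessThan_Suc_atMost [symmetric] algebra_simps)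
  finally have "poly q (l * x) = 0" using p by simp
  hence int: "algebraic_int (l * x)"
    using l p(1) by (intro algebraic_int.intros[of q]) (auto simp: deg coeff_q)
  obtain z where z: "l = of_int z" using l(1) by (auto elim: Ints_cases)
  have "of_nat (nat \<bar>z\<bar>) * x = l * x \<or> of_nat (nat \<bar>z\<bar>) * x = - (l * x)"
    by (cases "z \<ge> 0") (auto simp: z)
  thus ?thesis
    using int l(2) by (intro exI[of _ "nat \<bar>z\<bar>"]) (auto simp: z)
qed

lemma common_multiple_algebraic_int:
  fixes T :: "'a :: field_char_0 set"
  assumes "finite T" "\<And>x. x \<in> T \<Longrightarrow> algebraic x"
  shows "\<exists>n::nat. n > 0 \<and> (\<forall>x\<in>T. algebraic_int (of_nat n * x))"
  using assms
proof (induction T)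
  case (insert x T)
  then obtain n where n: "n > 0" "\<forall>x\<in>T. algebraic_int (of_nat n * x)" by auto
  obtain m where m: "m > 0" "algebraic_int (of_nat m * x)"
    using algebraic_multiple_algebraic_int[of x] insert.prems by auto
  have nat: "algebraic_int (of_nat j :: 'a)" for j using alg_ints.of_nat_mem[of j] by simp
  have "algebraic_int (of_nat (m * n) * x)"
    using alg_ints.mult_mem[of "of_nat n" "of_nat m * x"] m nat by (simp add: mult_ac)
  moreover have "algebraic_int (of_nat (m * n) * y)" if "y \<in> T" for y
    using alg_ints.mult_mem[of "of_nat m" "of_nat n * y"] n nat that by (simp add: mult_ac)
  ultimately show ?case
    using m(1) n(1) by (intro exI[of _ "m * n"]) auto
qed auto

lemma roots_of_unity_algebraic_int:
  assumes "z \<in> roots_of_unity"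
  shows "algebraic_int z"
proof -
  obtain n :: nat where n: "n > 0" "z ^ n = 1" using assms by (auto simp: roots_of_unity_def)
  have "coeff (monom 1 n - 1) i \<in> \<int>" for i :: nat by (auto simp: coeff_1)
  moreover have "degree (monom 1 n - 1 :: complex poly) = n"
    using n by (intro antisym[OF degree_le le_degree]) (auto simp: coeff_1)
  ultimately show ?thesis
    using n by (intro algebraic_int.intros[of "monom 1 n - 1"]) (auto simp: coeff_1 poly_monom)
qed

lemma complex_subfield_subring_set:
  assumes "complex_subfield K"
  shows "subring_set K"
  using assms by unfold_locales (auto simp: complex_subfield_def)

lemma Rats_subset_complex_subfield:
  assumes "complex_subfield K"
  shows "\<rat> \<subseteq> K"
proof
  fix q :: complex assume "q \<in> \<rat>"
  then obtain a b :: int where "b > 0" and q: "q = of_int a / of_int b" by (auto elim: Rats_cases')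
  interpret subring_set K by (rule complex_subfield_subring_set[OF assms])
  have int: "of_int z \<in> K" for z :: int
    using of_nat_mem[of "nat z"] uminus_mem[OF of_nat_mem[of "nat (- z)"]] by (cases "z \<ge> 0") auto
  have "of_int a * inverse (of_int b) \<in> K"
    using int assms by (intro mult_mem) (auto simp: complex_subfield_def)
  thus "q \<in> K" by (simp add: q field_simps)
qed

lemma number_field_algebraic:
  assumes "number_field K" "t \<in> K"
  shows "algebraic t"
proof -
  obtain Y where K: "complex_subfield K" and Y: "finite Y" "K \<subseteq> rat_vs.span Y"
    using assms(1) by (auto simp: number_field_def)
  interpret subring_set K by (rule complex_subfield_subring_set[OF K])
  \<comment> \<open>The given spanning set may lie outside \<open>K\<close>; a basis inside
    \<open>K\<close> ensures that \<open>t * x\<close> is again in the span.\<close>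
  obtain X where X: "X \<subseteq> K" "rat_vs.independent X" "K \<subseteq> rat_vs.span X"
    by (rule rat_vs.basis_exists[of K])
  have fin: "finite X"
    using rat_vs.independent_span_bound[OF Y(1) X(2)] X(1) Y(2) by auto
  have "K \<subseteq> span_over \<rat> X"
  proof
    fix u assume "u \<in> K"
    then obtain c where "u = (\<Sum>x\<in>X. of_rat (c x) * x)"
      using X(3) by (auto simp: rat_vs.span_finite[OF fin])
    thus "u \<in> span_over \<rat> X" by (auto simp: span_over_def)
  qed
  hence "1 \<in> span_over \<rat> X" "\<And>x. x \<in> X \<Longrightarrow> t * x \<in> span_over \<rat> X"
    using one_mem assms(2) X(1) mult_mem by auto
  from span_over_multiplication_integral[OF subring_set_Rats fin this] show ?thesis
    by (auto simp: algebraic_iff_integral_closure integral_closure_def)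
qed

lemma complex_subfield_field_adjoin: "complex_subfield (field_adjoin K X)"
  by (auto simp: complex_subfield_def field_adjoin_def)

lemma field_adjoin_subset:
  "complex_subfield F \<Longrightarrow> K \<subseteq> F \<Longrightarrow> X \<subseteq> F \<Longrightarrow> field_adjoin K X \<subseteq> F"
  by (auto simp: field_adjoin_def)

lemma subset_field_adjoin: "K \<subseteq> field_adjoin K X" "X \<subseteq> field_adjoin K X"
  by (auto simp: field_adjoin_def)

lemma cyc_closure_algebraic:
  assumes "number_field K" "t \<in> cyc_closure K"
  shows "algebraic t"
proof -
  have "cyc_closure K \<subseteq> {x. algebraic x}"
    unfolding cyc_closure_def using number_field_algebraic[OF assms(1)]
    by (intro field_adjoin_subset complex_subfield_algebraic) (auto dest: roots_of_unity_algebraic_int)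
  thus ?thesis using assms(2) by auto
qed

section \<open>Field embeddings and the house\<close>

text \<open>The cofactor \<open>s\<close> has coefficients in \<open>A\<close> as well, so a
  homomorphism defined on \<open>A\<close> alone can be applied to the factorization
  \<open>f = s * m\<close>.\<close>

lemma minimal_polynomial_over:
  fixes A :: "'a :: field set"
  assumes "subring_set A" "\<And>a. a \<in> A \<Longrightarrow> inverse a \<in> A" "t \<in> integral_closure A"
  obtains m where "m \<in> polys_over A" "lead_coeff m = 1" "poly m t = 0"
    "\<forall>f\<in>polys_over A. poly f t = 0 \<longrightarrow> (\<exists>s\<in>polys_over A. f = s * m)"
proof -
  interpret subring_set A by fact
  interpret polys: subring_set "polys_over A" by (rule subring_set_polys_over)
  define P where "P = (\<lambda>p. p \<in> polys_over A \<and> lead_coeff p = 1 \<and> poly p t = 0)"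
  obtain m where m: "P m" and min: "\<And>p. P p \<Longrightarrow> degree m \<le> degree p"
    using assms(3) ex_has_least_nat[of P _ degree] unfolding integral_closure_def P_def by blast
  have "\<exists>s\<in>polys_over A. f = s * m" if f: "f \<in> polys_over A" "poly f t = 0" for f
  proof -
    obtain s r where sr: "s \<in> polys_over A" "r \<in> polys_over A" "f = s * m + r"
        "r = 0 \<or> degree r < degree m"
      using division_monic[of m f] m f by (auto simp: P_def)
    have "r = 0"
    proof (rule ccontr)
      assume "r \<noteq> 0"
      define r' where "r' = Polynomial.smult (inverse (lead_coeff r)) r"
      have "poly r t = 0" using sr(3) f m by (simp add: P_def)
      hence "P r'"
        using sr(2) \<open>r \<noteq> 0\<close> assms(2) by (auto simp: P_def r'_def smult_mem_polys_over coeff_mem)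
      hence "degree m \<le> degree r'" by (rule min)
      thus False using sr(4) \<open>r \<noteq> 0\<close> by (simp add: r'_def)
    qed
    thus ?thesis using sr by auto
  qed
  thus ?thesis using that m by (auto simp: P_def)
qed

text \<open>A partial embedding into the complex numbers; values off \<open>K\<close> are arbitrary.
  Embeddings are extended by finitely many elements at a time, which is enough to transport one
  given equation.\<close>

definition field_hom_on :: "complex set \<Rightarrow> (complex \<Rightarrow> complex) \<Rightarrow> bool" where
  "field_hom_on K \<sigma> \<longleftrightarrow> complex_subfield K \<and> \<sigma> 1 = 1 \<and>
     (\<forall>x\<in>K. \<forall>y\<in>K. \<sigma> (x + y) = \<sigma> x + \<sigma> y \<and> \<sigma> (x * y) = \<sigma> x * \<sigma> y)"

locale complex_field_hom =
  fixes K :: "complex set" and \<sigma> :: "complex \<Rightarrow> complex"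
  assumes hom: "field_hom_on K \<sigma>"
begin

lemma subfield: "complex_subfield K"
  using hom by (simp add: field_hom_on_def)

sublocale subring_set K
  by (rule complex_subfield_subring_set[OF subfield])

lemma inverse_mem: "x \<in> K \<Longrightarrow> inverse x \<in> K"
  using subfield by (simp add: complex_subfield_def)

lemma hom_one: "\<sigma> 1 = 1"
  and hom_add: "x \<in> K \<Longrightarrow> y \<in> K \<Longrightarrow> \<sigma> (x + y) = \<sigma> x + \<sigma> y"
  and hom_mult: "x \<in> K \<Longrightarrow> y \<in> K \<Longrightarrow> \<sigma> (x * y) = \<sigma> x * \<sigma> y"
  using hom by (simp_all add: field_hom_on_def)

lemma hom_zero: "\<sigma> 0 = 0"
  using hom_add[of 0 0] zero_mem by simp

lemma hom_uminus: "x \<in> K \<Longrightarrow> \<sigma> (- x) = - \<sigma> x"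
  using hom_add[of x "- x"] by (simp add: uminus_mem hom_zero eq_neg_iff_add_eq_0 add.commute)

lemma hom_inverse:
  assumes "x \<in> K"
  shows "\<sigma> (inverse x) = inverse (\<sigma> x)"
proof (cases "x = 0")
  case False
  hence "\<sigma> x * \<sigma> (inverse x) = 1"
    using hom_mult[OF assms inverse_mem[OF assms]] by (simp add: hom_one)
  thus ?thesis by (simp add: inverse_unique)
qed (simp add: hom_zero)

lemma hom_sum: "(\<And>i. i \<in> I \<Longrightarrow> f i \<in> K) \<Longrightarrow> \<sigma> (sum f I) = (\<Sum>i\<in>I. \<sigma> (f i))"
  by (induction I rule: infinite_finite_induct) (auto simp: hom_zero hom_add sum_mem)

lemma hom_of_nat: "\<sigma> (of_nat n) = of_nat n"
  by (induction n) (auto simp: hom_zero hom_one hom_add one_mem of_nat_mem)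

lemma hom_Rats:
  assumes "q \<in> \<rat>"
  shows "\<sigma> q = q"
proof -
  from assms obtain a b :: int where "b > 0" and q: "q = of_int a / of_int b" by (auto elim: Rats_cases')
  have int: "of_int z \<in> K \<and> \<sigma> (of_int z) = of_int z" for z :: int
    using of_nat_mem[of "nat z"] of_nat_mem[of "nat (- z)"] uminus_mem[OF of_nat_mem[of "nat (- z)"]]
      hom_of_nat[of "nat z"] hom_uminus[OF of_nat_mem[of "nat (- z)"]] hom_of_nat[of "nat (- z)"]
    by (cases "z \<ge> 0") auto
  have "\<sigma> (of_int a * inverse (of_int b)) = of_int a * inverse (of_int b)"
    using int by (subst hom_mult) (auto simp: inverse_mem hom_inverse)
  thus ?thesis by (simp add: q field_simps)
qed

lemma hom_poly:
  assumes "p \<in> polys_over K" "x \<in> K"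
  shows "\<sigma> (poly p x) = poly (map_poly \<sigma> p) (\<sigma> x)"
  using assms(1)
proof (induction p)
  case (pCons a p)
  thus ?case
    using assms(2) by (simp add: map_poly_pCons hom_zero hom_add hom_mult mult_mem poly_mem)
qed (simp add: hom_zero)

lemma map_poly_hom_add:
  assumes "p \<in> polys_over K" "q \<in> polys_over K"
  shows "map_poly \<sigma> (p + q) = map_poly \<sigma> p + map_poly \<sigma> q"
  using assms by (intro poly_eqI) (auto simp: coeff_map_poly hom_zero hom_add coeff_mem)

lemma map_poly_hom_mult:
  assumes "p \<in> polys_over K" "q \<in> polys_over K"
  shows "map_poly \<sigma> (p * q) = map_poly \<sigma> p * map_poly \<sigma> q"
  using assms
  by (intro poly_eqI) (auto simp: coeff_map_poly hom_zero hom_sum hom_mult coeff_mem mult_mem coeff_mult)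

text \<open>All relations of \<open>a\<close> are multiples of its minimal polynomial, whose image
  still has leading coefficient 1 and positive degree, hence a complex root.\<close>

lemma ex_root_of_relations:
  assumes "a \<in> integral_closure K"
  shows "\<exists>b. \<forall>f\<in>polys_over K. poly f a = 0 \<longrightarrow> poly (map_poly \<sigma> f) b = 0"
proof -
  obtain m where m: "m \<in> polys_over K" "lead_coeff m = 1" "poly m a = 0"
      "\<forall>f\<in>polys_over K. poly f a = 0 \<longrightarrow> (\<exists>s\<in>polys_over K. f = s * m)"
    by (rule minimal_polynomial_over[OF subring_set_axioms inverse_mem assms])
  have "degree m > 0"
  proof (rule ccontr)
    assume "\<not> degree m > 0"
    then obtain c where "m = [:c:]" by (metis degree_eq_zeroE neq0_conv)
    thus False using m(2,3) by simp
  qed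
  have "coeff (map_poly \<sigma> m) (degree m) = 1"
    using m(2) by (simp add: coeff_map_poly hom_zero hom_one)
  hence "degree (map_poly \<sigma> m) > 0"
    using \<open>degree m > 0\<close> le_degree[of "map_poly \<sigma> m" "degree m"] by simp
  then obtain b where b: "poly (map_poly \<sigma> m) b = 0"
    using alg_closed_imp_poly_has_root by blast
  have "poly (map_poly \<sigma> f) b = 0" if "f \<in> polys_over K" "poly f a = 0" for f
    using m(4) that b map_poly_hom_mult m(1) by auto
  thus ?thesis by blast
qed

text \<open>The assumption on \<open>b\<close> makes the substitution of \<open>b\<close> for
  \<open>a\<close> well defined on the ring \<open>K[a]\<close>: two polynomials with the same value
  at \<open>a\<close> differ by a relation. This ring is a field because \<open>a\<close> is
  algebraic over \<open>K\<close>.\<close>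

lemma extend_hom:
  assumes "a \<in> integral_closure K"
    and b: "\<And>f. f \<in> polys_over K \<Longrightarrow> poly f a = 0 \<Longrightarrow> poly (map_poly \<sigma> f) b = 0"
  shows "\<exists>L \<tau>. field_hom_on L \<tau> \<and> K \<subseteq> L \<and> a \<in> L \<and> \<tau> a = b \<and> (\<forall>x\<in>K. \<tau> x = \<sigma> x)"
proof -
  interpret polys: subring_set "polys_over K" by (rule subring_set_polys_over)
  define L where "L = (\<lambda>f. poly f a) ` polys_over K"
  define \<tau> where "\<tau> = (\<lambda>x. poly (map_poly \<sigma> (SOME f. f \<in> polys_over K \<and> poly f a = x)) b)"
  have \<tau>: "\<tau> (poly f a) = poly (map_poly \<sigma> f) b" if f: "f \<in> polys_over K" for f
  proof -
    define g where "g = (SOME g. g \<in> polys_over K \<and> poly g a = poly f a)"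
    have g: "g \<in> polys_over K \<and> poly g a = poly f a"
      unfolding g_def by (rule someI[of _ f]) (use f in auto)
    have "poly (map_poly \<sigma> (g - f)) b = 0"
      using g f by (intro b polys.diff_mem) auto
    moreover have "map_poly \<sigma> g = map_poly \<sigma> (g - f) + map_poly \<sigma> f"
      using map_poly_hom_add[of "g - f" f] g f by (simp add: polys.diff_mem)
    ultimately show ?thesis by (simp add: \<tau>_def g_def)
  qed
  have base: "x \<in> L \<and> \<tau> x = \<sigma> x" if "x \<in> K" for x
  proof -
    have "[:x:] \<in> polys_over K" using that by simp
    moreover have "map_poly \<sigma> [:x:] = [:\<sigma> x:]"
      by (rule poly_eqI) (simp add: coeff_map_poly hom_zero coeff_pCons split: nat.splits)
    ultimately show ?thesis
      using \<tau>[of "[:x:]"] by (auto simp: L_def intro!: image_eqI[of _ _ "[:x:]"])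
  qed
  have X: "[:0, 1:] \<in> polys_over K" by (simp add: zero_mem one_mem)
  have a: "a \<in> L \<and> \<tau> a = b"
    using \<tau>[OF X] X by (auto simp: L_def map_poly_pCons hom_zero hom_one intro!: image_eqI[of _ _ "[:0, 1:]"])
  have ringL: "subring_set L"
  proof
    fix x y assume "x \<in> L" "y \<in> L"
    then obtain f g where fg: "f \<in> polys_over K" "g \<in> polys_over K" "x = poly f a" "y = poly g a"
      by (auto simp: L_def)
    have "poly (f + g) a \<in> L" "poly (f * g) a \<in> L" "poly (- f) a \<in> L"
      unfolding L_def using fg
      by (intro imageI polys.add_mem polys.mult_mem polys.uminus_mem; simp)+
    thus "x + y \<in> L" "x * y \<in> L" "- x \<in> L"
      using fg by simp_all
  qed (use base one_mem in auto)
  have inv: "inverse x \<in> L" if "x \<in> L" for x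
  proof -
    interpret C: subring_set "integral_closure K"
      by (rule subring_set_integral_closure[OF subring_set_axioms])
    have sub: "K \<subseteq> integral_closure K" by (rule subset_integral_closure[OF subring_set_axioms])
    have "x \<in> integral_closure K"
      using that polys_over_mono[OF sub] by (auto simp: L_def intro!: C.poly_mem assms(1))
    then obtain p where "p \<in> polys_over K" "lead_coeff p = 1" "poly p x = 0"
      by (auto simp: integral_closure_def)
    moreover have "K \<subseteq> L" using base by auto
    ultimately show ?thesis
      by (intro inverse_mem_of_algebraic[OF subring_set_axioms inverse_mem ringL _ that]) auto
  qed
  have "complex_subfield L"
    using inv subring_set.one_mem[OF ringL] subring_set.zero_mem[OF ringL]
      subring_set.add_mem[OF ringL] subring_set.mult_mem[OF ringL] subring_set.uminus_mem[OF ringL]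
    by (auto simp: complex_subfield_def)
  moreover have "\<tau> (x + y) = \<tau> x + \<tau> y \<and> \<tau> (x * y) = \<tau> x * \<tau> y" if xy: "x \<in> L" "y \<in> L" for x y
  proof -
    obtain f g where fg: "f \<in> polys_over K" "g \<in> polys_over K" "x = poly f a" "y = poly g a"
      using xy by (auto simp: L_def)
    show ?thesis
      using \<tau>[OF fg(1)] \<tau>[OF fg(2)] \<tau>[OF polys.add_mem[OF fg(1,2)]] \<tau>[OF polys.mult_mem[OF fg(1,2)]] fg
      by (simp add: map_poly_hom_add map_poly_hom_mult)
  qed
  moreover have "\<tau> 1 = 1" using base[OF one_mem] by (simp add: hom_one)
  ultimately have "field_hom_on L \<tau>" by (simp add: field_hom_on_def)
  thus ?thesis using base a by blast
qed

lemma extend_hom_finite: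
  assumes "finite T" "T \<subseteq> integral_closure K"
  shows "\<exists>L \<tau>. field_hom_on L \<tau> \<and> K \<subseteq> L \<and> T \<subseteq> L \<and> (\<forall>x\<in>K. \<tau> x = \<sigma> x)"
  using assms
proof (induction T)
  case empty
  show ?case using hom by blast
next
  case (insert t T)
  then obtain L \<tau> where L: "field_hom_on L \<tau>" "K \<subseteq> L" "T \<subseteq> L" "\<forall>x\<in>K. \<tau> x = \<sigma> x"
    by (auto elim!: exE conjE)
  interpret L: complex_field_hom L \<tau> by unfold_locales fact
  have t: "t \<in> integral_closure L"
    using insert.prems polys_over_mono[OF L(2)] by (auto simp: integral_closure_def)
  then obtain b where "\<forall>f\<in>polys_over L. poly f t = 0 \<longrightarrow> poly (map_poly \<tau> f) b = 0"
    using L.ex_root_of_relations[OF t] by (elim exE)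
  with L.extend_hom[OF t, of b] obtain L' \<tau>' where
    "field_hom_on L' \<tau>'" "L \<subseteq> L'" "t \<in> L'" "\<forall>x\<in>L. \<tau>' x = \<tau> x" by auto
  thus ?case using L by (intro exI[of _ L'] exI[of _ \<tau>']) auto
qed

end

section \<open>Conjugates over the rationals and the house\<close>

lemma rat_poly_dvd_of_common_root:
  fixes p q :: "rat poly" and a :: "'a :: field_char_0"
  assumes "irreducible p" "poly (map_poly of_rat p) a = 0" "poly (map_poly of_rat q) a = 0"
  shows "p dvd q"
proof (rule ccontr)
  interpret hom: map_poly_inj_idom_hom "of_rat :: rat \<Rightarrow> 'a" ..
  assume "\<not> p dvd q"
  hence "coprime p q"
    using assms(1) by (simp add: irreducible_imp_prime_elem prime_elem_imp_coprime)
  then obtain u v where uv: "u * p + v * q = 1"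
    by (metis bezout_coefficients_fst_snd coprime_imp_gcd_eq_1)
  have "poly (map_poly of_rat (u * p + v * q)) a = 0"
    using assms(2,3) by (simp add: hom.hom_add hom.hom_mult)
  thus False by (simp add: uv)
qed

lemma rat_conjugates_subset_roots:
  assumes "irreducible p" "poly (map_poly of_rat p) a = 0"
  shows "rat_conjugates a \<subseteq> {b. poly (map_poly of_rat p) b = 0}"
proof
  fix b assume "b \<in> rat_conjugates a"
  then obtain q :: "rat poly" where q: "irreducible q" "poly (map_poly of_rat q) a = 0" "poly (map_poly of_rat q) b = 0"
    by (auto simp: rat_conjugates_def)
  have "q dvd p" by (rule rat_poly_dvd_of_common_root[OF q(1,2) assms(2)])
  then obtain s where "p = q * s" by blast
  interpret hom: map_poly_inj_idom_hom "of_rat :: rat \<Rightarrow> complex" ..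
  have "map_poly of_rat p = map_poly of_rat q * (map_poly of_rat s :: complex poly)"
    by (simp add: \<open>p = q * s\<close> hom.hom_mult)
  thus "b \<in> {b. poly (map_poly of_rat p) b = 0}" using q(3) by simp
qed

lemma finite_rat_conjugates: "finite (rat_conjugates a)"
proof (cases "rat_conjugates a = {}")
  case False
  then obtain p :: "rat poly" where p: "irreducible p" "poly (map_poly of_rat p) a = 0"
    by (auto simp: rat_conjugates_def)
  hence "map_poly of_rat p \<noteq> (0 :: complex poly)" by (auto simp: map_poly_eq_0_iff)
  thus ?thesis
    using finite_subset[OF rat_conjugates_subset_roots[OF p]] poly_roots_finite by blast
qed auto

text \<open>Ensures that \<open>house\<close> is the maximum of a nonempty set. If the minimal
  polynomial factors, one factor vanishes at \<open>a\<close> and so has full degree, which leaves a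
  constant for the other.\<close>

lemma mem_rat_conjugates_self:
  assumes "algebraic a"
  shows "a \<in> rat_conjugates a"
proof -
  have a: "a \<in> integral_closure \<rat>" using assms by (simp add: algebraic_iff_integral_closure)
  obtain m where m: "m \<in> polys_over \<rat>" "lead_coeff m = 1" "poly m a = 0"
      "\<forall>f\<in>polys_over \<rat>. poly f a = 0 \<longrightarrow> (\<exists>s\<in>polys_over \<rat>. f = s * m)"
    by (rule minimal_polynomial_over[OF subring_set_Rats Rats_inverse a])
  obtain p where p: "m = map_poly of_rat p"
    by (rule ratpolyE[OF coeff_mem[OF m(1)]])
  have deg: "degree m = degree p" by (simp add: p)
  have "p \<noteq> 0" using m(2) p by auto
  interpret hom: map_poly_inj_idom_hom "of_rat :: rat \<Rightarrow> complex" ..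
  have "irreducible p"
  proof (rule irreducibleI)
    show "p \<noteq> 0" by fact
    show "\<not> p dvd 1"
    proof
      assume "p dvd 1"
      hence "degree p = 0" using \<open>p \<noteq> 0\<close> by (simp add: is_unit_iff_degree)
      then obtain c where "p = [:c:]" by (rule degree_eq_zeroE)
      thus False using m(3) p \<open>p \<noteq> 0\<close> by simp
    qed
  next
    fix u v assume uv: "p = u * v"
    have unit: "w' dvd 1" if w: "p = w * w'" "poly (map_poly of_rat w) a = 0" for w w' :: "rat poly"
    proof -
      have "map_poly of_rat w \<in> polys_over (\<rat> :: complex set)" by (simp add: polys_over_def)
      then obtain s where s: "map_poly of_rat w = s * m" using m(4) w(2) by blast
      have "w \<noteq> 0" "w' \<noteq> 0" using \<open>p \<noteq> 0\<close> w by auto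
      hence "s \<noteq> 0" using s by auto
      have "degree w = degree (s * m)" using s by (simp flip: s)
      also have "\<dots> \<ge> degree m" using \<open>s \<noteq> 0\<close> m(2) by (subst degree_mult_eq) auto
      finally have "degree w' = 0"
        using w(1) \<open>w \<noteq> 0\<close> \<open>w' \<noteq> 0\<close> by (simp add: deg degree_mult_eq)
      thus "w' dvd 1" using \<open>w' \<noteq> 0\<close> by (simp add: is_unit_iff_degree)
    qed
    have "poly (map_poly of_rat u) a * poly (map_poly of_rat v) a = 0"
      using m(3) by (simp add: p uv hom.hom_mult)
    thus "u dvd 1 \<or> v dvd 1"
      using unit[of u v] unit[of v u] uv by (auto simp: mult.commute)
  qed
  thus ?thesis
    using m(3) p by (auto simp: rat_conjugates_def)
qed

lemma house_le:
  assumes "algebraic a" "\<And>b. b \<in> rat_conjugates a \<Longrightarrow> cmod b \<le> R"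
  shows "house a \<le> R"
  unfolding house_def using mem_rat_conjugates_self[OF assms(1)] assms(2)
  by (subst Max_le_iff) (auto simp: finite_rat_conjugates)

lemma cmod_conjugate_le_house:
  assumes "b \<in> rat_conjugates a"
  shows "cmod b \<le> house a"
  unfolding house_def using assms by (intro Max_ge) (auto simp: finite_rat_conjugates)

lemma house_nonneg:
  assumes "algebraic a"
  shows "house a \<ge> 0"
  using cmod_conjugate_le_house[OF mem_rat_conjugates_self[OF assms]] norm_ge_zero[of a] by linarith

context complex_field_hom
begin

lemma cmod_hom_le_house:
  assumes "a \<in> K" "algebraic a"
  shows "cmod (\<sigma> a) \<le> house a"
proof (rule cmod_conjugate_le_house)
  obtain p :: "rat poly" where p: "irreducible p" "poly (map_poly of_rat p) a = 0"
    using mem_rat_conjugates_self[OF assms(2)] by (auto simp: rat_conjugates_def)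
  have "map_poly of_rat p \<in> polys_over K"
    using Rats_subset_complex_subfield[OF subfield] by (auto simp: polys_over_def)
  hence "0 = poly (map_poly \<sigma> (map_poly of_rat p)) (\<sigma> a)"
    using hom_poly[of "map_poly of_rat p" a] assms(1) p(2) by (simp add: hom_zero)
  also have "map_poly \<sigma> (map_poly of_rat p) = map_poly of_rat p"
    by (rule poly_eqI) (simp add: coeff_map_poly hom_zero hom_Rats)
  finally show "\<sigma> a \<in> rat_conjugates a"
    using p by (auto simp: rat_conjugates_def)
qed

end

text \<open>Used to bound the house: a conjugate \<open>b\<close> is realized by an embedding that
  is defined on all numbers in \<open>T\<close>, so an equation between them can be transported and
  estimated.\<close>

lemma ex_hom_to_conjugate:
  assumes "algebraic a" "b \<in> rat_conjugates a" "finite T" "\<And>t. t \<in> T \<Longrightarrow> algebraic t"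
  shows "\<exists>K \<sigma>. field_hom_on K \<sigma> \<and> a \<in> K \<and> T \<subseteq> K \<and> \<sigma> a = b"
proof -
  interpret Q: complex_field_hom "\<rat>" "\<lambda>x. x"
    by unfold_locales (auto simp: field_hom_on_def complex_subfield_def Rats_inverse)
  obtain p :: "rat poly" where p: "irreducible p" "poly (map_poly of_rat p) a = 0" "poly (map_poly of_rat p) b = 0"
    using assms(2) by (auto simp: rat_conjugates_def)
  have "poly (map_poly (\<lambda>x. x) f) b = 0" if f: "f \<in> polys_over \<rat>" "poly f a = 0" for f
  proof -
    interpret hom: map_poly_inj_idom_hom "of_rat :: rat \<Rightarrow> complex" ..
    obtain q where q: "f = map_poly of_rat q"
      by (rule ratpolyE[OF coeff_mem[OF f(1)]])
    then obtain s where "q = p * s" using rat_poly_dvd_of_common_root[OF p(1,2)] f(2) by blast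
    hence "f = map_poly of_rat p * map_poly of_rat s" by (simp add: q hom.hom_mult)
    thus ?thesis using p(3) by (simp add: map_poly_idI)
  qed
  moreover have "a \<in> integral_closure \<rat>"
    using assms(1) by (simp add: algebraic_iff_integral_closure)
  ultimately obtain K \<sigma> where K: "field_hom_on K \<sigma>" "a \<in> K" "\<sigma> a = b"
    using Q.extend_hom[of a b] by auto
  interpret K: complex_field_hom K \<sigma> by unfold_locales fact
  have "T \<subseteq> integral_closure K"
    using assms(4) polys_over_mono[OF Rats_subset_complex_subfield[OF K.subfield]]
    by (force simp: algebraic_iff_integral_closure integral_closure_def)
  from K.extend_hom_finite[OF assms(3) this] obtain L \<tau> where
    "field_hom_on L \<tau>" "K \<subseteq> L" "T \<subseteq> L" "\<forall>x\<in>K. \<tau> x = \<sigma> x"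
    by (elim exE conjE)
  thus ?thesis using K by (intro exI[of _ L] exI[of _ \<tau>]) auto
qed

section \<open>Degrees of roots of unity\<close>

text \<open>Additivity of the Frobenius map modulo \<open>p\<close>, with an explicit error term:
  requiring \<open>h\<close> in the subring is what makes this a congruence there.\<close>

lemma (in subring_set) add_power_prime:
  assumes "prime p" "x \<in> A" "y \<in> A"
  shows "\<exists>h\<in>A. (x + y) ^ p = x ^ p + y ^ p + of_nat p * h"
proof -
  have p: "p > 1" using assms(1) prime_gt_1_nat by blast
  define h where "h = (\<Sum>k\<in>{1..<p}. of_nat ((p choose k) div p) * (x ^ k * y ^ (p - k)))"
  have "(x + y) ^ p = (\<Sum>k\<le>p. of_nat (p choose k) * x ^ k * y ^ (p - k))"
    by (rule binomial_ring)
  also have "{..p} = {0, p} \<union> {1..<p}" using p by auto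
  also have "(\<Sum>k\<in>\<dots>. of_nat (p choose k) * x ^ k * y ^ (p - k)) =
      x ^ p + y ^ p + (\<Sum>k\<in>{1..<p}. of_nat (p choose k) * x ^ k * y ^ (p - k))"
    using p by (subst sum.union_disjoint) auto
  also have "(\<Sum>k\<in>{1..<p}. of_nat (p choose k) * x ^ k * y ^ (p - k)) = of_nat p * h"
    unfolding h_def sum_distrib_left
  proof (rule sum.cong)
    fix k assume "k \<in> {1..<p}"
    hence "p dvd p choose k" using assms(1) by (intro dvd_choose_prime) auto
    hence "of_nat (p choose k) = (of_nat p * of_nat ((p choose k) div p) :: 'a)"
      by (simp flip: of_nat_mult)
    thus "of_nat (p choose k) * x ^ k * y ^ (p - k) =
        of_nat p * (of_nat ((p choose k) div p) * (x ^ k * y ^ (p - k)))"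
      by (simp only: mult.assoc)
  qed auto
  finally have "(x + y) ^ p = x ^ p + y ^ p + of_nat p * h" .
  moreover have "h \<in> A"
    unfolding h_def using assms by (intro sum_mem mult_mem power_mem of_nat_mem)
  ultimately show ?thesis by blast
qed

lemma int_power_prime:
  fixes c :: int
  assumes "prime p"
  shows "int p dvd c ^ p - c"
proof -
  interpret subring_set "UNIV :: int set" by unfold_locales auto
  \<comment> \<open>An equivalence rather than an implication, so that the induction can run in both
    directions from 0.\<close>
  have step: "int p dvd (i + 1) ^ p - (i + 1) \<longleftrightarrow> int p dvd i ^ p - i" for i :: int
  proof -
    obtain h where h: "(i + 1) ^ p = i ^ p + 1 ^ p + int p * h"
      using add_power_prime[OF assms, of i 1] by auto
    have eq: "(i + 1) ^ p - (i + 1) = (i ^ p - i) + int p * h" using h by simp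
    show ?thesis unfolding eq by (rule dvd_add_left_iff) simp
  qed
  show ?thesis
  proof (induction c rule: int_induct[where k = 0])
    case base
    show ?case using prime_gt_0_nat[OF assms] by (simp add: power_0_left)
  next
    case (step1 i)
    thus ?case using step by simp
  next
    case (step2 i)
    thus ?case using step[of "i - 1"] by simp
  qed
qed

text \<open>The Frobenius map modulo \<open>p\<close> is additive, and it fixes integer coefficients
  by Fermat's little theorem.\<close>

lemma pcompose_monom_prime:
  fixes f :: "'a :: field_char_0 poly"
  assumes "prime p" "f \<in> polys_over \<int>"
  shows "\<exists>g\<in>polys_over \<int>. pcompose f (monom 1 p) = f ^ p + of_nat p * g"
  using assms(2)
proof (induction f)
  case 0
  show ?case using assms(1) by (intro bexI[of _ 0]) (auto simp: power_0_left polys_over_def)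
next
  case (pCons c f)
  interpret Z: subring_set "\<int> :: 'a set" by (rule subring_set_Ints)
  interpret polys: subring_set "polys_over (\<int> :: 'a set)" by (rule Z.subring_set_polys_over)
  obtain g where g: "g \<in> polys_over \<int>" "pcompose f (monom 1 p) = f ^ p + of_nat p * g"
    using pCons by auto
  have f: "f \<in> polys_over \<int>" and c: "c \<in> \<int>" using pCons.prems by auto
  have X: "monom 1 1 \<in> polys_over (\<int> :: 'a set)" by (intro Z.monom_mem_polys_over) auto
  obtain h where h: "h \<in> polys_over \<int>"
      "([:c:] + monom 1 1 * f) ^ p = [:c:] ^ p + (monom 1 1 * f) ^ p + of_nat p * h"
    using polys.add_power_prime[OF assms(1), of "[:c:]" "monom 1 1 * f"] c f X polys.mult_mem by auto
  obtain z where z: "c = of_int z" using c by (auto elim: Ints_cases)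
  obtain w where w: "z ^ p - z = int p * w" using int_power_prime[OF assms(1), of z] by blast
  have "c ^ p - c = of_int (z ^ p - z)" by (simp add: z)
  also have "\<dots> = of_nat p * of_int w" by (simp add: w)
  finally have cp: "[:c:] - [:c:] ^ p = - (of_nat p * [:of_int w:])"
    by (simp add: of_nat_poly poly_const_pow algebra_simps)
  have "pcompose (pCons c f) (monom 1 p) = [:c:] + monom 1 p * (f ^ p + of_nat p * g)"
    by (simp only: pcompose_pCons g(2))
  moreover have "pCons c f ^ p = [:c:] ^ p + monom 1 p * f ^ p + of_nat p * h"
  proof -
    have "pCons c f = [:c:] + monom 1 1 * f" by (simp add: monom_altdef)
    thus ?thesis using h(2) by (simp add: power_mult_distrib monom_power)
  qed
  ultimately have "pcompose (pCons c f) (monom 1 p) - pCons c f ^ p =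
      ([:c:] - [:c:] ^ p) + of_nat p * (monom 1 p * g - h)"
    by (simp only: algebra_simps)
  also have "\<dots> = of_nat p * (monom 1 p * g - h - [:of_int w:])"
    unfolding cp by (simp add: algebra_simps)
  finally have "pcompose (pCons c f) (monom 1 p) =
      pCons c f ^ p + of_nat p * (monom 1 p * g - h - [:of_int w:])"
    unfolding diff_eq_eq by (simp only: add.commute)
  moreover have "monom 1 p * g - h - [:of_int w:] \<in> polys_over \<int>"
    using g(1) h(1) by (intro polys.diff_mem polys.mult_mem Z.monom_mem_polys_over) auto
  ultimately show ?case by blast
qed

text \<open>To \<open>j\<close> one adds \<open>M\<close> times the product of the small primes not
  dividing \<open>j\<close>. Each small prime then divides exactly one of the two summands, hence
  not their sum. This takes the place of Dirichlet's theorem, as products of large primes are good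
  enough.\<close>

lemma coprime_residue_large_prime_factors:
  fixes M j b :: nat
  assumes "coprime j M"
  shows "\<exists>t. [t = j] (mod M) \<and> (\<forall>p. prime p \<longrightarrow> p dvd t \<longrightarrow> p \<ge> b)"
proof -
  define S where "S = {p. prime p \<and> p < b \<and> \<not> p dvd j}"
  have S: "finite S" by (rule finite_subset[of _ "{..<b}"]) (auto simp: S_def)
  define t where "t = j + M * \<Prod>S"
  have "p \<ge> b" if p: "prime p" "p dvd t" for p
  proof (rule ccontr)
    assume "\<not> p \<ge> b"
    show False
    proof (cases "p dvd j")
      case True
      hence "p dvd M * \<Prod>S" using p(2) by (simp add: t_def dvd_add_right_iff)
      hence "p dvd M \<or> (\<exists>q\<in>S. p dvd q)"
        using p(1) S by (simp add: prime_dvd_mult_iff prime_dvd_prod_iff)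
      thus False
      proof
        assume "p dvd M"
        thus False using True assms p(1) by (metis coprime_def not_prime_unit)
      next
        assume "\<exists>q\<in>S. p dvd q"
        then obtain q where "q \<in> S" "p dvd q" by blast
        thus False using True p(1) by (auto simp: S_def dest: primes_dvd_imp_eq)
      qed
    next
      case False
      hence "p \<in> S" using p(1) \<open>\<not> p \<ge> b\<close> by (auto simp: S_def)
      hence "p dvd M * \<Prod>S" using dvd_prodI[OF S, of p "\<lambda>x. x"] by (simp add: dvd_mult)
      thus False using False p(2) by (simp add: t_def dvd_add_left_iff)
    qed
  qed
  moreover have "[t = j] (mod M)" by (simp add: t_def cong_def)
  ultimately show ?thesis by blast
qed

text \<open>Landau's argument: modulo the minimal polynomial \<open>m\<close> of \<open>\<zeta>\<close>, only finitely many
  remainders of \<open>m (X ^ p)\<close> occur, while each of them is divisible by \<open>p\<close>. So for large primes \<open>p\<close>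
  the remainder vanishes, and every residue class coprime to \<open>M\<close> contains a product of such primes.\<close>

lemma totient_le_degree:
  fixes \<zeta> :: complex
  assumes M: "M > 0" and primitive: "\<And>j. \<zeta> ^ j = 1 \<longleftrightarrow> M dvd j"
    and f: "f \<in> polys_over \<rat>" "f \<noteq> 0" "poly f \<zeta> = 0"
  shows "totient M \<le> degree f"
proof -
  interpret Q: subring_set "\<rat> :: complex set" by (rule subring_set_Rats)
  interpret Qpolys: subring_set "polys_over (\<rat> :: complex set)" by (rule Q.subring_set_polys_over)
  interpret Z: subring_set "\<int> :: complex set" by (rule subring_set_Ints)
  interpret Zpolys: subring_set "polys_over (\<int> :: complex set)" by (rule Z.subring_set_polys_over)
  interpret alg_int_polys: subring_set "polys_over {x :: complex. algebraic_int x}"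
    by (rule alg_ints.subring_set_polys_over)
  have ZQ: "polys_over \<int> \<subseteq> polys_over (\<rat> :: complex set)"
    by (intro polys_over_mono Ints_subset_Rats)
  have "\<zeta> ^ M = 1" using primitive[of M] by simp
  hence \<zeta>: "\<zeta> \<in> roots_of_unity" using M by (auto simp: roots_of_unity_def)
  have int: "\<zeta> \<in> integral_closure \<rat>"
    using \<zeta> by (auto dest: roots_of_unity_algebraic_int simp flip: algebraic_iff_integral_closure)
  obtain m where m: "m \<in> polys_over \<rat>" "lead_coeff m = 1" "poly m \<zeta> = 0"
      and min: "\<forall>f\<in>polys_over \<rat>. poly f \<zeta> = 0 \<longrightarrow> (\<exists>s\<in>polys_over \<rat>. f = s * m)"
    by (rule minimal_polynomial_over[OF subring_set_Rats Rats_inverse int])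
  have small: "g = 0" if "g \<in> polys_over \<rat>" "poly g \<zeta> = 0" "degree g < degree m" for g
  proof (rule ccontr)
    assume "g \<noteq> 0"
    obtain s where "g = s * m" using min \<open>g \<in> _\<close> \<open>poly g \<zeta> = 0\<close> by blast
    thus False using \<open>g \<noteq> 0\<close> \<open>degree g < degree m\<close> by (auto simp: degree_mult_eq)
  qed
  have "m \<noteq> 0" using m(2) by auto
  have roots: "\<eta> ^ M = 1" if "poly m \<eta> = 0" for \<eta>
  proof -
    have "monom 1 M - 1 \<in> polys_over (\<rat> :: complex set)"
      by (intro Qpolys.diff_mem Q.monom_mem_polys_over Qpolys.one_mem) auto
    moreover have "poly (monom 1 M - 1) \<zeta> = 0" using \<open>\<zeta> ^ M = 1\<close> by (simp add: poly_monom)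
    ultimately obtain s where "monom 1 M - 1 = s * m" using min by blast
    hence "poly (monom 1 M - 1) \<eta> = poly s \<eta> * poly m \<eta>" by simp
    thus ?thesis using that by (simp add: poly_monom)
  qed
  \<comment> \<open>Integrality of \<open>m\<close> comes from its roots: they are roots of unity,
    so the coefficients are algebraic integers, and being rational they are integers.\<close>
  have "m \<in> polys_over {x. algebraic_int x}"
  proof -
    obtain R where R: "m = Polynomial.smult (lead_coeff m) (\<Prod>x\<in>#R. [:-x, 1:])"
      using alg_closed_imp_factorization[OF \<open>m \<noteq> 0\<close>] by auto
    have "algebraic_int x" if "x \<in># R" for x
    proof -
      have "poly m x = 0" using that by (subst R) (auto simp: poly_prod_mset)
      thus ?thesis using roots M by (intro roots_of_unity_algebraic_int) (auto simp: roots_of_unity_def)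
    qed
    hence "(\<Prod>x\<in>#R. [:-x, 1:]) \<in> polys_over {x. algebraic_int x}"
    proof (induction R)
      case (add x R)
      hence "[:-x, 1:] * (\<Prod>x\<in>#R. [:-x, 1:]) \<in> polys_over {x. algebraic_int x}"
        using alg_ints.one_mem by (intro alg_int_polys.mult_mem) auto
      thus ?case by (simp only: image_mset_add_mset prod_mset.add_mset)
    qed (simp add: alg_int_polys.one_mem)
    thus ?thesis using R m(2) by simp
  qed
  hence mZ: "m \<in> polys_over \<int>"
    using m(1) by (auto simp: polys_over_def intro!: rational_algebraic_int_is_int)
  have "\<exists>r. r \<in> polys_over \<int> \<and> (r = 0 \<or> degree r < degree m) \<and> poly r \<zeta> = poly g \<zeta>"
    if g: "g \<in> polys_over \<int>" for g
  proof -
    obtain s r where "r \<in> polys_over \<int>" "g = s * m + r" "r = 0 \<or> degree r < degree m"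
      using Z.division_monic[OF mZ m(2) g] by blast
    thus ?thesis using m(3) by auto
  qed
  then obtain r where r: "\<And>g. g \<in> polys_over \<int> \<Longrightarrow> r g \<in> polys_over \<int>"
      "\<And>g. g \<in> polys_over \<int> \<Longrightarrow> r g = 0 \<or> degree (r g) < degree m"
      "\<And>g. g \<in> polys_over \<int> \<Longrightarrow> poly (r g) \<zeta> = poly g \<zeta>"
    by metis
  define mj where "mj = (\<lambda>j. pcompose m (monom 1 j))"
  have mj: "mj j \<in> polys_over \<int>" for j
    unfolding mj_def by (intro Z.pcompose_mem_polys_over mZ Z.monom_mem_polys_over) auto
  have poly_mj: "poly (mj j) x = poly m (x ^ j)" for j x
    by (simp add: mj_def poly_pcompose poly_monom)
  \<comment> \<open>As \<open>\<zeta> ^ p\<close> depends only on \<open>p mod M\<close>, the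
    remainders for \<open>j < M\<close> cover all primes, and one bound \<open>b\<close> serves them
    all.\<close>
  define C where "C = (\<Union>j<M. (\<lambda>i. cmod (coeff (r (mj j)) i)) ` {..degree (r (mj j))})"
  have "finite C" by (auto simp: C_def)
  then obtain b0 where "\<forall>c\<in>C. c \<le> b0" by (metis finite_has_maximal2 bdd_above_finite bdd_above_def)
  moreover obtain b :: nat where "real b > b0" using reals_Archimedean2 by blast
  ultimately have b: "cmod (coeff (r (mj j)) i) < real b" if "j < M" "i \<le> degree (r (mj j))" for i j
    using that by (force simp: C_def)
  have large_prime: "poly m (\<eta> ^ p) = 0" if p: "prime p" "p \<ge> b" and \<eta>: "poly m \<eta> = 0" for p \<eta>
  proof -
    define j where "j = p mod M"
    have j: "j < M" using M by (simp add: j_def)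
    have "\<zeta> ^ p = \<zeta> ^ (M * (p div M) + j)" by (simp add: j_def)
    hence pj: "\<zeta> ^ p = \<zeta> ^ j" by (simp add: power_add power_mult \<open>\<zeta> ^ M = 1\<close>)
    obtain g where g: "g \<in> polys_over \<int>" "mj p = m ^ p + of_nat p * g"
      using pcompose_monom_prime[OF p(1) mZ] by (auto simp: mj_def)
    have "poly (r (mj j)) \<zeta> = poly (mj p) \<zeta>"
      using r(3)[OF mj] pj by (simp add: poly_mj)
    also have "\<dots> = of_nat p * poly g \<zeta>"
      using g(2) m(3) p(1) by (simp add: prime_gt_0_nat)
    finally have "poly (r (mj j) - of_nat p * r g) \<zeta> = 0"
      using r(3)[OF g(1)] by simp
    moreover have "r (mj j) - of_nat p * r g \<in> polys_over \<rat>"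
      using ZQ r(1)[OF mj] r(1)[OF g(1)]
      by (intro subsetD[OF ZQ] Zpolys.diff_mem Zpolys.mult_mem Zpolys.of_nat_mem) auto
    moreover have "r (mj j) - of_nat p * r g = 0 \<or> degree (r (mj j) - of_nat p * r g) < degree m"
      using r(2)[OF mj, of j] r(2)[OF g(1)] p(1)
      by (auto simp: of_nat_poly degree_diff_less)
    ultimately have "r (mj j) - of_nat p * r g = 0"
      using small by blast
    hence eq: "r (mj j) = of_nat p * r g" by simp
    have "r (mj j) = 0"
    proof (rule poly_eqI)
      fix i
      show "coeff (r (mj j)) i = coeff 0 i"
      proof (cases "i \<le> degree (r (mj j))")
        case True
        obtain z where z: "coeff (r g) i = of_int z"
          using coeff_mem[OF r(1)[OF g(1)]] by (auto elim: Ints_cases)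
        have c: "coeff (r (mj j)) i = of_int (int p * z)"
          using z by (simp add: eq of_nat_poly)
        \<comment> \<open>The coefficient is a multiple of \<open>p\<close> of absolute value less
          than \<open>b \<le> p\<close>, hence zero.\<close>
        have "real_of_int \<bar>int p * z\<bar> < real b"
          using b[OF j True] unfolding c norm_of_int by simp
        hence "real p * \<bar>real_of_int z\<bar> < real p * 1"
          using p(2) by (simp add: abs_mult)
        hence "\<bar>real_of_int z\<bar> < 1"
          using prime_gt_0_nat[OF p(1)] by (simp only: mult_less_cancel_left_pos of_nat_0_less_iff)
        hence "z = 0" by linarith
        thus ?thesis by (simp add: c)
      qed (simp add: coeff_eq_0)
    qed
    hence "poly (mj p) \<zeta> = 0"
      using r(3)[OF mj, of j] pj by (simp add: poly_mj)
    then obtain s where "mj p = s * m"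
      using min subsetD[OF ZQ mj[of p]] by blast
    hence "poly (mj p) \<eta> = 0" using \<eta> by simp
    thus ?thesis by (simp add: poly_mj)
  qed
  have large: "poly m (\<eta> ^ t) = 0"
    if "t > 0" "\<And>p. prime p \<Longrightarrow> p dvd t \<Longrightarrow> p \<ge> b" "poly m \<eta> = 0" for t \<eta>
    using that
  proof (induction t arbitrary: \<eta> rule: less_induct)
    case (less t)
    show ?case
    proof (cases "t = 1")
      case False
      then obtain p where p: "prime p" "p dvd t" using prime_factor_nat by blast
      then obtain t' where t': "t = p * t'" by blast
      have "t' < t" "t' > 0" using less.prems(1) prime_gt_1_nat[OF p(1)] by (auto simp: t')
      moreover have "poly m (\<eta> ^ p) = 0" using less.prems p by (intro large_prime) auto
      moreover have "q \<ge> b" if "prime q" "q dvd t'" for q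
        using that by (intro less.prems(2)) (auto simp: t')
      ultimately have "poly m ((\<eta> ^ p) ^ t') = 0" by (intro less.IH[of t' "\<eta> ^ p"])
      thus ?thesis by (simp add: t' power_mult)
    qed (use less.prems in auto)
  qed
  have conj: "poly m (\<zeta> ^ j) = 0" if "j \<in> totatives M" for j
  proof -
    have "coprime j M" using that by (simp add: in_totatives_iff)
    \<comment> \<open>The lower bound 3 excludes \<open>t = 0\<close>, which is divisible by
      2.\<close>
    then obtain t where t: "[t = j] (mod M)" "\<And>p. prime p \<Longrightarrow> p dvd t \<Longrightarrow> p \<ge> max b 3"
      using coprime_residue_large_prime_factors[of j M "max b 3"] by blast
    have "t > 0"
    proof (rule ccontr)
      assume "\<not> t > 0"
      thus False using t(2)[of "2 :: nat"] by simp
    qed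
    hence "poly m (\<zeta> ^ t) = 0" using t(2) m(3) by (intro large) auto
    moreover have "\<zeta> ^ t = \<zeta> ^ j"
    proof -
      have "\<zeta> ^ i = \<zeta> ^ (i mod M)" for i
        using power_add[of \<zeta> "M * (i div M)" "i mod M"] by (simp add: power_mult \<open>\<zeta> ^ M = 1\<close>)
      thus ?thesis using t(1) by (metis cong_def)
    qed
    ultimately show ?thesis by simp
  qed
  have "inj_on (\<lambda>j. \<zeta> ^ j) (totatives M)"
  proof (rule linorder_inj_onI)
    fix i j assume ij: "i < j" "i \<in> totatives M" "j \<in> totatives M"
    show "\<zeta> ^ i \<noteq> \<zeta> ^ j"
    proof
      assume "\<zeta> ^ i = \<zeta> ^ j"
      also have "\<zeta> ^ j = \<zeta> ^ i * \<zeta> ^ (j - i)" using ij by (simp flip: power_add)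
      finally have "\<zeta> ^ (j - i) = 1" using \<open>\<zeta> ^ M = 1\<close> M by (auto simp: power_0_left)
      hence "M dvd j - i" by (simp add: primitive)
      thus False using ij by (auto simp: in_totatives_iff dest: dvd_imp_le)
    qed
  qed auto
  hence "totient M = card ((\<lambda>j. \<zeta> ^ j) ` totatives M)"
    by (simp add: totient_def card_image)
  also have "\<dots> \<le> card {x. poly m x = 0}"
    using conj poly_roots_finite[OF \<open>m \<noteq> 0\<close>] by (intro card_mono) auto
  also have "\<dots> \<le> degree m"
    by (rule card_poly_roots_bound[OF \<open>m \<noteq> 0\<close>])
  also obtain s where "f = s * m" using min f by blast
  hence "degree m \<le> degree f" using f(2) by (auto simp: degree_mult_eq)
  finally show ?thesis .
qed

section \<open>Simultaneous approximation of roots of unity\<close>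

lemma prod_one_minus_inverse_ge:
  fixes S :: "nat set"
  assumes "finite S" "\<And>p. p \<in> S \<Longrightarrow> p \<ge> 2"
  shows "(\<Prod>p\<in>S. 1 - 1 / real p) \<ge> 1 / (real (card S) + 1)"
  using assms
proof (induction S rule: finite_linorder_max_induct)
  case (insert b S)
  \<comment> \<open>The element split off is the largest, so it is at least
    \<open>card S + 2\<close>. The extremal set is {2, ..., n + 1}, for which the product telescopes
    to 1 / (n + 1).\<close>
  have "S \<subseteq> {2..<b}" using insert.hyps insert.prems by auto
  hence "card S \<le> b - 2" using card_mono[of "{2..<b}" S] by simp
  hence b: "real (card S) + 2 \<le> real b" using insert.prems[of b] by simp
  have "1 / (real (card (insert b S)) + 1) = (1 - 1 / (real (card S) + 2)) * (1 / (real (card S) + 1))"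
    using insert.hyps by (subst card_insert_disjoint) (auto simp: field_simps)
  also have "\<dots> \<le> (1 - 1 / real b) * (\<Prod>p\<in>S. 1 - 1 / real p)"
    using b insert by (intro mult_mono) (auto simp: field_simps)
  also have "\<dots> = (\<Prod>p\<in>insert b S. 1 - 1 / real p)"
    using insert.hyps by (subst prod.insert) auto
  finally show ?case .
qed simp

text \<open>Take \<open>r\<close> to be the number of prime divisors of \<open>M\<close>. Replacing
  each of them by 2 gives \<open>2 ^ r \<le> M\<close>, so the loss \<open>r + 1\<close> is only
  logarithmic in \<open>M\<close>.\<close>

lemma totient_lower_bound:
  assumes "M > 0"
  shows "\<exists>r. 2 ^ r \<le> M \<and> M \<le> (r + 1) * totient M"
proof (intro exI conjI)
  define r where "r = card (prime_factors M)"
  have ge2: "p \<ge> 2" if "p \<in> prime_factors M" for p :: nat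
    using that by (auto intro: prime_ge_2_nat)
  have "2 ^ r = (\<Prod>p\<in>prime_factors M. 2 :: nat)" by (simp add: r_def)
  also have "\<dots> \<le> (\<Prod>p\<in>prime_factors M. p)" using ge2 by (intro prod_mono) auto
  also have "\<dots> \<le> (\<Prod>p\<in>prime_factors M. p ^ multiplicity p M)"
    using ge2 by (intro prod_mono conjI self_le_power) (auto simp: prime_factors_multiplicity intro: Suc_leI prime_gt_0_nat)
  also have "\<dots> = M" using assms by (simp add: prime_factorization_nat [symmetric])
  finally show "2 ^ card (prime_factors M) \<le> M" by (simp add: r_def)
  have "real M = (real r + 1) * (real M * (1 / (real r + 1)))" by simp
  also have "\<dots> \<le> (real r + 1) * (real M * (\<Prod>p\<in>prime_factors M. 1 - 1 / real p))"
    unfolding r_def using ge2 by (intro mult_left_mono prod_one_minus_inverse_ge) auto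
  also have "\<dots> = (real r + 1) * real (totient M)"
    by (simp add: totient_formula2)
  finally have "real M \<le> real ((r + 1) * totient M)" by (simp add: algebra_simps)
  thus "M \<le> (card (prime_factors M) + 1) * totient M"
    unfolding r_def of_nat_le_iff .
qed

lemma square_le_two_power: "q ^ 2 \<le> (2 :: nat) ^ q" if "q \<ge> 4"
  using that
proof (induction q rule: dec_induct)
  case (step n)
  have "4 * n \<le> n * n" using step.hyps by (intro mult_right_mono) auto
  hence le: "2 * n + 1 \<le> n ^ 2" using step.hyps unfolding power2_eq_square by linarith
  have "(Suc n) ^ 2 = n ^ 2 + (2 * n + 1)" by (simp add: power2_eq_square)
  also note le
  finally show ?case using step.IH by simp
qed simp

text \<open>Here \<open>r\<close> is at most the binary logarithm of \<open>M\<close>, so a fixed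
  power of it loses against \<open>M\<close>. For large \<open>r\<close> already
  \<open>2 ^ r\<close> dominates; for smaller \<open>r\<close> the left side stays below a constant,
  which \<open>M0\<close> exceeds.\<close>

lemma polylog_less:
  "\<exists>M0. \<forall>M\<ge>M0. \<forall>r. 2 ^ r \<le> M \<longrightarrow> (C * (r + 1)) ^ N < (M :: nat)"
proof (cases "N = 0")
  case False
  define D where "D = C * N"
  \<comment> \<open>At least 4 for \<open>square_le_two_power\<close>, and above
    \<open>2 * D\<close> for the strict step \<open>2 * D * q < q * q\<close>.\<close>
  define q0 where "q0 = 2 * D + 4"
  have large: "(C * (r + 1)) ^ N < 2 ^ r" if r: "r \<ge> N * q0" for r
  proof -
    define q where "q = r div N"
    have q: "q \<ge> q0" using r False by (simp add: q_def less_eq_div_iff_mult_less_eq mult.commute)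
    have "r < N * (q + 1)" using False dividend_less_times_div[of N r] by (simp add: q_def)
    hence "C * (r + 1) \<le> C * (N * (q + 1))" by (intro mult_left_mono) auto
    also have "\<dots> = D * (q + 1)" by (simp add: D_def algebra_simps)
    also have "\<dots> \<le> 2 * D * q" using q by (simp add: q0_def)
    also have "\<dots> < q * q" using q by (intro mult_strict_right_mono) (auto simp: q0_def)
    also have "\<dots> \<le> 2 ^ q" using square_le_two_power[of q] q by (simp add: q0_def power2_eq_square)
    finally have "(C * (r + 1)) ^ N < (2 ^ q) ^ N"
      using False by (intro power_strict_mono) auto
    also have "\<dots> = 2 ^ (q * N)" by (simp add: power_mult)
    also have "\<dots> \<le> 2 ^ r" by (intro power_increasing) (auto simp: q_def)
    finally show ?thesis .
  qed
  define r0 where "r0 = N * q0"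
  show ?thesis
  proof (rule exI[of _ "(C * (r0 + 1)) ^ N + 1"], intro allI impI)
    fix M r :: nat assume M: "(C * (r0 + 1)) ^ N + 1 \<le> M" "2 ^ r \<le> M"
    show "(C * (r + 1)) ^ N < M"
    proof (cases "r \<ge> r0")
      case True
      thus ?thesis using large[of r] M(2) by (simp add: r0_def)
    next
      case False
      have "(C * (r + 1)) ^ N \<le> (C * (r0 + 1)) ^ N"
        using False by (intro power_mono mult_left_mono) auto
      thus ?thesis using M(1) by simp
    qed
  qed
qed (auto intro!: exI[of _ 2])

section \<open>Small exponents by the pigeonhole principle\<close>

lemma ex_primitive_root_of_unity:
  assumes "M > 0"
  shows "\<exists>z :: complex. (\<forall>j. z ^ j = 1 \<longleftrightarrow> M dvd j) \<and> (\<forall>u. u ^ M = 1 \<longrightarrow> (\<exists>a. u = z ^ a))"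
proof -
  define z where "z = cis (2 * pi / real M)"
  have bij: "bij_betw (\<lambda>k. cis (2 * pi * real k / real M)) {..<M} {z. z ^ M = 1}"
    by (rule bij_betw_roots_unity[OF assms])
  have pow: "z ^ k = cis (2 * pi * real k / real M)" for k
    by (simp add: z_def DeMoivre mult_ac)
  have "z ^ M = 1" using assms by (simp add: pow)
  have "z ^ j = 1 \<longleftrightarrow> M dvd j" for j
  proof -
    have "z ^ j = z ^ (j mod M)"
      using power_add[of z "M * (j div M)" "j mod M"] by (simp add: power_mult \<open>z ^ M = 1\<close>)
    moreover have "z ^ (j mod M) = z ^ 0 \<longleftrightarrow> j mod M = 0"
      using inj_on_eq_iff[OF bij_betw_imp_inj_on[OF bij], of "j mod M" 0] assms unfolding pow by simp
    ultimately show ?thesis by (simp add: dvd_eq_mod_eq_0)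
  qed
  moreover have "\<exists>a. u = z ^ a" if "u ^ M = 1" for u
    using that bij by (auto simp: bij_betw_def pow image_def)
  ultimately show ?thesis by blast
qed

lemma root_of_unity_powi:
  assumes "\<rho> ^ g = (1 :: complex)" "g > 0"
  shows "\<exists>i. \<rho> powi r = \<rho> ^ (i :: nat)"
proof (cases "r \<ge> 0")
  case False
  have "\<rho> * \<rho> ^ (g - 1) = 1" using assms by (simp flip: power_Suc)
  hence "inverse \<rho> = \<rho> ^ (g - 1)" by (rule inverse_unique)
  hence "\<rho> powi r = \<rho> ^ ((g - 1) * nat (- r))"
    using False by (simp add: power_int_def power_mult flip: power_inverse)
  thus ?thesis by blast
qed (auto simp: power_int_def)

text \<open>Minkowski's argument: some multiple \<open>s\<close> of the exponents of the elements of \<open>\<Omega>\<close> is small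
  modulo \<open>M\<close>. Since \<open>s\<close> need not be coprime to \<open>M\<close>, the factor \<open>g = gcd s M\<close> is lost, but only up
  to the \<open>g\<close>-th roots of unity \<open>b \<omega>\<close>, and the exponents shrink by the same factor.\<close>

lemma roots_of_unity_small_exponents:
  fixes z :: complex and \<Omega> :: "complex set"
  assumes M: "M > 0" and primitive: "\<And>j. z ^ j = 1 \<longleftrightarrow> M dvd j"
    and \<Omega>: "finite \<Omega>" "\<And>\<omega>. \<omega> \<in> \<Omega> \<Longrightarrow> \<exists>a. \<omega> = z ^ a" and Q: "Q > 0" "Q ^ card \<Omega> < M"
  obtains g :: nat and \<zeta> \<rho> :: complex and x y :: nat and b :: "complex \<Rightarrow> complex" and w :: "complex \<Rightarrow> int"
  where "g > 0" "g < M" "\<rho> ^ g = 1" "\<zeta> \<noteq> 0" "z = \<zeta> ^ x * \<rho> ^ y"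
    "\<forall>\<omega>\<in>\<Omega>. \<omega> = b \<omega> * \<zeta> powi w \<omega> \<and> (\<exists>i. b \<omega> = \<rho> ^ i) \<and> nat \<bar>w \<omega>\<bar> * g * Q < M"
proof -
  obtain a where a: "\<And>\<omega>. \<omega> \<in> \<Omega> \<Longrightarrow> \<omega> = z ^ a \<omega>" using \<Omega>(2) by metis
  \<comment> \<open>The residues modulo \<open>M\<close> are cut into \<open>Q\<close> intervals;
    \<open>f s\<close> records the interval of \<open>s * a \<omega>\<close> for every \<omega>,
    which leaves \<open>Q ^ card \<Omega> < M\<close> possibilities.\<close>
  define f where "f = (\<lambda>s. \<lambda>\<omega>\<in>\<Omega>. ((s * a \<omega>) mod M) * Q div M)"
  have div_less: "(s mod M) * Q div M < Q" for s
  proof -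
    have "(s mod M) * Q < M * Q" using M Q(1) by (intro mult_strict_right_mono) auto
    thus ?thesis using M by (simp add: div_less_iff_less_mult mult.commute)
  qed
  have "\<not> inj_on f {..<M}"
  proof
    assume inj: "inj_on f {..<M}"
    have "f ` {..<M} \<subseteq> \<Omega> \<rightarrow>\<^sub>E {..<Q}"
      using div_less by (auto simp: f_def)
    hence "card (f ` {..<M}) \<le> card (\<Omega> \<rightarrow>\<^sub>E {..<Q})"
      using \<Omega>(1) by (intro card_mono finite_PiE) auto
    also have "\<dots> = Q ^ card \<Omega>" using \<Omega>(1) by (simp add: card_PiE)
    also have "card (f ` {..<M}) = M" using card_image[OF inj] by simp
    finally show False using Q(2) by simp
  qed
  then obtain s1 s2 where s12: "s1 < s2" "s2 < M" "f s1 = f s2"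
    by (auto simp: inj_on_def) (metis linorder_neqE_nat)
  define s where "s = s2 - s1"
  have s: "0 < s" "s < M" using s12 by (auto simp: s_def)
  define v where "v = (\<lambda>\<omega>. int ((s2 * a \<omega>) mod M) - int ((s1 * a \<omega>) mod M))"
  have v_small: "\<bar>v \<omega>\<bar> * int Q < int M" if "\<omega> \<in> \<Omega>" for \<omega>
  proof -
    define X Y where "X = (s2 * a \<omega>) mod M * Q" and "Y = (s1 * a \<omega>) mod M * Q"
    have "X div M = Y div M"
      using fun_cong[OF s12(3), of \<omega>] that by (simp add: f_def X_def Y_def)
    hence "int X - int Y = int (X mod M) - int (Y mod M)"
      by (metis (no_types) add_diff_cancel_left of_nat_add mult_div_mod_eq)
    hence "\<bar>int X - int Y\<bar> < int M"
      using M mod_less_divisor[of M X] mod_less_divisor[of M Y] by linarith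
    moreover have "int X - int Y = v \<omega> * int Q"
      by (simp add: X_def Y_def v_def algebra_simps)
    ultimately show ?thesis by (simp add: abs_mult)
  qed
  have v_cong: "int M dvd int s * int (a \<omega>) - v \<omega>" for \<omega>
  proof -
    have "[int s2 * int (a \<omega>) - int s1 * int (a \<omega>) = v \<omega>] (mod int M)"
      unfolding v_def by (intro cong_diff) (simp_all add: cong_def zmod_int)
    moreover have "int s = int s2 - int s1" using s12 by (simp add: s_def)
    ultimately show ?thesis by (simp add: cong_iff_dvd_diff left_diff_distrib)
  qed
  define g where "g = gcd s M"
  define s' M' where "s' = s div g" and "M' = M div g"
  have "g \<le> s" unfolding g_def using s by (intro gcd_le1_nat) auto
  moreover have "g > 0" using s by (simp add: g_def)
  ultimately have g: "g > 0" "g < M" using s by simp_all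
  have sg: "s = g * s'" "M = g * M'" by (simp_all add: s'_def M'_def g_def)
  have "coprime s' M'" using M by (auto simp: s'_def M'_def g_def intro: div_gcd_coprime)
  then obtain t where t: "[s' * t = 1] (mod M')" using cong_solve_coprime_nat by auto
  have "M' > 1" using g sg(2) by (metis less_irrefl_nat mult.right_neutral mult_0_right nat_neq_iff less_one M)
  \<comment> \<open>Since \<open>t\<close> inverts \<open>s'\<close> modulo \<open>M'\<close>, the
    power \<open>z ^ t\<close> can serve as \<zeta>: raising it to \<open>s'\<close> gives back
    \<open>z\<close> up to a power of \<open>z ^ M'\<close>, which is \<rho>.\<close>
  define k where "k = s' * t div M'"
  have k: "s' * t = 1 + M' * k"
    using t \<open>M' > 1\<close> mult_div_mod_eq[of M' "s' * t"] by (simp add: cong_def k_def)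
  define \<zeta> \<rho> where "\<zeta> = z ^ t" and "\<rho> = z ^ M'"
  have "z ^ M = 1" by (simp add: primitive)
  hence "z \<noteq> 0" using M by (auto simp: power_0_left)
  have \<rho>: "\<rho> ^ g = 1" using \<open>z ^ M = 1\<close> sg(2) by (simp add: \<rho>_def mult.commute flip: power_mult)
  \<comment> \<open>\<open>\<rho> ^ (k * (g - 1))\<close> is the inverse of
    \<open>\<rho> ^ k\<close>, written without negative exponents.\<close>
  have z: "z = \<zeta> ^ s' * \<rho> ^ (k * (g - 1))"
  proof -
    have "\<zeta> ^ s' = z * \<rho> ^ k"
      unfolding \<zeta>_def \<rho>_def power_mult [symmetric] by (simp add: mult.commute[of t] k power_add)
    hence "\<zeta> ^ s' * \<rho> ^ (k * (g - 1)) = z * \<rho> ^ (k + k * (g - 1))"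
      by (simp add: power_add)
    also have "k + k * (g - 1) = g * k" using g(1) by (cases g) auto
    also have "\<rho> ^ (g * k) = 1" by (simp add: power_mult \<rho>)
    finally show ?thesis by simp
  qed
  define w where "w = (\<lambda>\<omega>. v \<omega> div int g)"
  have gv: "v \<omega> = int g * w \<omega>" for \<omega>
  proof -
    have "int g dvd int M" "int g dvd int s * int (a \<omega>)" by (simp_all add: g_def)
    hence "int g dvd int s * int (a \<omega>) - (int s * int (a \<omega>) - v \<omega>)"
      using dvd_trans[OF _ v_cong] by (metis dvd_diff)
    thus ?thesis by (simp add: w_def)
  qed
  \<comment> \<open>Multiplication by \<open>t\<close> solves the congruence between
    \<open>s' * a \<omega>\<close> and \<open>w \<omega>\<close> modulo \<open>M'\<close> for
    \<open>a \<omega>\<close>. Therefore \<omega> and \<open>\<zeta> powi w \<omega>\<close> differ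
    by a power of \<rho>.\<close>
  have w_cong: "int M' dvd int (a \<omega>) - int t * w \<omega>" for \<omega>
  proof -
    have "int g * int M' dvd int g * (int s' * int (a \<omega>) - w \<omega>)"
      using v_cong[of \<omega>] unfolding gv by (simp add: sg algebra_simps)
    hence "int M' dvd int s' * int (a \<omega>) - w \<omega>" using g by simp
    hence dvd: "int M' dvd int t * (int s' * int (a \<omega>) - w \<omega>)" by simp
    have ts: "int t * int s' = 1 + int M' * int k"
      using k by (metis mult.commute of_nat_1 of_nat_add of_nat_mult)
    have "int t * (int s' * int (a \<omega>) - w \<omega>) = (int t * int s') * int (a \<omega>) - int t * w \<omega>"
      by (simp add: algebra_simps)
    also have "\<dots> = (int (a \<omega>) - int t * w \<omega>) + int M' * (int k * int (a \<omega>))"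
      unfolding ts by (simp add: algebra_simps)
    finally have eq: "int t * (int s' * int (a \<omega>) - w \<omega>) =
      (int (a \<omega>) - int t * w \<omega>) + int M' * (int k * int (a \<omega>))" .
    show ?thesis using dvd unfolding eq by (subst (asm) dvd_add_left_iff) simp_all
  qed
  define b where "b = (\<lambda>\<omega>. \<omega> * \<zeta> powi (- w \<omega>))"
  have \<zeta>0: "\<zeta> \<noteq> 0" using \<open>z \<noteq> 0\<close> by (simp add: \<zeta>_def)
  have b1: "\<omega> = b \<omega> * \<zeta> powi w \<omega>" for \<omega>
    using \<zeta>0 by (simp add: b_def power_int_minus)
  have b2: "\<exists>i. b \<omega> = \<rho> ^ i" if "\<omega> \<in> \<Omega>" for \<omega>
  proof -
    obtain r where r: "int (a \<omega>) - int t * w \<omega> = int M' * r" using w_cong by blast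
    have "\<zeta> powi (- w \<omega>) = z powi (int t * (- w \<omega>))"
      unfolding power_int_mult by (simp add: \<zeta>_def)
    hence "b \<omega> = z powi (int (a \<omega>)) * z powi (int t * (- w \<omega>))"
      unfolding b_def using a[OF that] by simp
    also have "\<dots> = z powi (int (a \<omega>) + int t * (- w \<omega>))"
      using \<open>z \<noteq> 0\<close> by (subst power_int_add) simp_all
    also have "int (a \<omega>) + int t * (- w \<omega>) = int M' * r" using r by simp
    also have "z powi (int M' * r) = \<rho> powi r" by (simp add: power_int_mult \<rho>_def)
    finally show ?thesis using root_of_unity_powi[OF \<rho> g(1), of r] by simp
  qed
  have w_small: "nat \<bar>w \<omega>\<bar> * g * Q < M" if "\<omega> \<in> \<Omega>" for \<omega>
  proof -
    have "int (nat \<bar>w \<omega>\<bar> * g * Q) < int M"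
      using v_small[OF that] unfolding gv by (simp add: abs_mult mult_ac)
    thus ?thesis by (simp only: of_nat_less_iff)
  qed
  show ?thesis
    using b1 b2 w_small by (intro that[OF g \<rho> \<zeta>0 z] ballI conjI)
qed

section \<open>Laurent polynomials attached to sums of roots of unity\<close>

text \<open>Adjoining \<zeta> to the span of \<open>Y\<close> gives a ring with at most
  \<open>degree G * card Y\<close> generators. It contains \<open>z\<close>, whose degree over the
  rationals is at least \<open>totient M\<close> and at most the number of generators.\<close>

lemma totient_le_degree_mult_card:
  fixes z \<zeta> \<rho> :: complex
  assumes Y: "finite Y" "subring_set (span_over \<rat> Y)"
    and G: "G \<in> polys_over (span_over \<rat> Y)" "G \<noteq> 0" "poly G \<zeta> = 0"
    and z: "M > 0" "\<And>j. z ^ j = 1 \<longleftrightarrow> M dvd j" "z = \<zeta> ^ x * \<rho> ^ y" "\<rho> \<in> span_over \<rat> Y"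
  shows "totient M \<le> degree G * card Y"
proof -
  interpret Q: subring_set "\<rat> :: complex set" by (rule subring_set_Rats)
  interpret R: subring_set "span_over \<rat> Y" by fact
  define G' where "G' = Polynomial.smult (inverse (lead_coeff G)) G"
  \<comment> \<open>The span is a field, as its elements are algebraic over the rationals; so
    \<open>G\<close> can be made monic.\<close>
  have "lead_coeff G \<in> span_over \<rat> Y" using coeff_mem[OF G(1)] .
  moreover from this obtain h where "h \<in> polys_over \<rat>" "lead_coeff h = 1" "poly h (lead_coeff G) = 0"
    using span_over_subset_integral_closure[OF subring_set_Rats Y]
    by (auto simp: integral_closure_def)
  moreover have "\<rat> \<subseteq> span_over \<rat> Y"
    using Q.span_over_scale[OF R.one_mem] by auto
  ultimately have "inverse (lead_coeff G) \<in> span_over \<rat> Y"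
    by (intro inverse_mem_of_algebraic[OF subring_set_Rats Rats_inverse Y(2), of _ h]) auto
  hence "G' \<in> polys_over (span_over \<rat> Y)" "lead_coeff G' = 1" "poly G' \<zeta> = 0"
    using G by (auto simp: G'_def intro!: R.smult_mem_polys_over)
  from span_over_adjoin[OF subring_set_Rats Y this] obtain Z where
    Z: "finite Z" "card Z \<le> degree G' * card Y" "subring_set (span_over \<rat> Z)"
      "span_over \<rat> Y \<subseteq> span_over \<rat> Z" "\<zeta> \<in> span_over \<rat> Z"
    by (elim exE conjE)
  interpret S: subring_set "span_over \<rat> Z" by fact
  have "z \<in> span_over \<rat> Z"
    unfolding z(3) using Z z(4) by (intro S.mult_mem S.power_mem) auto
  hence "z * t \<in> span_over \<rat> Z" if "t \<in> Z" for t
    by (rule S.mult_mem[OF _ Q.span_over_base[OF Z(1) that]])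
  from span_over_multiplication_integral[OF subring_set_Rats Z(1) S.one_mem this] obtain f where
    f: "f \<in> polys_over \<rat>" "degree f = card Z" "lead_coeff f = 1" "poly f z = 0"
    by blast
  have "f \<noteq> 0" using f(3) by auto
  have "totient M \<le> degree f"
    by (rule totient_le_degree[OF z(1,2) f(1) \<open>f \<noteq> 0\<close> f(4)])
  also have "\<dots> \<le> degree G * card Y"
    using f(2) Z(2) G(2) by (simp add: G'_def)
  finally show ?thesis .
qed

text \<open>This is \<open>U ^ m * f (V / U)\<close> with denominators cleared. A common
  \<open>m\<close> for \<open>p\<close> and \<open>q\<close>, possibly above one of their degrees,
  gives both the same denominator.\<close>

definition homogenized :: "nat \<Rightarrow> 'a :: comm_ring_1 poly \<Rightarrow> 'a poly \<Rightarrow> 'a poly \<Rightarrow> 'a poly" where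
  "homogenized m f U V = (\<Sum>i\<le>m. Polynomial.smult (coeff f i) (V ^ i * U ^ (m - i)))"

lemma poly_altdef_le:
  fixes f :: "'a :: comm_semiring_1 poly"
  shows "degree f \<le> m \<Longrightarrow> poly f x = (\<Sum>i\<le>m. coeff f i * x ^ i)"
  unfolding poly_altdef by (intro sum.mono_neutral_left) (auto simp: coeff_eq_0)

lemma poly_homogenized:
  fixes f :: "'a :: field poly"
  assumes "degree f \<le> m" "poly U x \<noteq> 0"
  shows "poly (homogenized m f U V) x = poly U x ^ m * poly f (poly V x / poly U x)"
  unfolding homogenized_def poly_sum poly_altdef_le[OF assms(1)] sum_distrib_left
proof (rule sum.cong)
  fix i assume "i \<in> {..m}"
  hence "poly U x ^ m = poly U x ^ i * poly U x ^ (m - i)" by (simp flip: power_add)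
  thus "poly (Polynomial.smult (coeff f i) (V ^ i * U ^ (m - i))) x =
      poly U x ^ m * (coeff f i * (poly V x / poly U x) ^ i)"
    using assms(2) by (simp add: power_divide)
qed auto

section \<open>Passage to the field of rational functions\<close>

lemma ratfun_const_0: "ratfun_const 0 = 0"
  and ratfun_const_add: "ratfun_const (a + b) = ratfun_const a + ratfun_const b"
  and ratfun_const_mult: "ratfun_const (a * b) = ratfun_const a * ratfun_const b"
  by (simp_all add: ratfun_const_def flip: to_fract_add to_fract_mult)

lemma ratfun_const_eq_0_iff: "ratfun_const a = 0 \<longleftrightarrow> a = 0"
  by (simp add: ratfun_const_def)

lemma poly_ratfun_const: "poly (map_poly ratfun_const f) (ratfun_const s) = ratfun_const (poly f s)"
  by (induction f) (simp_all add: map_poly_pCons ratfun_const_0 ratfun_const_add ratfun_const_mult)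

lemma to_fract_power: "to_fract (a ^ n) = to_fract a ^ n"
  by (induction n) simp_all

lemma to_fract_smult: "to_fract (Polynomial.smult c f) = ratfun_const c * to_fract f"
  by (simp add: ratfun_const_def flip: to_fract_mult)

text \<open>The function-field twin of \<open>poly_homogenized\<close>: that one evaluates a
  relation at \<zeta>, this one turns the resulting polynomial identity into an identity for
  \<open>S = V / U\<close>.\<close>

lemma to_fract_homogenized:
  assumes "degree f \<le> m" "U \<noteq> 0"
  shows "to_fract (homogenized m f U V) =
    to_fract U ^ m * poly (map_poly ratfun_const f) (to_fract V / to_fract U)"
proof -
  have "degree (map_poly ratfun_const f) \<le> m"
    using assms(1) degree_map_poly_le[of ratfun_const f] by simp
  hence "to_fract U ^ m * poly (map_poly ratfun_const f) (to_fract V / to_fract U) =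
      (\<Sum>i\<le>m. to_fract U ^ m * (ratfun_const (coeff f i) * (to_fract V / to_fract U) ^ i))"
    by (simp add: poly_altdef_le coeff_map_poly ratfun_const_0 sum_distrib_left)
  also have "\<dots> = (\<Sum>i\<le>m. to_fract (Polynomial.smult (coeff f i) (V ^ i * U ^ (m - i))))"
  proof (rule sum.cong)
    fix i assume "i \<in> {..m}"
    hence "to_fract U ^ m = to_fract U ^ i * to_fract U ^ (m - i)" by (simp flip: power_add)
    thus "to_fract U ^ m * (ratfun_const (coeff f i) * (to_fract V / to_fract U) ^ i) =
        to_fract (Polynomial.smult (coeff f i) (V ^ i * U ^ (m - i)))"
      using assms(2) by (simp add: power_divide to_fract_smult to_fract_power)
  qed auto
  finally show ?thesis by (simp add: homogenized_def)
qed

lemma degree_homogenized_le: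
  assumes "degree U \<le> d" "degree V \<le> d"
  shows "degree (homogenized m f U V) \<le> m * d"
  unfolding homogenized_def
proof (rule degree_sum_le)
  fix i assume i: "i \<in> {..m}"
  have "degree (V ^ i) \<le> d * i" "degree (U ^ (m - i)) \<le> d * (m - i)"
    by (rule order.trans[OF degree_power_le mult_right_mono[OF assms(2)]]
          order.trans[OF degree_power_le mult_right_mono[OF assms(1)]]; simp)+
  moreover have "d * i + d * (m - i) = m * d"
    using i by (simp add: mult.commute flip: distrib_left)
  ultimately show "degree (Polynomial.smult (coeff f i) (V ^ i * U ^ (m - i))) \<le> m * d"
    using degree_smult_le[of "coeff f i" "V ^ i * U ^ (m - i)"] degree_mult_le[of "V ^ i" "U ^ (m - i)"]
    by linarith
qed simp

lemma (in subring_set) homogenized_mem_polys_over: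
  assumes "f \<in> polys_over A" "U \<in> polys_over A" "V \<in> polys_over A"
  shows "homogenized m f U V \<in> polys_over A"
proof -
  interpret polys: subring_set "polys_over A" by (rule subring_set_polys_over)
  show ?thesis
    unfolding homogenized_def using assms
    by (intro polys.sum_mem smult_mem_polys_over polys.mult_mem polys.power_mem coeff_mem)
qed

text \<open>A list of pairs \<open>(e, \<xi>)\<close> represents the sum of the \<open>e * \<xi>\<close>. Replacing each \<open>\<xi>\<close> by
  \<open>b \<xi> * X powi w \<xi>\<close> gives a Laurent polynomial, which \<open>pair_poly\<close> multiplies by \<open>X ^ W\<close>.\<close>

definition pair_sum :: "(complex \<times> complex) list \<Rightarrow> complex" where
  "pair_sum xs = (\<Sum>t\<leftarrow>xs. fst t * snd t)"

definition pair_poly ::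
    "nat \<Rightarrow> (complex \<Rightarrow> complex) \<Rightarrow> (complex \<Rightarrow> int) \<Rightarrow> (complex \<times> complex) list \<Rightarrow> complex poly" where
  "pair_poly W b w xs = (\<Sum>t\<leftarrow>xs. monom (fst t * b (snd t)) (nat (w (snd t) + int W)))"

lemma poly_pair_poly:
  assumes "\<zeta> \<noteq> 0" "\<And>\<xi>. \<xi> \<in> snd ` set xs \<Longrightarrow> \<xi> = b \<xi> * \<zeta> powi w \<xi>"
    and "\<And>\<xi>. \<xi> \<in> snd ` set xs \<Longrightarrow> nat \<bar>w \<xi>\<bar> \<le> W"
  shows "poly (pair_poly W b w xs) \<zeta> = \<zeta> ^ W * pair_sum xs"
  using assms(2,3)
proof (induction xs)
  case (Cons t xs)
  have "w (snd t) + int W \<ge> 0" using Cons.prems(2)[of "snd t"] by auto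
  hence "\<zeta> ^ nat (w (snd t) + int W) = \<zeta> powi (w (snd t) + int W)"
    by (simp add: power_int_def)
  also have "\<dots> = \<zeta> powi w (snd t) * \<zeta> ^ W"
    using assms(1) by (simp add: power_int_add)
  finally have "poly (monom (fst t * b (snd t)) (nat (w (snd t) + int W))) \<zeta> =
      \<zeta> ^ W * (fst t * (b (snd t) * \<zeta> powi w (snd t)))"
    by (simp add: poly_monom)
  also have "b (snd t) * \<zeta> powi w (snd t) = snd t" using Cons.prems(1)[of "snd t"] by simp
  finally show ?case
    using Cons by (simp add: pair_poly_def pair_sum_def algebra_simps)
qed (simp add: pair_poly_def pair_sum_def)

lemma degree_pair_poly_le:
  assumes "\<And>\<xi>. \<xi> \<in> snd ` set xs \<Longrightarrow> nat \<bar>w \<xi>\<bar> \<le> W"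
  shows "degree (pair_poly W b w xs) \<le> 2 * W"
  using assms
proof (induction xs)
  case (Cons t xs)
  have "nat (w (snd t) + int W) \<le> 2 * W" using Cons.prems[of "snd t"] by auto
  hence "degree (monom (fst t * b (snd t)) (nat (w (snd t) + int W))) \<le> 2 * W"
    using degree_monom_le order.trans by blast
  thus ?case using Cons by (simp add: pair_poly_def degree_add_le)
qed (simp add: pair_poly_def)

lemma pair_poly_mem_polys_over:
  assumes "subring_set A" "\<And>t. t \<in> set xs \<Longrightarrow> fst t \<in> A \<and> b (snd t) \<in> A"
  shows "pair_poly W b w xs \<in> polys_over A"
proof -
  interpret subring_set A by fact
  interpret polys: subring_set "polys_over A" by (rule subring_set_polys_over)
  show ?thesis
    unfolding pair_poly_def using assms
    by (intro polys.sum_list_mem monom_mem_polys_over mult_mem) auto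
qed

lemma to_fract_pair_poly:
  assumes "\<And>\<xi>. \<xi> \<in> snd ` set xs \<Longrightarrow> nat \<bar>w \<xi>\<bar> \<le> W"
  shows "to_fract (pair_poly W b w xs) =
    ratfun_X ^ W * (\<Sum>t\<leftarrow>xs. ratfun_const (fst t * b (snd t)) * ratfun_X powi w (snd t))"
  using assms
proof (induction xs)
  case (Cons t xs)
  have X: "ratfun_X \<noteq> 0" by (simp add: ratfun_X_def)
  have "w (snd t) + int W \<ge> 0" using Cons.prems[of "snd t"] by auto
  hence "ratfun_X ^ nat (w (snd t) + int W) = ratfun_X powi (w (snd t) + int W)"
    by (simp add: power_int_def)
  also have "\<dots> = ratfun_X powi w (snd t) * ratfun_X ^ W"
    using X by (simp add: power_int_add)
  finally have "ratfun_X ^ nat (w (snd t) + int W) = ratfun_X powi w (snd t) * ratfun_X ^ W" .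
  moreover have "monom a n = Polynomial.smult a ([:0, 1:] ^ n)" for a :: complex and n
    by (simp add: monom_altdef)
  ultimately have "to_fract (monom (fst t * b (snd t)) (nat (w (snd t) + int W))) =
      ratfun_const (fst t * b (snd t)) * (ratfun_X powi w (snd t) * ratfun_X ^ W)"
    by (simp only: to_fract_smult to_fract_power ratfun_X_def)
  thus ?case
    using Cons by (simp add: pair_poly_def algebra_simps)
qed (simp add: pair_poly_def)

text \<open>If the Laurent polynomial of \<open>xs\<close> is constant, its nonconstant terms cancel, and may
  be dropped.\<close>

lemma pair_sum_filter:
  assumes "\<zeta> \<noteq> 0" "\<And>\<xi>. \<xi> \<in> snd ` set xs \<Longrightarrow> \<xi> = b \<xi> * \<zeta> powi w \<xi>"
    and W: "\<And>\<xi>. \<xi> \<in> snd ` set xs \<Longrightarrow> nat \<bar>w \<xi>\<bar> \<le> W"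
    and "pair_poly W b w xs = monom k W"
  shows "pair_sum (filter (\<lambda>t. w (snd t) = 0) xs) = pair_sum xs"
proof -
  \<comment> \<open>Because of the shift by \<open>W\<close>, the coefficient at \<open>W\<close>
    collects exactly the terms with exponent 0, and for those
    \<open>b \<xi> = \<xi>\<close>.\<close>
  have "coeff (pair_poly W b w xs) W = pair_sum (filter (\<lambda>t. w (snd t) = 0) xs)"
    using assms(2) W
  proof (induction xs)
    case (Cons t xs)
    have "nat (w (snd t) + int W) = W \<longleftrightarrow> w (snd t) = 0" using Cons.prems(2)[of "snd t"] by auto
    moreover have "b (snd t) = snd t" if "w (snd t) = 0"
      using Cons.prems(1)[of "snd t"] that by simp
    ultimately show ?case
      using Cons by (auto simp: pair_poly_def pair_sum_def)
  qed (simp add: pair_poly_def pair_sum_def)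
  moreover have "poly (pair_poly W b w xs) \<zeta> = \<zeta> ^ W * pair_sum xs"
    using assms(2) W by (intro poly_pair_poly[OF assms(1)]; blast)
  hence "\<zeta> ^ W * k = \<zeta> ^ W * pair_sum xs"
    unfolding assms(4) poly_monom by (simp only: mult.commute)
  hence "pair_sum xs = k" using assms(1) by simp
  ultimately show ?thesis using assms(4) by simp
qed

text \<open>The three sums are specializations at \<open>\<zeta>\<close> of Laurent polynomials, and a relation between
  these that vanishes at \<open>\<zeta>\<close> without being an identity would have too small a degree.
  Minimality of the representations excludes that \<open>S\<close> is constant.\<close>

lemma torsion_relations_lift:
  fixes p q :: "complex poly" and xs ys zs ts :: "(complex \<times> complex) list" and c :: nat
  assumes ts_def: "ts = xs @ ys @ zs"
    and X: "finite X" "subring_set (span_over \<rat> X)"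
    and pq: "p \<in> polys_over (span_over \<rat> X)" "q \<in> polys_over (span_over \<rat> X)"
    and m: "degree p \<le> m" "degree q \<le> m"
    and ts: "fst ` set ts \<subseteq> span_over \<rat> X" "snd ` set ts \<subseteq> roots_of_unity"
    and c: "c > 0" and \<alpha>: "poly q \<alpha> \<noteq> 0"
    and sums: "pair_sum xs = poly p \<alpha> / poly q \<alpha>" "pair_sum ys = of_nat c / poly q \<alpha>"
      "pair_sum zs = of_nat c * \<alpha> / poly q \<alpha>"
    and minimal: "\<forall>P. pair_sum (filter P xs) = pair_sum xs \<longrightarrow> pair_sum (filter P ys) = pair_sum ys \<longrightarrow>
      pair_sum (filter P zs) = pair_sum zs \<longrightarrow> (\<forall>t\<in>set ts. P t)"
    and M: "M > 0" "\<forall>\<xi>\<in>snd ` set ts. \<xi> ^ M = 1"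
      "\<forall>g>0. g < M \<longrightarrow> (\<exists>\<xi>\<in>snd ` set ts. \<xi> ^ g \<noteq> 1)"
    and large: "\<forall>r. 2 ^ r \<le> M \<longrightarrow> (2 * (m + 1) * card X * (r + 1)) ^ length ts < M"
  shows "\<exists>b w U V S. (\<forall>\<xi>\<in>snd ` set ts. b \<xi> \<in> roots_of_unity) \<and>
    (\<forall>A. subring_set A \<longrightarrow> fst ` set ts \<subseteq> A \<longrightarrow> roots_of_unity \<subseteq> A \<longrightarrow> U \<in> polys_over A \<and> V \<in> polys_over A) \<and>
    U \<noteq> 0 \<and> S = to_fract V / to_fract U \<and> nonconstant S \<and>
    (\<Sum>t\<leftarrow>xs. ratfun_const (fst t * b (snd t)) * ratfun_X powi w (snd t)) =
      poly (map_poly ratfun_const p) S / poly (map_poly ratfun_const q) S"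
proof -
  interpret Q: subring_set "\<rat> :: complex set" by (rule subring_set_Rats)
  interpret R: subring_set "span_over \<rat> X" by fact
  define \<Omega> where "\<Omega> = snd ` set ts"
  have fin\<Omega>: "finite \<Omega>" by (simp add: \<Omega>_def)
  have card\<Omega>: "card \<Omega> \<le> length ts"
    unfolding \<Omega>_def using card_image_le[of "set ts" snd] card_length[of ts] by simp
  obtain z :: complex where "\<forall>j. z ^ j = 1 \<longleftrightarrow> M dvd j" "\<forall>u. u ^ M = 1 \<longrightarrow> (\<exists>a. u = z ^ a)"
    using ex_primitive_root_of_unity[OF M(1)] by (elim exE conjE)
  hence z: "z ^ j = 1 \<longleftrightarrow> M dvd j" "u ^ M = 1 \<Longrightarrow> \<exists>a. u = z ^ a" for j u
    by simp_all
  obtain r where r: "2 ^ r \<le> M" "M \<le> (r + 1) * totient M"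
    using totient_lower_bound[OF M(1)] by blast
  \<comment> \<open>The factors anticipate \<open>vanish\<close>: a relation of degree at most
    \<open>2 * W * (m + 1)\<close> over a field with at most \<open>g * card X\<close> generators,
    and then \<open>r + 1\<close> for the quotient of \<open>M\<close> by
    \<open>totient M\<close>.\<close>
  define C where "C = 2 * (m + 1) * card X"
  define K where "K = C * (r + 1)"
  have "X \<noteq> {}" using R.one_mem by (auto simp: span_over_def)
  hence K: "K > 0" using X(1) by (simp add: K_def C_def card_gt_0_iff)
  hence "K ^ card \<Omega> \<le> K ^ length ts" using card\<Omega> by (intro power_increasing) auto
  also have "\<dots> < M" using large r(1) by (simp add: K_def C_def del: add_2_eq_Suc')
  finally have "K ^ card \<Omega> < M" .
  moreover have "\<exists>a. \<omega> = z ^ a" if "\<omega> \<in> \<Omega>" for \<omega>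
    using M(2) that unfolding \<Omega>_def by (intro z(2)) blast
  ultimately obtain g :: nat and \<zeta> \<rho> :: complex and i j :: nat
      and b :: "complex \<Rightarrow> complex" and w :: "complex \<Rightarrow> int"
    where g: "g > 0" "g < M" and \<rho>: "\<rho> ^ g = 1" and \<zeta>: "\<zeta> \<noteq> 0" "z = \<zeta> ^ i * \<rho> ^ j"
    and "\<forall>\<omega>\<in>\<Omega>. \<omega> = b \<omega> * \<zeta> powi w \<omega> \<and> (\<exists>i. b \<omega> = \<rho> ^ i) \<and> nat \<bar>w \<omega>\<bar> * g * K < M"
    using roots_of_unity_small_exponents[OF M(1) z(1) fin\<Omega> _ K, of thesis] by simp
  hence bw: "\<omega> = b \<omega> * \<zeta> powi w \<omega>" "\<exists>i. b \<omega> = \<rho> ^ i" "nat \<bar>w \<omega>\<bar> * g * K < M"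
    if "\<omega> \<in> \<Omega>" for \<omega>
    using that by simp_all
  define W where "W = Max (insert 0 ((\<lambda>\<omega>. nat \<bar>w \<omega>\<bar>) ` \<Omega>))"
  have w_le: "nat \<bar>w \<omega>\<bar> \<le> W" if "\<omega> \<in> \<Omega>" for \<omega>
    unfolding W_def using that fin\<Omega> by (intro Max_ge) auto
  have W: "W * g * K < M"
  proof -
    have "W \<in> insert 0 ((\<lambda>\<omega>. nat \<bar>w \<omega>\<bar>) ` \<Omega>)"
      unfolding W_def using fin\<Omega> by (intro Max_in) auto
    thus ?thesis using bw(3) M(1) by auto
  qed
  have \<Omega>_sub: "snd ` set xs \<subseteq> \<Omega>" "snd ` set ys \<subseteq> \<Omega>" "snd ` set zs \<subseteq> \<Omega>"
    by (auto simp: \<Omega>_def ts_def)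
  define F where "F = pair_poly W b w xs"
  define U where "U = pair_poly W b w ys"
  define V where "V = pair_poly W b w zs"
  have deg: "degree F \<le> 2 * W" "degree U \<le> 2 * W" "degree V \<le> 2 * W"
    unfolding F_def U_def V_def using w_le \<Omega>_sub by (auto intro!: degree_pair_poly_le)
  have val: "poly F \<zeta> = \<zeta> ^ W * pair_sum xs" "poly U \<zeta> = \<zeta> ^ W * pair_sum ys" "poly V \<zeta> = \<zeta> ^ W * pair_sum zs"
    unfolding F_def U_def V_def using w_le \<Omega>_sub \<zeta>(1) bw(1) by (intro poly_pair_poly; blast)+
  have "poly U \<zeta> \<noteq> 0" using val(2) sums(2) c \<alpha> \<zeta>(1) by simp
  hence U0: "U \<noteq> 0" by auto
  have quot: "poly V \<zeta> / poly U \<zeta> = \<alpha>"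
    using val sums c \<alpha> \<zeta>(1) by simp

  \<comment> \<open>Adjoining \<rho> through the relation \<open>\<rho> ^ g = 1\<close> costs a
    factor \<open>g\<close>, for which the bound \<open>W * g * K < M\<close> has made
    provision.\<close>
  obtain Y where Y: "finite Y" "card Y \<le> g * card X" "subring_set (span_over \<rat> Y)"
      "span_over \<rat> X \<subseteq> span_over \<rat> Y" "\<rho> \<in> span_over \<rat> Y"
  proof -
    define f where "f = monom 1 g - (1 :: complex poly)"
    interpret polys: subring_set "polys_over (span_over \<rat> X)" by (rule R.subring_set_polys_over)
    have "f \<in> polys_over (span_over \<rat> X)"
      unfolding f_def by (intro polys.diff_mem polys.one_mem R.monom_mem_polys_over R.one_mem)
    moreover have "degree f = g"
      unfolding f_def using g(1) by (intro antisym[OF degree_le le_degree]) (auto simp: coeff_1)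
    moreover have "coeff f g = 1" using g(1) by (simp add: f_def coeff_1)
    moreover have "poly f \<rho> = 0" by (simp add: f_def poly_monom \<rho>)
    ultimately show ?thesis
      using span_over_adjoin[OF subring_set_Rats X, of f \<rho>] that by auto
  qed
  interpret Y: subring_set "span_over \<rat> Y" by fact
  interpret Y_polys: subring_set "polys_over (span_over \<rat> Y)" by (rule Y.subring_set_polys_over)
  have pair_Y: "pair_poly W b w us \<in> polys_over (span_over \<rat> Y)" if us: "set us \<subseteq> set ts" for us
  proof (rule pair_poly_mem_polys_over[OF Y(3)])
    fix t assume t: "t \<in> set us"
    hence "fst t \<in> span_over \<rat> Y" using us ts(1) Y(4) by auto
    moreover obtain k where "b (snd t) = \<rho> ^ k" using bw(2)[of "snd t"] t us by (auto simp: \<Omega>_def)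
    ultimately show "fst t \<in> span_over \<rat> Y \<and> b (snd t) \<in> span_over \<rat> Y"
      using Y.power_mem[OF Y(5)] by simp
  qed
  have FUV: "F \<in> polys_over (span_over \<rat> Y)" "U \<in> polys_over (span_over \<rat> Y)" "V \<in> polys_over (span_over \<rat> Y)"
    unfolding F_def U_def V_def by (auto intro!: pair_Y simp: ts_def)
  have vanish: "G = 0"
    if G: "G \<in> polys_over (span_over \<rat> Y)" "poly G \<zeta> = 0" "degree G \<le> 2 * W * (m + 1)" for G
  proof (rule ccontr)
    assume "G \<noteq> 0"
    have "totient M \<le> degree G * card Y"
      using totient_le_degree_mult_card[OF Y(1,3) G(1) \<open>G \<noteq> 0\<close> G(2) M(1) z(1) \<zeta>(2) Y(5)] .
    also have "\<dots> \<le> 2 * W * (m + 1) * (g * card X)"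
      by (intro mult_mono G(3) Y(2)) auto
    also have "\<dots> = W * g * C" by (simp add: C_def algebra_simps)
    finally have "(r + 1) * totient M \<le> (r + 1) * (W * g * C)" by (rule mult_left_mono) simp
    also have "\<dots> = W * g * K" by (simp add: K_def algebra_simps)
    finally show False using W r(2) by linarith
  qed
  \<comment> \<open>\<open>P1 = P2\<close> lifts \<open>q \<alpha> * (c / q \<alpha>) = c\<close>,
    and \<open>P3 = P4\<close> lifts \<open>p \<alpha> * (c / q \<alpha>) = c * (p \<alpha> / q
    \<alpha>)\<close>. All sides are scaled by \<open>U ^ m\<close>, and \<open>monom 1 W\<close>
    stands for the constant 1 after the shift of exponents by \<open>W\<close>.\<close>
  define P1 where "P1 = homogenized m q U V * U"
  define P2 where "P2 = of_nat c * monom 1 W * U ^ m"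
  define P3 where "P3 = homogenized m p U V * U"
  define P4 where "P4 = of_nat c * F * U ^ m"
  have deg_U: "degree (U ^ m) \<le> 2 * W * m"
    using order.trans[OF degree_power_le mult_right_mono[OF deg(2)]] by simp
  have deg_hom: "degree (homogenized m f U V * U) \<le> 2 * W * (m + 1)" for f
    using degree_mult_le[of "homogenized m f U V" U] degree_homogenized_le[OF deg(2,3), of m f] deg(2)
    by (simp add: algebra_simps)
  have deg_mult: "degree (of_nat c * f * U ^ m) \<le> 2 * W * (m + 1)" if "degree f \<le> 2 * W" for f
  proof -
    have "degree (of_nat c * f * U ^ m) \<le> degree (of_nat c * f) + degree (U ^ m)" by (rule degree_mult_le)
    also have "degree (of_nat c * f) \<le> degree f"
      using degree_mult_le[of "of_nat c" f] by simp
    finally show ?thesis using deg_U that by (simp add: algebra_simps)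
  qed
  have hom_val: "poly (homogenized m f U V * U) \<zeta> = poly U \<zeta> ^ m * (\<zeta> ^ W * (poly f \<alpha> * pair_sum ys))"
    if "degree f \<le> m" for f
    unfolding poly_mult poly_homogenized[OF that \<open>poly U \<zeta> \<noteq> 0\<close>] quot by (simp add: val(2))
  have E1: "P1 = P2"
  proof -
    have "P1 - P2 = 0"
    proof (rule vanish)
      show "P1 - P2 \<in> polys_over (span_over \<rat> Y)"
        unfolding P1_def P2_def using FUV subsetD[OF polys_over_mono[OF Y(4)]] pq
        by (intro Y_polys.diff_mem Y_polys.mult_mem Y.homogenized_mem_polys_over Y_polys.power_mem
            Y_polys.of_nat_mem Y.monom_mem_polys_over Y.one_mem) auto
      show "poly (P1 - P2) \<zeta> = 0"
        using hom_val[OF m(2)] \<alpha> by (simp add: P1_def P2_def poly_monom sums)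
      have "degree (monom (1::complex) W) \<le> 2 * W"
        using degree_monom_le[of "1::complex" W] by simp
      thus "degree (P1 - P2) \<le> 2 * W * (m + 1)"
        unfolding P1_def P2_def by (intro degree_diff_le deg_hom deg_mult)
    qed
    thus ?thesis by simp
  qed
  have E2: "P3 = P4"
  proof -
    have "P3 - P4 = 0"
    proof (rule vanish)
      show "P3 - P4 \<in> polys_over (span_over \<rat> Y)"
        unfolding P3_def P4_def using FUV subsetD[OF polys_over_mono[OF Y(4)]] pq
        by (intro Y_polys.diff_mem Y_polys.mult_mem Y.homogenized_mem_polys_over Y_polys.power_mem
            Y_polys.of_nat_mem) auto
      show "poly (P3 - P4) \<zeta> = 0"
        using hom_val[OF m(1)] \<alpha> by (simp add: P3_def P4_def val sums mult_ac)
      show "degree (P3 - P4) \<le> 2 * W * (m + 1)"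
        unfolding P3_def P4_def by (intro degree_diff_le deg_hom deg_mult deg)
    qed
    thus ?thesis by simp
  qed

  define S where "S = to_fract V / to_fract U"
  define qS where "qS = poly (map_poly ratfun_const q) S"
  define pS where "pS = poly (map_poly ratfun_const p) S"
  have u0: "to_fract U \<noteq> 0" using U0 by simp
  have X0: "ratfun_X \<noteq> 0" by (simp add: ratfun_X_def)
  have mon: "to_fract (monom 1 W) = ratfun_X ^ W"
    by (simp add: monom_altdef ratfun_X_def to_fract_power)
  have nat: "to_fract (of_nat c) = ratfun_const (of_nat c)"
    by (simp add: ratfun_const_def of_nat_poly)
  have "to_fract U ^ m * qS * to_fract U = ratfun_const (of_nat c) * ratfun_X ^ W * to_fract U ^ m"
    using arg_cong[OF E1, of to_fract] to_fract_homogenized[OF m(2) U0, of V]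
    by (simp add: P1_def P2_def mon nat to_fract_power qS_def S_def)
  hence qS: "qS * to_fract U = ratfun_const (of_nat c) * ratfun_X ^ W"
    using u0 by simp
  have "to_fract U ^ m * pS * to_fract U = ratfun_const (of_nat c) * to_fract F * to_fract U ^ m"
    using arg_cong[OF E2, of to_fract] to_fract_homogenized[OF m(1) U0, of V]
    by (simp add: P3_def P4_def nat to_fract_power pS_def S_def)
  hence pS: "pS * to_fract U = ratfun_const (of_nat c) * to_fract F"
    using u0 by simp
  have c0: "ratfun_const (of_nat c) \<noteq> 0" using c by (simp add: ratfun_const_eq_0_iff)
  hence qS0: "qS \<noteq> 0" using qS X0 by auto
  have FX: "to_fract F = ratfun_X ^ W * (\<Sum>t\<leftarrow>xs. ratfun_const (fst t * b (snd t)) * ratfun_X powi w (snd t))"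
    unfolding F_def using w_le \<Omega>_sub by (intro to_fract_pair_poly) auto
  have "pS * (ratfun_const (of_nat c) * ratfun_X ^ W) = (pS * to_fract U) * qS"
    unfolding qS [symmetric] by (simp only: mult_ac)
  also have "\<dots> = ratfun_const (of_nat c) * ratfun_X ^ W *
      ((\<Sum>t\<leftarrow>xs. ratfun_const (fst t * b (snd t)) * ratfun_X powi w (snd t)) * qS)"
    unfolding pS FX by (simp only: mult_ac)
  finally have "pS = (\<Sum>t\<leftarrow>xs. ratfun_const (fst t * b (snd t)) * ratfun_X powi w (snd t)) * qS"
    using c0 X0 by (simp add: mult.commute)
  hence result: "(\<Sum>t\<leftarrow>xs. ratfun_const (fst t * b (snd t)) * ratfun_X powi w (snd t)) = pS / qS"
    using qS0 by (simp add: field_simps)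

  have b_unity: "b \<xi> \<in> roots_of_unity" if \<xi>: "\<xi> \<in> \<Omega>" for \<xi>
  proof -
    obtain k where "b \<xi> = \<rho> ^ k" using bw(2)[OF \<xi>] by blast
    hence "b \<xi> ^ g = 1" using \<rho> by (metis mult.commute power_mult power_one)
    thus ?thesis using g(1) by (auto simp: roots_of_unity_def)
  qed
  have "nonconstant S"
    unfolding nonconstant_def
  proof
    \<comment> \<open>A constant \<open>S\<close> makes \<open>U\<close>, \<open>V\<close> and
      \<open>F\<close> scalar multiples of \<open>monom 1 W\<close>. By minimality all exponents
      \<open>w\<close> are then 0, so every root of unity in the sums is a power of \<rho> and is
      killed by \<open>g < M\<close>, against the choice of \<open>M\<close>.\<close>
    assume "S \<in> range ratfun_const"
    then obtain s where s: "S = ratfun_const s" by blast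
    have qs: "qS = ratfun_const (poly q s)" "pS = ratfun_const (poly p s)"
      by (simp_all add: qS_def pS_def s poly_ratfun_const)
    have "poly q s \<noteq> 0" using qS0 qs by (simp add: ratfun_const_eq_0_iff)
    have "to_fract (Polynomial.smult (poly q s) U) = to_fract (Polynomial.smult (of_nat c) (monom 1 W))"
      using qS qs by (simp add: to_fract_smult mon)
    hence eq: "Polynomial.smult (poly q s) U = monom (of_nat c) W"
      by (simp add: smult_monom)
    have "U = Polynomial.smult (inverse (poly q s)) (Polynomial.smult (poly q s) U)"
      using \<open>poly q s \<noteq> 0\<close> by simp
    hence U: "U = monom (inverse (poly q s) * of_nat c) W"
      unfolding eq by (simp add: smult_monom)
    have "to_fract V = S * to_fract U" using u0 by (simp add: S_def)
    hence "to_fract V = to_fract (Polynomial.smult s U)" by (simp add: to_fract_smult s)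
    hence V: "V = monom (s * (inverse (poly q s) * of_nat c)) W"
      using U by (simp add: smult_monom)
    have "to_fract (Polynomial.smult (poly p s) U) = to_fract (Polynomial.smult (of_nat c) F)"
      using pS qs by (simp add: to_fract_smult)
    hence eq: "Polynomial.smult (of_nat c) F = Polynomial.smult (poly p s) U" by simp
    have "F = Polynomial.smult (inverse (of_nat c)) (Polynomial.smult (of_nat c) F)"
      using c by simp
    hence F: "F = monom (inverse (of_nat c) * (poly p s * (inverse (poly q s) * of_nat c))) W"
      unfolding eq U by (simp add: smult_monom)
    have drop: "pair_sum (filter (\<lambda>t. w (snd t) = 0) us) = pair_sum us"
      if us: "snd ` set us \<subseteq> \<Omega>" "pair_poly W b w us = monom a W" for us a
    proof (rule pair_sum_filter[OF \<zeta>(1) _ _ us(2)])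
      fix \<xi> assume "\<xi> \<in> snd ` set us"
      hence \<xi>: "\<xi> \<in> \<Omega>" using us(1) by blast
      show "\<xi> = b \<xi> * \<zeta> powi w \<xi>" by (rule bw(1)[OF \<xi>])
      show "nat \<bar>w \<xi>\<bar> \<le> W" by (rule w_le[OF \<xi>])
    qed
    have "\<forall>t\<in>set ts. w (snd t) = 0"
      by (rule minimal[THEN spec, THEN mp, THEN mp, THEN mp, OF drop[OF \<Omega>_sub(1) F[unfolded F_def]]
            drop[OF \<Omega>_sub(2) U[unfolded U_def]] drop[OF \<Omega>_sub(3) V[unfolded V_def]]])
    have "\<xi> ^ g = 1" if "\<xi> \<in> snd ` set ts" for \<xi>
    proof -
      have \<xi>: "\<xi> \<in> \<Omega>" using that by (simp add: \<Omega>_def)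
      have "\<xi> = b \<xi>" using bw(1)[OF \<xi>] \<open>\<forall>t\<in>set ts. w (snd t) = 0\<close> that by auto
      moreover obtain k where "b \<xi> = \<rho> ^ k" using bw(2)[OF \<xi>] by blast
      ultimately show ?thesis using \<rho> by (metis mult.commute power_mult power_one)
    qed
    thus False using M(3) g by blast
  qed
  \<comment> \<open>The vanishing argument works over a finite extension of the rationals, while
    \<open>S\<close> has to be defined over the cyclotomic closure; hence the coefficient ring is
    left open here.\<close>
  moreover have "U \<in> polys_over A \<and> V \<in> polys_over A"
    if "subring_set A" "fst ` set ts \<subseteq> A" "roots_of_unity \<subseteq> A" for A
    unfolding U_def V_def using that b_unity
    by (intro conjI pair_poly_mem_polys_over) (auto simp: ts_def \<Omega>_def)
  ultimately show ?thesis
    using b_unity U0 result unfolding \<Omega>_def qS_def pS_def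
    by (intro exI[of _ b] exI[of _ w] exI[of _ U] exI[of _ V] exI[of _ S]) (simp add: S_def)
qed

section \<open>Integral quotients of rational functions\<close>

lemma (in subring_set) division_with_remainder:
  fixes f m :: "'a poly"
  assumes "\<And>a. a \<in> A \<Longrightarrow> a \<noteq> 0 \<Longrightarrow> \<exists>b\<in>A. a * b = 1"
    and "m \<in> polys_over A" "m \<noteq> 0" "f \<in> polys_over A"
  shows "\<exists>s\<in>polys_over A. \<exists>r\<in>polys_over A. f = s * m + r \<and> (r = 0 \<or> degree r < degree m)"
proof -
  obtain c where c: "c \<in> A" "lead_coeff m * c = 1"
    using assms(1)[OF coeff_mem[OF assms(2)], of "degree m"] assms(3) by auto
  define m' where "m' = Polynomial.smult c m"
  have "coeff m' (degree m) = 1" using c by (simp add: m'_def mult.commute)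
  moreover have "degree m' \<le> degree m" by (simp add: m'_def degree_smult_le)
  ultimately have deg: "degree m' = degree m"
    by (metis coeff_eq_0 le_antisym not_le zero_neq_one)
  obtain s r where "s \<in> polys_over A" "r \<in> polys_over A" "f = s * m' + r" "r = 0 \<or> degree r < degree m'"
    using division_monic[OF smult_mem_polys_over[OF c(1) assms(2)] _ assms(4)] deg \<open>coeff m' (degree m) = 1\<close>
    unfolding m'_def by metis
  thus ?thesis
    using c(1) deg by (intro bexI[of _ "Polynomial.smult c s"] bexI[of _ r])
      (auto simp: m'_def intro!: smult_mem_polys_over)
qed

text \<open>Euclid's algorithm carried out inside \<open>polys_over A\<close>, so that the Bezout
  coefficients and both cofactors stay over \<open>A\<close>.\<close>

lemma bezout_over_subfield:
  fixes A :: "'a :: field set"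
  assumes "subring_set A" "\<And>a. a \<in> A \<Longrightarrow> inverse a \<in> A" "p \<in> polys_over A" "q \<in> polys_over A"
  shows "\<exists>u\<in>polys_over A. \<exists>v\<in>polys_over A. \<exists>p'\<in>polys_over A. \<exists>q'\<in>polys_over A.
    p = (u * p + v * q) * p' \<and> q = (u * p + v * q) * q'"
proof -
  interpret subring_set A by fact
  interpret polys: subring_set "polys_over A" by (rule subring_set_polys_over)
  note mem = polys.zero_mem polys.one_mem polys.add_mem polys.diff_mem polys.mult_mem
  show ?thesis
    using assms(3,4)
  \<comment> \<open>The measure separates \<open>q = 0\<close> from nonzero constants, which have
    the same degree.\<close>
  proof (induction "if q = 0 then 0 else Suc (degree q)" arbitrary: p q rule: less_induct)
    case less
    show ?case
    proof (cases "q = 0")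
      case True
      thus ?thesis using less.prems
        by (intro bexI[of _ 1] bexI[of _ 0]) (auto intro: mem)
    next
      case False
      have "\<exists>b\<in>A. a * b = 1" if "a \<in> A" "a \<noteq> 0" for a
        using assms(2)[OF that(1)] that(2) by (intro bexI[of _ "inverse a"]) auto
      then obtain s r where sr: "s \<in> polys_over A" "r \<in> polys_over A" "p = s * q + r"
          "r = 0 \<or> degree r < degree q"
        using division_with_remainder[OF _ less.prems(2) False less.prems(1)] by blast
      have "(if r = 0 then 0 else Suc (degree r)) < (if q = 0 then 0 else Suc (degree q))"
        using sr(4) False by auto
      from less.hyps[OF this less.prems(2) sr(2)] obtain u v q' r' where
        uv: "u \<in> polys_over A" "v \<in> polys_over A" "q' \<in> polys_over A" "r' \<in> polys_over A"
          "q = (u * q + v * r) * q'" "r = (u * q + v * r) * r'" by blast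
      have g: "u * q + v * r = v * p + (u - v * s) * q"
        by (simp add: sr(3) algebra_simps)
      have "p = s * ((u * q + v * r) * q') + (u * q + v * r) * r'"
        using sr(3) uv(5,6) by metis
      hence "p = (u * q + v * r) * (s * q' + r')" by (simp add: algebra_simps)
      thus ?thesis
        using uv sr(1,2) unfolding g
        by (intro bexI[of _ v] bexI[of _ "u - v * s"] bexI[of _ "s * q' + r'"] bexI[of _ q'] conjI mem)
    qed
  qed
qed

text \<open>The Bezout identity is multiplied by the monomial and the coefficient of
  \<open>q\<close> reduced modulo \<open>p\<close>. The coefficient of \<open>p\<close> is then
  small too: \<open>a * p\<close> is a difference of two polynomials of degree less than
  \<open>2 * degree p\<close>.\<close>

lemma monom_combination_aux:
  fixes A :: "'a :: field set"
  assumes "subring_set A" "\<And>a. a \<in> A \<Longrightarrow> inverse a \<in> A" "p \<in> polys_over A" "q \<in> polys_over A"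
    and uv: "u \<in> polys_over A" "v \<in> polys_over A" "u * p + v * q = 1"
    and "degree q \<le> degree p" "degree p > 0" "i < 2 * degree p"
  shows "\<exists>a\<in>polys_over A. \<exists>b\<in>polys_over A. degree a < degree p \<and> degree b < degree p \<and>
    a * p + b * q = monom 1 i"
proof -
  interpret subring_set A by fact
  interpret polys: subring_set "polys_over A" by (rule subring_set_polys_over)
  have X: "monom 1 i \<in> polys_over A" by (rule monom_mem_polys_over[OF one_mem])
  have "p \<noteq> 0" using assms(9) by auto
  have "\<exists>b\<in>A. a * b = 1" if "a \<in> A" "a \<noteq> 0" for a
    using assms(2)[OF that(1)] that(2) by (intro bexI[of _ "inverse a"]) auto
  then obtain s b where sb: "s \<in> polys_over A" "b \<in> polys_over A" "monom 1 i * v = s * p + b"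
      "b = 0 \<or> degree b < degree p"
    using division_with_remainder[OF _ assms(3) \<open>p \<noteq> 0\<close> polys.mult_mem[OF X uv(2)]] by blast
  define a where "a = monom 1 i * u + s * q"
  have "a * p + b * q = monom 1 i * u * p + (s * p + b) * q"
    by (simp add: a_def algebra_simps)
  also have "\<dots> = monom 1 i * (u * p + v * q)"
    unfolding sb(3) [symmetric] by (simp add: algebra_simps)
  finally have eq: "a * p + b * q = monom 1 i" by (simp add: uv(3))
  have db: "degree b < degree p" using sb(4) assms(9) by auto
  have "degree a < degree p"
  proof (cases "a = 0")
    case False
    have "degree a + degree p = degree (a * p)" using False \<open>p \<noteq> 0\<close> by (simp add: degree_mult_eq)
    also have "a * p = monom 1 i - b * q" using eq by (simp add: algebra_simps)
    also have "degree \<dots> \<le> 2 * degree p - 1"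
    proof (rule degree_diff_le)
      show "degree (monom (1::'a) i) \<le> 2 * degree p - 1"
        using assms(10) degree_monom_le[of "1::'a" i] by simp
      show "degree (b * q) \<le> 2 * degree p - 1"
        using degree_mult_le[of b q] db assms(8) by simp
    qed
    finally show ?thesis using assms(9) by simp
  qed (use assms(9) in auto)
  moreover have "a \<in> polys_over A"
    unfolding a_def by (intro polys.add_mem polys.mult_mem X uv sb assms(4))
  ultimately show ?thesis using eq sb(2) db by blast
qed

lemma monom_combination:
  fixes A :: "'a :: field set"
  assumes "subring_set A" "\<And>a. a \<in> A \<Longrightarrow> inverse a \<in> A" "p \<in> polys_over A" "q \<in> polys_over A"
    and uv: "u \<in> polys_over A" "v \<in> polys_over A" "u * p + v * q = 1"
    and m: "m = max (degree p) (degree q)" "m > 0" "i < 2 * m"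
  shows "\<exists>a\<in>polys_over A. \<exists>b\<in>polys_over A. degree a < m \<and> degree b < m \<and>
    a * p + b * q = monom 1 i"
proof (cases "degree q \<le> degree p")
  case True
  thus ?thesis using monom_combination_aux[OF assms(1-7) True] m by (simp add: max_absorb1)
next
  case False
  have "v * q + u * p = 1" using uv(3) by (simp add: add.commute)
  from monom_combination_aux[OF assms(1,2,4,3) uv(2,1) this] False m
  show ?thesis by (fastforce simp: add.commute max_absorb2)
qed

text \<open>The constants are uniform in \<open>u\<close>, \<open>v\<close>, \<open>y\<close> and
  \<open>s\<close>. After scaling by \<open>c\<close> the matrix has algebraic integer entries, so
  \<open>c * u\<close> is integral; for the house an embedding is applied to the row where the image
  of \<open>v\<close> is largest. The row selector \<open>s\<close> lets one table of coefficients
  serve several matrices.\<close>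

lemma eigenvalue_denominator_and_house:
  fixes a b :: "nat \<Rightarrow> nat \<Rightarrow> complex"
  assumes alg: "\<And>i j. algebraic (a i j)" "\<And>i j. algebraic (b i j)" and n: "n > 0"
  shows "\<exists>c::nat. \<exists>R. c > 0 \<and> (\<forall>u v y s. algebraic_int y \<longrightarrow> house y \<le> A \<longrightarrow>
    (\<forall>i<n. algebraic (v i) \<and> s i < N) \<longrightarrow> v 0 = 1 \<longrightarrow>
    (\<forall>i<n. u * v i = (\<Sum>j<n. (a (s i) j * y + b (s i) j) * v j)) \<longrightarrow>
    algebraic_int (of_nat c * u) \<and> house (of_nat c * u) \<le> R)"
proof -
  define T where "T = (\<lambda>(i,j). a i j) ` ({..<N} \<times> {..<n}) \<union> (\<lambda>(i,j). b i j) ` ({..<N} \<times> {..<n})"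
  have T: "finite T" "\<And>x. x \<in> T \<Longrightarrow> algebraic x" using alg by (auto simp: T_def)
  obtain c :: nat where c: "c > 0" "\<forall>x\<in>T. algebraic_int (of_nat c * x)"
    using common_multiple_algebraic_int[OF T] by blast
  \<comment> \<open>Summing over all \<open>N\<close> rows covers whichever row \<open>s\<close>
    selects; \<open>\<bar>A\<bar>\<close> keeps all factors nonnegative for arbitrary
    \<open>A\<close>.\<close>
  define R where "R = (\<Sum>i<N. \<Sum>j<n. real c * (house (a i j) * \<bar>A\<bar> + house (b i j)))"
  have h0: "house (a i j) \<ge> 0" "house (b i j) \<ge> 0" for i j
    using house_nonneg alg by auto
  have "algebraic_int (of_nat c * u) \<and> house (of_nat c * u) \<le> R"
    if y: "algebraic_int y" "house y \<le> A" and v: "\<forall>i<n. algebraic (v i) \<and> s i < N" "v 0 = 1"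
      and eq: "\<forall>i<n. u * v i = (\<Sum>j<n. (a (s i) j * y + b (s i) j) * v j)"
    for u y and v :: "nat \<Rightarrow> complex" and s
  proof
    have ceq: "of_nat c * u * v i =
        (\<Sum>j<n. (of_nat c * a (s i) j * y + of_nat c * b (s i) j) * v j)" if "i < n" for i
    proof -
      have "of_nat c * u * v i = of_nat c * (\<Sum>j<n. (a (s i) j * y + b (s i) j) * v j)"
        using eq that by (simp add: mult.assoc)
      thus ?thesis by (simp add: sum_distrib_left algebra_simps)
    qed
    have int: "algebraic_int (of_nat c * a (s i) j * y + of_nat c * b (s i) j)" if "i < n" "j < n" for i j
    proof -
      have "a (s i) j \<in> T" "b (s i) j \<in> T" using v(1) that by (force simp: T_def)+
      hence "algebraic_int (of_nat c * a (s i) j)" "algebraic_int (of_nat c * b (s i) j)"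
        using c(2) by auto
      thus ?thesis
        using y(1) alg_ints.mult_mem[of "of_nat c * a (s i) j" y]
          alg_ints.add_mem[of "of_nat c * a (s i) j * y" "of_nat c * b (s i) j"] by simp
    qed
    have "\<exists>f\<in>polys_over {x. algebraic_int x}. degree f = n \<and> lead_coeff f = 1 \<and> poly f (of_nat c * u) = 0"
      using int ceq n v(2)
      by (intro subring_set_eigenvalue[OF alg_ints.subring_set_axioms, of n _ _ v 0]) auto
    hence "of_nat c * u \<in> integral_closure {x. algebraic_int x}"
      by (auto simp: integral_closure_def)
    moreover have "{x :: complex. algebraic_int x} = integral_closure \<int>"
      by (auto simp: algebraic_int_iff_integral_closure)
    ultimately show cu: "algebraic_int (of_nat c * u)"
      using integral_closure_idem[OF subring_set_Ints, where 'a = complex]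
      by (auto simp: algebraic_int_iff_integral_closure)
    show "house (of_nat c * u) \<le> R"
    proof (rule house_le)
      show "algebraic (of_nat c * u)" using cu by auto
      fix \<beta> assume \<beta>: "\<beta> \<in> rat_conjugates (of_nat c * u)"
      have "finite (insert y (T \<union> v ` {..<n}))" using T(1) by simp
      moreover have "algebraic t" if "t \<in> insert y (T \<union> v ` {..<n})" for t
        using that T(2) v(1) y(1) by auto
      ultimately obtain K \<sigma> where K: "field_hom_on K \<sigma>" "of_nat c * u \<in> K"
          "insert y (T \<union> v ` {..<n}) \<subseteq> K" "\<sigma> (of_nat c * u) = \<beta>"
        using ex_hom_to_conjugate[OF _ \<beta>] cu by blast
      interpret complex_field_hom K \<sigma> by unfold_locales fact
      have vK: "v i \<in> K" if "i < n" for i using K(3) that by auto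
      have yK: "y \<in> K" using K(3) by auto
      have abK: "a (s i) j \<in> K" "b (s i) j \<in> K" if "i < n" "j < n" for i j
      proof -
        have "a (s i) j \<in> T" "b (s i) j \<in> T" using v(1) that by (force simp: T_def)+
        thus "a (s i) j \<in> K" "b (s i) j \<in> K" using K(3) by auto
      qed
      have "\<exists>k\<in>{..<n}. \<forall>j\<in>{..<n}. cmod (\<sigma> (v j)) \<le> cmod (\<sigma> (v k))"
      proof -
        have "Max ((\<lambda>j. cmod (\<sigma> (v j))) ` {..<n}) \<in> (\<lambda>j. cmod (\<sigma> (v j))) ` {..<n}"
          using n by (intro Max_in) auto
        then obtain k where k: "k < n" "Max ((\<lambda>j. cmod (\<sigma> (v j))) ` {..<n}) = cmod (\<sigma> (v k))" by auto
        have "cmod (\<sigma> (v j)) \<le> cmod (\<sigma> (v k))" if "j < n" for j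
          unfolding k(2) [symmetric] using that by (intro Max_ge) auto
        thus ?thesis using k(1) by auto
      qed
      then obtain k where k: "k < n" "\<And>j. j < n \<Longrightarrow> cmod (\<sigma> (v j)) \<le> cmod (\<sigma> (v k))" by auto
      \<comment> \<open>The largest coordinate is nonzero because of \<open>v 0 = 1\<close>, so it
        may be cancelled at the end.\<close>
      have "1 \<le> cmod (\<sigma> (v k))"
        using k(2)[of 0] n v(2) by (simp add: hom_one)
      hence pos: "cmod (\<sigma> (v k)) > 0" by linarith
      have "\<beta> * \<sigma> (v k) = \<sigma> (of_nat c * u * v k)"
        using K(2,4) vK[OF k(1)] by (simp add: hom_mult)
      also have "\<dots> = (\<Sum>j<n. (of_nat c * \<sigma> (a (s k) j) * \<sigma> y + of_nat c * \<sigma> (b (s k) j)) * \<sigma> (v j))"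
        unfolding ceq[OF k(1)] using abK[OF k(1)] yK vK
        by (subst hom_sum) (auto simp: hom_add hom_mult hom_of_nat of_nat_mem mult_mem add_mem)
      finally have "cmod \<beta> * cmod (\<sigma> (v k)) =
          cmod (\<Sum>j<n. (of_nat c * \<sigma> (a (s k) j) * \<sigma> y + of_nat c * \<sigma> (b (s k) j)) * \<sigma> (v j))"
        by (simp flip: norm_mult)
      also have "\<dots> \<le> (\<Sum>j<n. real c * (house (a (s k) j) * \<bar>A\<bar> + house (b (s k) j)) * cmod (\<sigma> (v k)))"
      proof (intro sum_norm_le)
        fix j assume "j \<in> {..<n}"
        hence j: "j < n" by simp
        have "cmod (of_nat c * \<sigma> (a (s k) j) * \<sigma> y + of_nat c * \<sigma> (b (s k) j)) \<le>
            real c * (cmod (\<sigma> (a (s k) j)) * cmod (\<sigma> y) + cmod (\<sigma> (b (s k) j)))"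
          using norm_triangle_ineq[of "of_nat c * \<sigma> (a (s k) j) * \<sigma> y" "of_nat c * \<sigma> (b (s k) j)"]
          by (simp add: norm_mult algebra_simps)
        also have "\<dots> \<le> real c * (house (a (s k) j) * \<bar>A\<bar> + house (b (s k) j))"
        proof -
          have "cmod (\<sigma> y) \<le> \<bar>A\<bar>"
            using cmod_hom_le_house[OF yK] y by (meson abs_ge_self algebraic_int_imp_algebraic order.trans)
          thus ?thesis
            using cmod_hom_le_house[OF abK(1)[OF k(1) j] alg(1)] cmod_hom_le_house[OF abK(2)[OF k(1) j] alg(2)] h0
            by (intro mult_left_mono add_mono mult_mono) auto
        qed
        finally show "cmod ((of_nat c * \<sigma> (a (s k) j) * \<sigma> y + of_nat c * \<sigma> (b (s k) j)) * \<sigma> (v j))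
            \<le> real c * (house (a (s k) j) * \<bar>A\<bar> + house (b (s k) j)) * cmod (\<sigma> (v k))"
          unfolding norm_mult using k(2)[OF j] h0 by (intro mult_mono) auto
      qed
      also have "\<dots> = (\<Sum>j<n. real c * (house (a (s k) j) * \<bar>A\<bar> + house (b (s k) j))) * cmod (\<sigma> (v k))"
        by (simp add: sum_distrib_right)
      also have "\<dots> \<le> R * cmod (\<sigma> (v k))"
        unfolding R_def using v(1) k(1) h0
        by (intro mult_right_mono member_le_sum[of "s k" _ "\<lambda>i. \<Sum>j<n. real c * (house (a i j) * \<bar>A\<bar> + house (b i j))"])
           (auto intro!: sum_nonneg)
      finally show "cmod \<beta> \<le> R" using pos by simp
    qed
  qed
  thus ?thesis using c(1) by blast
qed

text \<open>\<open>quot_of_fract\<close> reduces over the complex numbers. A reduction over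
  \<open>F\<close> differs from it only by a constant factor, and since its denominator is monic,
  this constant is a leading coefficient over \<open>F\<close>.\<close>

lemma quot_of_fract_over_subfield:
  assumes F: "complex_subfield F" and h: "h \<in> ratfuns_over F"
  shows "fst (quot_of_fract h) \<in> polys_over F" "snd (quot_of_fract h) \<in> polys_over F"
    "\<exists>u\<in>polys_over F. \<exists>v\<in>polys_over F. u * fst (quot_of_fract h) + v * snd (quot_of_fract h) = 1"
proof -
  interpret subring_set F by (rule complex_subfield_subring_set[OF F])
  interpret polys: subring_set "polys_over F" by (rule subring_set_polys_over)
  have inv: "inverse a \<in> F" if "a \<in> F" for a using F that by (simp add: complex_subfield_def)
  define p q where "p = fst (quot_of_fract h)" and "q = snd (quot_of_fract h)"
  have "q \<noteq> 0" by (simp add: q_def)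
  have coprime: "coprime p q" unfolding p_def q_def by (rule coprime_quot_of_fract)
  have "unit_factor q = 1" unfolding q_def by (rule unit_factor_snd_quot_of_fract)
  hence "lead_coeff q = 1"
    by (simp add: unit_factor_poly_def one_pCons)
  obtain p1 q1 where h1: "h = Fract p1 q1" "q1 \<noteq> 0" "p1 \<in> polys_over F" "q1 \<in> polys_over F"
    using h by (auto simp: ratfuns_over_def polys_over_def)
  obtain u v p2 q2 where uv: "u \<in> polys_over F" "v \<in> polys_over F" "p2 \<in> polys_over F" "q2 \<in> polys_over F"
      "p1 = (u * p1 + v * q1) * p2" "q1 = (u * p1 + v * q1) * q2"
    using bezout_over_subfield[OF subring_set_axioms inv h1(3,4)] by blast
  define g where "g = u * p1 + v * q1"
  have "g \<noteq> 0" "q2 \<noteq> 0" using uv(6) h1(2) unfolding g_def by auto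
  have p1: "p1 = g * p2" and q1: "q1 = g * q2" using uv(5,6) by (simp_all add: g_def)
  have "g = u * p1 + v * q1" by (simp add: g_def)
  also have "\<dots> = g * (u * p2 + v * q2)" unfolding p1 q1 by (simp add: algebra_simps)
  finally have "g = g * (u * p2 + v * q2)" .
  hence one: "u * p2 + v * q2 = 1" using \<open>g \<noteq> 0\<close> by simp
  have "Fract p q = Fract p1 q1" unfolding p_def q_def h1(1)[symmetric] by simp
  hence "p * q1 = p1 * q" using \<open>q \<noteq> 0\<close> h1(2) by (simp add: eq_fract)
  hence "g * (p * q2) = g * (p2 * q)"
    unfolding p1 q1 by (simp add: mult_ac)
  hence eq: "p * q2 = p2 * q" using \<open>g \<noteq> 0\<close> by simp
  have "q dvd p * q2" by (simp add: eq)
  hence "q dvd q2" using coprime by (simp add: coprime_dvd_mult_right_iff coprime_commute)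
  then obtain s where s: "q2 = q * s" by blast
  have "p * (q * s) = p2 * q" using eq s by simp
  hence ps: "p2 = p * s" using \<open>q \<noteq> 0\<close> by (simp add: mult.commute mult.left_commute)
  have "s * (u * p + v * q) = 1" using one by (simp add: s ps algebra_simps)
  hence "is_unit s" by (metis dvd_triv_left)
  then obtain c where c: "s = [:c:]" "c \<noteq> 0"
    by (metis degree_eq_zeroE is_unit_iff_degree not_is_unit_0 pCons_0_0)
  have "lead_coeff q2 = c" using \<open>lead_coeff q = 1\<close> by (simp add: s c lead_coeff_mult)
  hence cF: "c \<in> F" using uv(4) coeff_mem by blast
  have "q = Polynomial.smult (inverse c) q2" "p = Polynomial.smult (inverse c) p2"
    using c by (simp_all add: s ps)
  thus "fst (quot_of_fract h) \<in> polys_over F" "snd (quot_of_fract h) \<in> polys_over F"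
    using uv(3,4) inv[OF cF] by (auto simp: p_def q_def intro!: smult_mem_polys_over)
  have "(Polynomial.smult c u) * p + (Polynomial.smult c v) * q = 1"
    using \<open>s * (u * p + v * q) = 1\<close> by (simp add: c algebra_simps smult_add_right)
  thus "\<exists>u\<in>polys_over F. \<exists>v\<in>polys_over F. u * fst (quot_of_fract h) + v * snd (quot_of_fract h) = 1"
    using smult_mem_polys_over[OF cF] uv(1,2) unfolding p_def q_def by blast
qed

lemma nonconstant_degree:
  assumes "nonconstant h"
  shows "max (degree (fst (quot_of_fract h))) (degree (snd (quot_of_fract h))) > 0"
proof (rule ccontr)
  assume "\<not> ?thesis"
  hence "degree (fst (quot_of_fract h)) = 0" "degree (snd (quot_of_fract h)) = 0" by simp_all
  then obtain a b where ab: "fst (quot_of_fract h) = [:a:]" "snd (quot_of_fract h) = [:b:]"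
    by (elim degree_eq_zeroE)
  have "b \<noteq> 0" using ab(2) snd_quot_of_fract_nonzero[of h] by auto
  have "h = Fract [:a:] [:b:]" using ab by (metis Fract_quot_of_fract)
  also have "\<dots> = ratfun_const (a / b)"
    using \<open>b \<noteq> 0\<close> by (simp add: ratfun_const_def to_fract_def eq_fract)
  finally show False using assms by (auto simp: nonconstant_def)
qed

text \<open>The functions \<open>1 / q\<close> and \<open>X / q\<close> are integral over \<open>F[p / q]\<close>: multiplication by them
  preserves the span of \<open>1, X, \<dots>, X ^ (m - 1)\<close> over \<open>F[p / q]\<close>, because \<open>X ^ i\<close> is a combination
  \<open>a * p + b * q\<close> with \<open>a\<close>, \<open>b\<close> of degree less than \<open>m\<close> for all \<open>i < 2 * m\<close>.\<close>

lemma denominator_and_house_of_quotients: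
  assumes F: "complex_subfield F" and alg: "\<And>x. x \<in> F \<Longrightarrow> algebraic x"
    and pq: "p \<in> polys_over F" "q \<in> polys_over F" "max (degree p) (degree q) > 0"
    and uv: "u \<in> polys_over F" "v \<in> polys_over F" "u * p + v * q = 1"
  shows "\<exists>c::nat. \<exists>R. c > 0 \<and> (\<forall>\<alpha>\<in>F. poly q \<alpha> \<noteq> 0 \<longrightarrow> poly p \<alpha> / poly q \<alpha> \<in> bounded_house_ints A \<longrightarrow>
    of_nat c / poly q \<alpha> \<in> bounded_house_ints R \<and> of_nat c * \<alpha> / poly q \<alpha> \<in> bounded_house_ints R)"
proof -
  interpret subring_set F by (rule complex_subfield_subring_set[OF F])
  have inv: "inverse a \<in> F" if "a \<in> F" for a using F that by (simp add: complex_subfield_def)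
  define m where "m = max (degree p) (degree q)"
  \<comment> \<open>For \<open>i \<ge> 2 * m\<close> the polynomials are still chosen over
    \<open>F\<close>, so that all entries of the coefficient table are algebraic.\<close>
  have "\<forall>i. \<exists>a b. a \<in> polys_over F \<and> b \<in> polys_over F \<and>
      (i < 2 * m \<longrightarrow> degree a < m \<and> degree b < m \<and> a * p + b * q = monom 1 i)"
  proof
    fix i
    show "\<exists>a b. a \<in> polys_over F \<and> b \<in> polys_over F \<and>
      (i < 2 * m \<longrightarrow> degree a < m \<and> degree b < m \<and> a * p + b * q = monom 1 i)"
    proof (cases "i < 2 * m")
      case True
      have "m > 0" using pq(3) by (simp add: m_def)
      thus ?thesis
        using monom_combination[OF subring_set_axioms inv pq(1,2) uv m_def _ True] by blast
    next
      case False
      thus ?thesis using zero_mem_polys_over by blast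
    qed
  qed
  from choice[OF this] obtain a where "\<forall>i. \<exists>b. a i \<in> polys_over F \<and> b \<in> polys_over F \<and>
      (i < 2 * m \<longrightarrow> degree (a i) < m \<and> degree b < m \<and> a i * p + b * q = monom 1 i)"
    by (elim exE)
  from choice[OF this] obtain b where "\<forall>i. a i \<in> polys_over F \<and> b i \<in> polys_over F \<and>
      (i < 2 * m \<longrightarrow> degree (a i) < m \<and> degree (b i) < m \<and> a i * p + b i * q = monom 1 i)"
    by (elim exE)
  hence ab: "a i \<in> polys_over F" "b i \<in> polys_over F"
      "i < 2 * m \<Longrightarrow> degree (a i) < m \<and> degree (b i) < m \<and> a i * p + b i * q = monom 1 i" for i
    by simp_all
  have m: "m > 0" using pq(3) by (simp add: m_def)
  have alg_ab: "algebraic (coeff (a i) j)" "algebraic (coeff (b i) j)" for i j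
    using alg coeff_mem[OF ab(1)] coeff_mem[OF ab(2)] by auto
  obtain c :: nat and R where c: "c > 0" and cR: "\<And>u v y s. algebraic_int y \<Longrightarrow> house y \<le> A \<Longrightarrow>
      (\<forall>i<m. algebraic (v i) \<and> s i < 2 * m) \<Longrightarrow> v 0 = 1 \<Longrightarrow>
      (\<forall>i<m. u * v i = (\<Sum>j<m. (coeff (a (s i)) j * y + coeff (b (s i)) j) * v j)) \<Longrightarrow>
      algebraic_int (of_nat c * u) \<and> house (of_nat c * u) \<le> R"
    using eigenvalue_denominator_and_house[of "\<lambda>i. coeff (a i)" "\<lambda>i. coeff (b i)" m A "2 * m", OF alg_ab m]
    by blast
  \<comment> \<open>Both quotients are treated at once: \<open>k = 0\<close> and
    \<open>k = 1\<close> select the rows \<open>i + k\<close> of the same table, and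
    \<open>i + k \<le> m < 2 * m\<close>.\<close>
  have "of_nat c * (\<alpha> ^ k / poly q \<alpha>) \<in> bounded_house_ints R"
    if \<alpha>: "\<alpha> \<in> F" "poly q \<alpha> \<noteq> 0" "poly p \<alpha> / poly q \<alpha> \<in> bounded_house_ints A" and k: "k \<le> 1" for \<alpha> k
  proof -
    define y where "y = poly p \<alpha> / poly q \<alpha>"
    have "algebraic_int (of_nat c * (\<alpha> ^ k / poly q \<alpha>)) \<and> house (of_nat c * (\<alpha> ^ k / poly q \<alpha>)) \<le> R"
    proof (rule cR[of y "\<lambda>i. \<alpha> ^ i" "\<lambda>i. i + k"])
      show "algebraic_int y" "house y \<le> A" using \<alpha>(3) by (simp_all add: y_def bounded_house_ints_def)
      show "\<forall>i<m. algebraic (\<alpha> ^ i) \<and> i + k < 2 * m"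
        using alg power_mem[OF \<alpha>(1)] k by auto
      show "\<forall>i<m. \<alpha> ^ k / poly q \<alpha> * \<alpha> ^ i =
          (\<Sum>j<m. (coeff (a (i + k)) j * y + coeff (b (i + k)) j) * \<alpha> ^ j)"
      proof (intro allI impI)
        fix i assume "i < m"
        hence i: "i + k < 2 * m" using k by simp
        have sum: "poly f \<alpha> = (\<Sum>j<m. coeff f j * \<alpha> ^ j)" if "degree f < m" for f
          using poly_altdef_le[of f "m - 1" \<alpha>] that m by (simp flip: lessThan_Suc_atMost)
        have "(\<Sum>j<m. (coeff (a (i + k)) j * y + coeff (b (i + k)) j) * \<alpha> ^ j) =
            poly (a (i + k)) \<alpha> * y + poly (b (i + k)) \<alpha>"
          using ab(3)[OF i] by (simp add: sum sum_distrib_left sum.distrib algebra_simps)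
        also have "\<dots> = poly (a (i + k) * p + b (i + k) * q) \<alpha> / poly q \<alpha>"
          using \<alpha>(2) by (simp add: y_def add_divide_distrib)
        also have "\<dots> = \<alpha> ^ k / poly q \<alpha> * \<alpha> ^ i"
          using ab(3)[OF i] by (simp add: poly_monom power_add)
        finally show "\<alpha> ^ k / poly q \<alpha> * \<alpha> ^ i =
          (\<Sum>j<m. (coeff (a (i + k)) j * y + coeff (b (i + k)) j) * \<alpha> ^ j)" by simp
      qed
    qed simp
    thus ?thesis by (simp add: bounded_house_ints_def)
  qed
  from this[of _ 0] this[of _ 1] show ?thesis
    using c by (intro exI[of _ c] exI[of _ R]) auto
qed

section \<open>From Loxton representations to a short witness\<close>

lemma loxton_pair_pair_sum:
  assumes "loxton_pair L k B E" "mono_on {0..} L"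
    and "a \<in> cyc_closure k" "a \<in> bounded_house_ints R"
  shows "\<exists>xs. set xs \<subseteq> E \<times> roots_of_unity \<and> real (length xs) \<le> L (B * R) \<and> pair_sum xs = a"
proof -
  have a: "algebraic_int a" "house a \<le> R" using assms(4) by (auto simp: bounded_house_ints_def)
  obtain d e \<xi> where d: "real d \<le> L (B * house a)" "\<forall>i\<in>{1..d}. e i \<in> E \<and> \<xi> i \<in> roots_of_unity"
      "a = (\<Sum>i=1..d. e i * \<xi> i)"
    using assms(1,3) a(1) unfolding loxton_pair_def by blast
  have "B > 0" using assms(1) by (simp add: loxton_pair_def)
  have "house a \<ge> 0" using house_nonneg a(1) by blast
  hence "L (B * house a) \<le> L (B * R)"
    using \<open>B > 0\<close> a(2) by (intro mono_onD[OF assms(2)]) auto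
  moreover have "pair_sum (map (\<lambda>i. (e i, \<xi> i)) [1..<Suc d]) = a"
    unfolding d(3) pair_sum_def
    by (simp add: interv_sum_list_conv_sum_set_nat o_def atLeastLessThanSuc_atLeastAtMost del: upt_Suc)
  ultimately show ?thesis
    using d(1,2) by (intro exI[of _ "map (\<lambda>i. (e i, \<xi> i)) [1..<Suc d]"]) (auto simp del: upt_Suc)
qed

lemma polys_over_if_coeffs:
  assumes "subring_set A" "coeff p ` {..degree p} \<subseteq> A"
  shows "p \<in> polys_over A"
proof -
  interpret subring_set A by fact
  have "coeff p i \<in> A" for i
    using assms(2) zero_mem by (cases "i \<le> degree p") (auto simp: coeff_eq_0)
  thus ?thesis by (simp add: polys_over_def)
qed

lemma ex_common_exponent:
  assumes "finite \<Omega>" "\<Omega> \<subseteq> roots_of_unity"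
  shows "\<exists>M::nat. M > 0 \<and> (\<forall>\<xi>\<in>\<Omega>. \<xi> ^ M = 1)"
  using assms
proof (induction \<Omega>)
  case (insert \<xi> \<Omega>)
  then obtain M n :: nat where "M > 0" "\<forall>\<xi>\<in>\<Omega>. \<xi> ^ M = 1" "n > 0" "\<xi> ^ n = 1"
    by (auto simp: roots_of_unity_def)
  moreover from this have "\<xi> ^ (n * M) = 1" by (simp add: power_mult)
  ultimately have "\<forall>\<eta>\<in>insert \<xi> \<Omega>. \<eta> ^ (M * n) = 1"
    by (auto simp: power_mult simp flip: mult.commute[of M n])
  thus ?case using \<open>M > 0\<close> \<open>n > 0\<close> by (intro exI[of _ "M * n"]) auto
qed (auto intro!: exI[of _ 1])

text \<open>With bounded exponent and bounded length there are only finitely many pairs of sums. As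
  \<alpha> is the quotient of its two auxiliary sums, all but finitely many \<alpha> require a large
  exponent.\<close>

lemma finite_small_exponent_quotients:
  fixes E :: "complex set"
  assumes "finite E"
  shows "finite {pair_sum zs / pair_sum ys | ys zs M. 0 < M \<and> M < (M0 :: nat) \<and>
    set (ys @ zs) \<subseteq> E \<times> {\<xi>. \<xi> ^ M = 1} \<and> length (ys @ zs) \<le> N}"
proof -
  define D where "D = E \<times> (\<Union>M\<in>{0<..<M0}. {\<xi> :: complex. \<xi> ^ M = 1})"
  have "finite D"
    unfolding D_def using assms by (intro finite_cartesian_product finite_UN_I) (auto intro: finite_roots_unity)
  hence "finite {xs. set xs \<subseteq> D \<and> length xs \<le> N}" by (rule finite_lists_length_le)
  hence "finite ((\<lambda>(ys,zs). pair_sum zs / pair_sum ys) `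
      ({xs. set xs \<subseteq> D \<and> length xs \<le> N} \<times> {xs. set xs \<subseteq> D \<and> length xs \<le> N}))" by simp
  thus ?thesis
  proof (rule finite_subset[rotated], safe)
    fix ys zs :: "(complex \<times> complex) list" and M :: nat
    assume "0 < M" "M < M0" "set (ys @ zs) \<subseteq> E \<times> {\<xi>. \<xi> ^ M = 1}" "length (ys @ zs) \<le> N"
    hence "set ys \<subseteq> D" "set zs \<subseteq> D" "length ys \<le> N" "length zs \<le> N"
      by (fastforce simp: D_def)+
    thus "pair_sum zs / pair_sum ys \<in> (\<lambda>(ys,zs). pair_sum zs / pair_sum ys) `
      ({xs. set xs \<subseteq> D \<and> length xs \<le> N} \<times> {xs. set xs \<subseteq> D \<and> length xs \<le> N})"
      by (intro image_eqI[of _ _ "(ys, zs)"]) auto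
  qed
qed

lemma sum_list_eq_sum_nth: "sum_list (map f xs) = (\<Sum>i=1..length xs. f (xs ! (i - 1)))"
proof -
  have "sum_list (map f xs) = (\<Sum>i<length xs. f (xs ! i))"
    by (simp add: sum_list_sum_nth atLeast0LessThan)
  also have "\<dots> = (\<Sum>i=1..length xs. f (xs ! (i - 1)))"
    by (rule sum.reindex_bij_witness[of _ "\<lambda>i. i - 1" Suc]) auto
  finally show ?thesis .
qed

theorem theorem2p5:
  fixes L :: "real \<Rightarrow> real" and k E :: "complex set" and A B :: real
    and h :: "complex poly fract"
  assumes "loxton_function L" and "mono_on {0..} L"
    and "number_field k"
    and "loxton_pair L k B E"
    and "h \<in> ratfuns_over (cyc_closure k)" and "nonconstant h"
    and "A \<ge> 1"
    and "\<nexists>w. short_witness L k B E A h w"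
  shows "avoiding (bounded_house_ints A) (cyc_closure k) h"
proof (rule ccontr)
  define F where "F = cyc_closure k"
  define p q where "p = fst (quot_of_fract h)" and "q = snd (quot_of_fract h)"
  define bad where "bad = {a \<in> F. poly q a \<noteq> 0 \<and> poly p a / poly q a \<in> bounded_house_ints A}"
  assume "\<not> avoiding (bounded_house_ints A) (cyc_closure k) h"
  hence inf: "infinite bad"
    by (simp add: avoiding_def bad_def F_def regular_at_def ratfun_eval_def p_def q_def)
  have F: "complex_subfield F" unfolding F_def cyc_closure_def by (rule complex_subfield_field_adjoin)
  interpret F: subring_set F by (rule complex_subfield_subring_set[OF F])
  have F_div: "x / y \<in> F" if "x \<in> F" "y \<in> F" for x y
    using F.mult_mem[OF that(1), of "inverse y"] that F by (simp add: complex_subfield_def divide_inverse)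
  have alg: "algebraic x" if "x \<in> F" for x
    using cyc_closure_algebraic[OF assms(3)] that by (simp add: F_def)
  have pq: "p \<in> polys_over F" "q \<in> polys_over F"
    using quot_of_fract_over_subfield(1,2)[OF F] assms(5) by (auto simp: p_def q_def F_def)
  obtain u v where uv: "u \<in> polys_over F" "v \<in> polys_over F" "u * p + v * q = 1"
    using quot_of_fract_over_subfield(3)[OF F] assms(5) unfolding p_def q_def F_def by blast
  have m: "max (degree p) (degree q) > 0"
    unfolding p_def q_def by (rule nonconstant_degree[OF assms(6)])
  obtain c :: nat and R where c: "c > 0" and R: "\<forall>\<alpha>\<in>F. poly q \<alpha> \<noteq> 0 \<longrightarrow>
      poly p \<alpha> / poly q \<alpha> \<in> bounded_house_ints A \<longrightarrow>
      of_nat c / poly q \<alpha> \<in> bounded_house_ints R \<and> of_nat c * \<alpha> / poly q \<alpha> \<in> bounded_house_ints R"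
    using denominator_and_house_of_quotients[OF F alg pq m uv, of A] by blast
  have E: "E \<subseteq> k" "finite E" using assms(4) by (simp_all add: loxton_pair_def)
  have EF: "E \<subseteq> F" "roots_of_unity \<subseteq> F"
    using E(1) subset_field_adjoin unfolding F_def cyc_closure_def by blast+

  define N where "N = nat \<lfloor>L (A * B)\<rfloor> + 2 * nat \<lfloor>L (B * R)\<rfloor>"
  \<comment> \<open>The bound on \<open>length xs\<close> is kept apart from \<open>N\<close>: only
    \<open>xs\<close> becomes the witness, and its length must not exceed
    \<open>L (A * B)\<close>.\<close>
  define rep where "rep = (\<lambda>\<alpha> (xs, ys, zs). set (xs @ ys @ zs) \<subseteq> E \<times> roots_of_unity \<and>
    real (length xs) \<le> L (A * B) \<and> length (xs @ ys @ zs) \<le> N \<and>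
    pair_sum xs = poly p \<alpha> / poly q \<alpha> \<and> pair_sum ys = of_nat c / poly q \<alpha> \<and>
    pair_sum zs = of_nat c * \<alpha> / poly q \<alpha>)"
  define size where "size = (\<lambda>(xs, ys, zs). length (xs @ ys @ zs :: (complex \<times> complex) list))"
  have ex_rep: "\<exists>t. rep \<alpha> t" if "\<alpha> \<in> bad" for \<alpha>
  proof -
    have \<alpha>: "\<alpha> \<in> F" "poly q \<alpha> \<noteq> 0" "poly p \<alpha> / poly q \<alpha> \<in> bounded_house_ints A"
      using that by (auto simp: bad_def)
    have "poly p \<alpha> / poly q \<alpha> \<in> F" "of_nat c / poly q \<alpha> \<in> F" "of_nat c * \<alpha> / poly q \<alpha> \<in> F"
      using \<alpha>(1) pq by (auto intro!: F_div F.mult_mem F.poly_mem F.of_nat_mem)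
    note lox = this[unfolded F_def, THEN loxton_pair_pair_sum[OF assms(4,2)]]
    obtain xs where xs: "set xs \<subseteq> E \<times> roots_of_unity" "real (length xs) \<le> L (B * A)"
        "pair_sum xs = poly p \<alpha> / poly q \<alpha>"
      using lox(1)[OF \<alpha>(3)] by blast
    obtain ys where ys: "set ys \<subseteq> E \<times> roots_of_unity" "real (length ys) \<le> L (B * R)"
        "pair_sum ys = of_nat c / poly q \<alpha>"
      using lox(2)[of R] R \<alpha> by blast
    obtain zs where zs: "set zs \<subseteq> E \<times> roots_of_unity" "real (length zs) \<le> L (B * R)"
        "pair_sum zs = of_nat c * \<alpha> / poly q \<alpha>"
      using lox(3)[of R] R \<alpha> by blast
    have "length xs \<le> nat \<lfloor>L (A * B)\<rfloor>" "length ys \<le> nat \<lfloor>L (B * R)\<rfloor>" "length zs \<le> nat \<lfloor>L (B * R)\<rfloor>"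
      using xs(2) ys(2) zs(2) by (simp_all add: le_nat_floor mult.commute)
    hence "length (xs @ ys @ zs) \<le> N" by (simp add: N_def)
    thus ?thesis
      using xs ys zs by (intro exI[of _ "(xs, ys, zs)"]) (simp add: rep_def mult.commute)
  qed

  \<comment> \<open>This set depends on \<open>E\<close>, \<open>p\<close> and \<open>q\<close>
    only; it is fixed before \<alpha>, so \<open>card X\<close> may enter the threshold
    \<open>M0\<close>.\<close>
  obtain X where X: "finite X" "subring_set (span_over \<rat> X)"
    "E \<union> coeff p ` {..degree p} \<union> coeff q ` {..degree q} \<subseteq> span_over \<rat> X"
  proof -
    have fin: "finite (E \<union> coeff p ` {..degree p} \<union> coeff q ` {..degree q})" using E(2) by simp
    have sub: "E \<union> coeff p ` {..degree p} \<union> coeff q ` {..degree q} \<subseteq> integral_closure \<rat>"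
      using EF(1) coeff_mem[OF pq(1)] coeff_mem[OF pq(2)] alg
      by (auto simp flip: algebraic_iff_integral_closure)
    show ?thesis
      using integral_closure_finite_span[OF subring_set_Rats fin sub] by (elim exE conjE) (rule that)
  qed
  have pqX: "p \<in> polys_over (span_over \<rat> X)" "q \<in> polys_over (span_over \<rat> X)"
    using X(3) by (intro polys_over_if_coeffs[OF X(2)]; simp)+
  define m where "m = max (degree p) (degree q)"
  obtain M0 where M0: "\<forall>M\<ge>M0. \<forall>r. 2 ^ r \<le> M \<longrightarrow> (2 * (m + 1) * card X * (r + 1)) ^ N < M"
    using polylog_less by blast
  have "\<not> bad \<subseteq> {pair_sum zs / pair_sum ys | ys zs M. 0 < M \<and> M < M0 \<and>
    set (ys @ zs) \<subseteq> E \<times> {\<xi>. \<xi> ^ M = 1} \<and> length (ys @ zs) \<le> N}"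
    using finite_subset[OF _ finite_small_exponent_quotients[OF E(2)]] inf by blast
  then obtain \<alpha> where \<alpha>: "\<alpha> \<in> bad" and \<alpha>': "\<alpha> \<notin> {pair_sum zs / pair_sum ys | ys zs M. 0 < M \<and> M < M0 \<and>
    set (ys @ zs) \<subseteq> E \<times> {\<xi>. \<xi> ^ M = 1} \<and> length (ys @ zs) \<le> N}" by blast
  obtain t where t: "rep \<alpha> t" and t_min: "\<And>t'. rep \<alpha> t' \<Longrightarrow> size t \<le> size t'"
    using ex_rep[OF \<alpha>] ex_has_least_nat[of "rep \<alpha>" _ size] by blast
  obtain xs ys zs where txyz: "t = (xs, ys, zs)" by (cases t)
  define ts where "ts = xs @ ys @ zs"
  have ts: "set ts \<subseteq> E \<times> roots_of_unity" "real (length xs) \<le> L (A * B)" "length ts \<le> N"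
      "pair_sum xs = poly p \<alpha> / poly q \<alpha>" "pair_sum ys = of_nat c / poly q \<alpha>"
      "pair_sum zs = of_nat c * \<alpha> / poly q \<alpha>"
    using t by (simp_all add: txyz rep_def ts_def)
  have q\<alpha>: "poly q \<alpha> \<noteq> 0" using \<alpha> by (simp add: bad_def)
  have fst_snd: "fst ` set ts \<subseteq> E" "snd ` set ts \<subseteq> roots_of_unity"
    using ts(1) by (auto simp: subset_iff)
  have minimal: "\<forall>P. pair_sum (filter P xs) = pair_sum xs \<longrightarrow> pair_sum (filter P ys) = pair_sum ys \<longrightarrow>
    pair_sum (filter P zs) = pair_sum zs \<longrightarrow> (\<forall>t\<in>set ts. P t)"
  proof (intro allI impI, rule ccontr)
    fix P
    assume P: "pair_sum (filter P xs) = pair_sum xs" "pair_sum (filter P ys) = pair_sum ys"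
      "pair_sum (filter P zs) = pair_sum zs"
    assume "\<not> (\<forall>t\<in>set ts. P t)"
    hence less: "length (filter P ts) < length ts" by (auto intro: length_filter_less)
    have "real (length (filter P xs)) \<le> L (A * B)"
      using length_filter_le[of P xs] ts(2) by linarith
    hence "rep \<alpha> (filter P xs, filter P ys, filter P zs)"
      using ts P less by (auto simp: rep_def ts_def)
    hence "length ts \<le> length (filter P ts)"
      using t_min by (fastforce simp: size_def txyz ts_def)
    thus False using less by simp
  qed
  \<comment> \<open>Being least, this exponent excludes the smaller exponent \<open>g\<close> that a
    constant \<open>S\<close> would produce.\<close>
  define M where "M = (LEAST M. M > 0 \<and> (\<forall>\<xi>\<in>snd ` set ts. \<xi> ^ M = 1))"
  have M: "M > 0" "\<forall>\<xi>\<in>snd ` set ts. \<xi> ^ M = 1"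
    using LeastI_ex[OF ex_common_exponent[OF _ fst_snd(2)]] unfolding M_def by simp_all
  have M_least: "\<forall>g>0. g < M \<longrightarrow> (\<exists>\<xi>\<in>snd ` set ts. \<xi> ^ g \<noteq> 1)"
    using not_less_Least[of _ "\<lambda>M. M > 0 \<and> (\<forall>\<xi>\<in>snd ` set ts. \<xi> ^ M = 1)"]
    unfolding M_def by blast
  have "M \<ge> M0"
  proof (rule ccontr)
    assume "\<not> M \<ge> M0"
    moreover have "set (ys @ zs) \<subseteq> E \<times> {\<xi>. \<xi> ^ M = 1}"
      using ts(1) M(2) by (force simp: ts_def)
    moreover have "\<alpha> = pair_sum zs / pair_sum ys" using ts(5,6) q\<alpha> c by simp
    moreover have "length (ys @ zs) \<le> N" using ts(3) by (simp add: ts_def)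
    ultimately have "\<alpha> \<in> {pair_sum zs / pair_sum ys | ys zs M. 0 < M \<and> M < M0 \<and>
        set (ys @ zs) \<subseteq> E \<times> {\<xi>. \<xi> ^ M = 1} \<and> length (ys @ zs) \<le> N}"
      using M(1) not_le by blast
    thus False using \<alpha>' by contradiction
  qed
  have large: "\<forall>r. 2 ^ r \<le> M \<longrightarrow> (2 * (m + 1) * card X * (r + 1)) ^ length ts < M"
  proof (intro allI impI)
    fix r :: nat assume r: "2 ^ r \<le> M"
    have "X \<noteq> {}" using subring_set.one_mem[OF X(2)] by (auto simp: span_over_def)
    hence "1 \<le> 2 * (m + 1) * card X * (r + 1)" using X(1) by (simp add: Suc_le_eq card_gt_0_iff)
    hence "(2 * (m + 1) * card X * (r + 1)) ^ length ts \<le> (2 * (m + 1) * card X * (r + 1)) ^ N"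
      using ts(3) by (intro power_increasing) auto
    also have "\<dots> < M" using M0 \<open>M \<ge> M0\<close> r by blast
    finally show "(2 * (m + 1) * card X * (r + 1)) ^ length ts < M" .
  qed

  have deg: "degree p \<le> m" "degree q \<le> m" by (simp_all add: m_def)
  have fstX: "fst ` set ts \<subseteq> span_over \<rat> X" using fst_snd(1) X(3) by blast
  obtain b w U V S where S:
    "\<forall>\<xi>\<in>snd ` set ts. b \<xi> \<in> roots_of_unity"
    "\<forall>A. subring_set A \<longrightarrow> fst ` set ts \<subseteq> A \<longrightarrow> roots_of_unity \<subseteq> A \<longrightarrow> U \<in> polys_over A \<and> V \<in> polys_over A"
    "U \<noteq> 0" "S = to_fract V / to_fract U" "nonconstant S"
    "(\<Sum>t\<leftarrow>xs. ratfun_const (fst t * b (snd t)) * ratfun_X powi w (snd t)) =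
      poly (map_poly ratfun_const p) S / poly (map_poly ratfun_const q) S"
    using torsion_relations_lift[OF ts_def X(1,2) pqX deg fstX fst_snd(2) c q\<alpha> ts(4-6) minimal
        M M_least large]
    by (elim exE conjE)
  have "U \<in> polys_over F \<and> V \<in> polys_over F"
    using S(2) F.subring_set_axioms order.trans[OF fst_snd(1) EF(1)] EF(2) by simp
  hence S_over: "S \<in> ratfuns_over F"
    using S(3,4) by (auto simp: ratfuns_over_def polys_over_def Fract_conv_to_fract)
  define W where "W = (\<Sum>t\<leftarrow>xs. ratfun_const (fst t * b (snd t)) * ratfun_X powi w (snd t))"
  have "witness_of_length k E h (length xs) W"
    unfolding witness_of_length_def
  proof (intro exI conjI ballI)
    show "S \<in> ratfuns_over (cyc_closure k)" using S_over by (simp add: F_def)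
    show "nonconstant S" by (fact S(5))
    fix i assume "i \<in> {1..length xs}"
    hence i: "xs ! (i - 1) \<in> set ts" by (auto simp: ts_def)
    show "b (snd (xs ! (i - 1))) \<in> roots_of_unity" using S(1) i by blast
    show "fst (xs ! (i - 1)) \<in> E" using i fst_snd(1) by blast
  next
    show "W = (\<Sum>i=1..length xs. ratfun_const (b (snd (xs ! (i - 1))) * fst (xs ! (i - 1))) *
        ratfun_X powi w (snd (xs ! (i - 1))))"
      unfolding W_def sum_list_eq_sum_nth by (simp add: mult.commute)
    show "W = ratfun_compose h S"
      unfolding W_def S(6) ratfun_compose_def p_def q_def ..
  qed
  hence "short_witness L k B E A h W"
    using ts(2) by (auto simp: short_witness_def)
  thus False using assms(8) by blast
qed

end
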